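(* Let $(Q,\mathfrak{n})$ be a regular local ring and let $f_1,\ldots,f_c\in\mathfrak{n}^2$ be a $Q$-regular sequence such that the initial forms $f_1^*,\ldots,f_c^*$ form a $G(Q)$-regular sequence, where $G(Q)=\bigoplus_{i\ge 0}\mathfrak{n}^i/\mathfrak{n}^{i+1}$. Assume $\operatorname{ord}_Q(f_1)\ge \operatorname{ord}_Q(f_2)\ge\cdots\ge\operatorname{ord}_Q(f_c)$. Set $(A,\mathfrak{m})=(Q/(f_1,\ldots,f_c),\ \mathfrak{n}/(f_1,\ldots,f_c))$. Let $M$ be a finitely generated $A$-module of infinite projective dimension and let $(\mathbb{F},\partial)$ be a minimal free resolution of $M$ as an $A$-module. Then $\operatorname{ord}_A(\partial_i)\le \operatorname{ord}_Q(f_1)-1$ for all $i\gg 0$.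
   Context: For a Noetherian local ring $(A,\mathfrak{m})$ and $x\in\mathfrak{m}^i\setminus\mathfrak{m}^{i+1}$, $\operatorname{ord}_A(x)=i$, and $\operatorname{ord}_A(0)=+\infty$. For a nonzero element $x$ of $Q$, its initial form $x^*$ is its image in $\mathfrak{n}^j/\mathfrak{n}^{j+1}\subseteq G(Q)$ where $j=\operatorname{ord}_Q(x)$. For an $A$-linear map $\phi\colon F\to G$ of finite free $A$-modules written as a matrix $(a_{ij})$ with respect to some bases, if $\phi\neq 0$ then $\operatorname{ord}_A(\phi)=\max\{l \mid a_{ij}\in\mathfrak{m}^l \text{ for all } i,j\}$ (independent of the bases), and $\operatorname{ord}_A(0)=+\infty$. Here $\partial_i\colon F_i\to F_{i-1}$ are the differentials of the minimal free resolution. *)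

theory Defs
  imports "HOL-Algebra.Algebra" "HOL-Library.Extended_Nat"
begin

fun idealpow :: "('a, 'b) ring_scheme \<Rightarrow> 'a set \<Rightarrow> nat \<Rightarrow> 'a set" where
  "idealpow R I 0 = carrier R"
| "idealpow R I (Suc k) = ideal_prod R I (idealpow R I k)"

text \<open>Order of an element w.r.t. an ideal m: the largest i with x in m^i
  (infinity if x lies in every power, e.g. x = 0).\<close>
definition ord_in :: "('a, 'b) ring_scheme \<Rightarrow> 'a set \<Rightarrow> 'a \<Rightarrow> enat" where
  "ord_in R m x = Sup {enat i | i. x \<in> idealpow R m i}"

definition noetherian_ring :: "('a, 'b) ring_scheme \<Rightarrow> bool" where
  "noetherian_ring R \<longleftrightarrow> cring R \<and>
     (\<forall>I. ideal I R \<longrightarrow> (\<exists>S. finite S \<and> S \<subseteq> carrier R \<and> I = Idl\<^bsub>R\<^esub> S))"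

definition local_ring :: "('a, 'b) ring_scheme \<Rightarrow> 'a set \<Rightarrow> bool" where
  "local_ring R m \<longleftrightarrow> cring R \<and> maximalideal m R \<and> (\<forall>m'. maximalideal m' R \<longrightarrow> m' = m)"

definition krull_dim :: "('a, 'b) ring_scheme \<Rightarrow> enat" where
  "krull_dim R = Sup {enat k | k. \<exists>p. (\<forall>i\<le>k. primeideal (p i) R) \<and> (\<forall>i<k. p i \<subset> p (Suc i))}"

definition edim :: "('a, 'b) ring_scheme \<Rightarrow> 'a set \<Rightarrow> nat" where
  "edim R m = (LEAST k. \<exists>S. finite S \<and> S \<subseteq> carrier R \<and> card S = k \<and> m = Idl\<^bsub>R\<^esub> S)"

definition regular_local_ring :: "('a, 'b) ring_scheme \<Rightarrow> 'a set \<Rightarrow> bool" where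
  "regular_local_ring R m \<longleftrightarrow> noetherian_ring R \<and> local_ring R m \<and> krull_dim R = enat (edim R m)"

definition regular_seq :: "('a, 'b) ring_scheme \<Rightarrow> 'a list \<Rightarrow> bool" where
  "regular_seq R xs \<longleftrightarrow> set xs \<subseteq> carrier R \<and>
     (\<forall>i < length xs. \<forall>y \<in> carrier R.
        xs ! i \<otimes>\<^bsub>R\<^esub> y \<in> Idl\<^bsub>R\<^esub> (set (take i xs)) \<longrightarrow> y \<in> Idl\<^bsub>R\<^esub> (set (take i xs))) \<and>
     Idl\<^bsub>R\<^esub> (set xs) \<noteq> carrier R"

definition coset_rep :: "'a set \<Rightarrow> 'a" where
  "coset_rep S = (SOME x. x \<in> S)"

definition graded_carrier :: "('a, 'b) ring_scheme \<Rightarrow> 'a set \<Rightarrow> (nat \<Rightarrow> 'a set) set" where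
  "graded_carrier R m = {g. (\<forall>i. \<exists>r \<in> idealpow R m i. g i = idealpow R m (Suc i) +>\<^bsub>R\<^esub> r)
                  \<and> finite {i. g i \<noteq> idealpow R m (Suc i) +>\<^bsub>R\<^esub> \<zero>\<^bsub>R\<^esub>}}"

definition graded_mult :: "('a, 'b) ring_scheme \<Rightarrow> 'a set \<Rightarrow> (nat \<Rightarrow> 'a set) \<Rightarrow> (nat \<Rightarrow> 'a set) \<Rightarrow> nat \<Rightarrow> 'a set" where
  "graded_mult R m g h k = idealpow R m (Suc k) +>\<^bsub>R\<^esub>
       (\<Oplus>\<^bsub>R\<^esub>i\<in>{..k}. coset_rep (g i) \<otimes>\<^bsub>R\<^esub> coset_rep (h (k - i)))"

definition graded_one :: "('a, 'b) ring_scheme \<Rightarrow> 'a set \<Rightarrow> nat \<Rightarrow> 'a set" where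
  "graded_one R m i = idealpow R m (Suc i) +>\<^bsub>R\<^esub> (if i = 0 then \<one>\<^bsub>R\<^esub> else \<zero>\<^bsub>R\<^esub>)"

definition graded_zero :: "('a, 'b) ring_scheme \<Rightarrow> 'a set \<Rightarrow> nat \<Rightarrow> 'a set" where
  "graded_zero R m i = idealpow R m (Suc i) +>\<^bsub>R\<^esub> \<zero>\<^bsub>R\<^esub>"

definition graded_add :: "('a, 'b) ring_scheme \<Rightarrow> (nat \<Rightarrow> 'a set) \<Rightarrow> (nat \<Rightarrow> 'a set) \<Rightarrow> nat \<Rightarrow> 'a set" where
  "graded_add R g h i = g i <+>\<^bsub>R\<^esub> h i"

text \<open>Associated graded ring G(R) = \<Oplus>_i m^i/m^(i+1); an element is a family
  g with g i a coset of m^(i+1) inside m^i, almost all zero; multiplication is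
  induced by multiplying representatives.\<close>
definition assoc_graded :: "('a, 'b) ring_scheme \<Rightarrow> 'a set \<Rightarrow> (nat \<Rightarrow> 'a set) ring" where
  "assoc_graded R m = \<lparr> carrier = graded_carrier R m, monoid.mult = graded_mult R m,
     one = graded_one R m, ring.zero = graded_zero R m, ring.add = graded_add R \<rparr>"

definition initial_form :: "('a, 'b) ring_scheme \<Rightarrow> 'a set \<Rightarrow> 'a \<Rightarrow> nat \<Rightarrow> 'a set" where
  "initial_form R m x = (\<lambda>j. idealpow R m (Suc j) +>\<^bsub>R\<^esub>
                              (if ord_in R m x = enat j then x else \<zero>\<^bsub>R\<^esub>))"

definition fvec :: "('a, 'b) ring_scheme \<Rightarrow> nat \<Rightarrow> (nat \<Rightarrow> 'a) set" where
  "fvec R k = {v. (\<forall>j<k. v j \<in> carrier R) \<and> (\<forall>j\<ge>k. v j = \<zero>\<^bsub>R\<^esub>)}"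

definition mat_app :: "('a, 'b) ring_scheme \<Rightarrow> (nat \<Rightarrow> nat \<Rightarrow> 'a) \<Rightarrow> nat \<Rightarrow> nat \<Rightarrow> (nat \<Rightarrow> 'a) \<Rightarrow> nat \<Rightarrow> 'a" where
  "mat_app R D l k v = (\<lambda>r. if r < l then (\<Oplus>\<^bsub>R\<^esub>s\<in>{..<k}. D r s \<otimes>\<^bsub>R\<^esub> v s) else \<zero>\<^bsub>R\<^esub>)"

definition is_matrix :: "('a, 'b) ring_scheme \<Rightarrow> (nat \<Rightarrow> nat \<Rightarrow> 'a) \<Rightarrow> nat \<Rightarrow> nat \<Rightarrow> bool" where
  "is_matrix R D l k \<longleftrightarrow> (\<forall>r<l. \<forall>s<k. D r s \<in> carrier R)"

definition mat_ker :: "('a, 'b) ring_scheme \<Rightarrow> (nat \<Rightarrow> nat \<Rightarrow> 'a) \<Rightarrow> nat \<Rightarrow> nat \<Rightarrow> (nat \<Rightarrow> 'a) set" where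
  "mat_ker R D l k = {v \<in> fvec R k. mat_app R D l k v = (\<lambda>_. \<zero>\<^bsub>R\<^esub>)}"

definition mat_im :: "('a, 'b) ring_scheme \<Rightarrow> (nat \<Rightarrow> nat \<Rightarrow> 'a) \<Rightarrow> nat \<Rightarrow> nat \<Rightarrow> (nat \<Rightarrow> 'a) set" where
  "mat_im R D l k = mat_app R D l k ` fvec R k"

definition aug :: "('a, 'm, 'c) module_scheme \<Rightarrow> (nat \<Rightarrow> 'm) \<Rightarrow> nat \<Rightarrow> (nat \<Rightarrow> 'a) \<Rightarrow> 'm" where
  "aug M e k v = (\<Oplus>\<^bsub>M\<^esub>j\<in>{..<k}. v j \<odot>\<^bsub>M\<^esub> e j)"

text \<open>A free resolution  ... -> R^(b 2) -d 2-> R^(b 1) -d 1-> R^(b 0) -aug e-> M -> 0,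
  where d i (i \<ge> 1) is a (b (i-1)) x (b i) matrix.\<close>
definition free_resolution ::
  "('a, 'b) ring_scheme \<Rightarrow> ('a, 'm, 'c) module_scheme \<Rightarrow> (nat \<Rightarrow> nat) \<Rightarrow> (nat \<Rightarrow> nat \<Rightarrow> nat \<Rightarrow> 'a)
     \<Rightarrow> (nat \<Rightarrow> 'm) \<Rightarrow> bool" where
  "free_resolution R M b d e \<longleftrightarrow>
     (\<forall>j < b 0. e j \<in> carrier M) \<and>
     (\<forall>x \<in> carrier M. \<exists>v \<in> fvec R (b 0). aug M e (b 0) v = x) \<and>
     {v \<in> fvec R (b 0). aug M e (b 0) v = \<zero>\<^bsub>M\<^esub>} = mat_im R (d 1) (b 0) (b 1) \<and>
     (\<forall>i\<ge>1. is_matrix R (d i) (b (i - 1)) (b i) \<and>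
        mat_ker R (d i) (b (i - 1)) (b i) = mat_im R (d (Suc i)) (b i) (b (Suc i)))"

definition minimal_resolution ::
  "('a, 'b) ring_scheme \<Rightarrow> 'a set \<Rightarrow> ('a, 'm, 'c) module_scheme \<Rightarrow> (nat \<Rightarrow> nat) \<Rightarrow> (nat \<Rightarrow> nat \<Rightarrow> nat \<Rightarrow> 'a)
     \<Rightarrow> (nat \<Rightarrow> 'm) \<Rightarrow> bool" where
  "minimal_resolution R m M b d e \<longleftrightarrow> free_resolution R M b d e \<and>
     (\<forall>i\<ge>1. \<forall>r < b (i - 1). \<forall>s < b i. d i r s \<in> m)"

definition fin_gen_module :: "('a, 'b) ring_scheme \<Rightarrow> ('a, 'm, 'c) module_scheme \<Rightarrow> bool" where
  "fin_gen_module R M \<longleftrightarrow> (\<exists>S. finite S \<and> S \<subseteq> carrier M \<and>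
     (\<forall>x \<in> carrier M. \<exists>a. (\<forall>s\<in>S. a s \<in> carrier R) \<and> x = (\<Oplus>\<^bsub>M\<^esub>s\<in>S. a s \<odot>\<^bsub>M\<^esub> s)))"

text \<open>Finite projective dimension (for f.g. modules over a Noetherian local ring):
  existence of a finite-length resolution by finite free modules.\<close>
definition finite_proj_dim :: "('a, 'b) ring_scheme \<Rightarrow> ('a, 'm, 'c) module_scheme \<Rightarrow> bool" where
  "finite_proj_dim R M \<longleftrightarrow>
     (\<exists>b d e N. free_resolution R M b d e \<and> (\<forall>i>N. b i = 0))"

text \<open>ord of a map given by an l x k matrix: largest t with all entries in m^t
  (infinity for the zero map).\<close>
definition ord_map :: "('a, 'b) ring_scheme \<Rightarrow> 'a set \<Rightarrow> (nat \<Rightarrow> nat \<Rightarrow> 'a) \<Rightarrow> nat \<Rightarrow> nat \<Rightarrow> enat" where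
  "ord_map R m D l k = Sup {enat t | t. \<forall>r<l. \<forall>s<k. D r s \<in> idealpow R m t}"

definition quot_ideal :: "('a, 'b) ring_scheme \<Rightarrow> 'a set \<Rightarrow> 'a set \<Rightarrow> 'a set set" where
  "quot_ideal R I m = (\<lambda>x. I +>\<^bsub>R\<^esub> x) ` m"

end

theory Submission
  imports Defs "HOL-Library.Function_Algebras" "HOL-Library.Poly_Mapping" "HOL-Library.Multiset"
    "HOL-Computational_Algebra.Polynomial"
begin

text \<open>Lift the resolution to matrices \<open>D\<close> over \<open>Q\<close> and write \<open>D\<^sup>2 = \<Sum> f\<^sub>j T\<^sub>j\<close> with Eisenbud's operators
  \<open>T\<^sub>j\<close> of degree \<open>-2\<close>. If \<open>ord (\<partial>\<^sub>i) \<ge> ord (f\<^sub>1)\<close>, then \<open>D\<^sup>2\<close> has entries in \<open>n ^ (ord (f\<^sub>1) + 1)\<close> on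
  \<open>F\<^sub>i\<^sub>+\<^sub>1\<close>, since \<open>D\<close> is minimal; as the initial forms of the \<open>f\<^sub>j\<close> are regular and their degrees are at
  most \<open>ord (f\<^sub>1)\<close>, all \<open>T\<^sub>j\<close> vanish modulo \<open>n\<close> there. This cannot happen for infinitely many \<open>i\<close>,
  because \<open>Tor\<^sup>A(M, k) = F \<otimes> k\<close> is an Artinian graded module over \<open>k[T\<^sub>1, \<dots>, T\<^sub>c]\<close> (Gulliksen).

  The Artinian property is proved by induction on \<open>c\<close>: passing from \<open>Q/(f\<^sub>1, \<dots>, f\<^sub>c)\<close> to
  \<open>Q/(f\<^sub>1, \<dots>, f\<^sub>c\<^sub>-\<^sub>1)\<close>, a cone construction turns the resolution into one whose homology maps onto the
  kernel of \<open>T\<^sub>c\<close>, and the argument dual to Hilbert's basis theorem applies. For \<open>c = 0\<close> the homology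
  vanishes in high degrees since \<open>n\<close> is generated by a regular sequence, which follows from Krull's
  principal ideal theorem.\<close>

section \<open>Ideals and prime chains\<close>

text \<open>Quotients, localisations and homology modules are never formed. All rings in play are
  quotients of one type class ring, so elements and matrices are lifted once and every claim is a
  congruence modulo an ideal. Homology appears as pairs of preimages, localisation at a prime as
  saturated ideals. The ambient ring need not be Noetherian, so chain conditions concern only ideals
  above the kernel \<open>J\<close>. The obstacle is that \<open>T j\<close> commutes with
  \<open>D\<close> and with the last operator only up to error terms. Regularity controls them: a
  relation among the \<open>f j\<close> has its coefficients in the ideal of the sequence, so the
  errors vanish modulo \<open>N\<close> up to boundaries. For the last operator the error lies in
  the ideal of the earlier elements, which is why the induction removes the last element. The
  operators lower degrees while the homology is unbounded above, so the fitting finiteness condition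
  is the descending one.\<close>

definition ring_ideal :: "'p::comm_ring_1 set \<Rightarrow> bool" where
  "ring_ideal I \<longleftrightarrow> 0 \<in> I \<and> (\<forall>x\<in>I. \<forall>y\<in>I. x + y \<in> I) \<and> (\<forall>a. \<forall>x\<in>I. a * x \<in> I)"

definition prime_subset :: "'p::comm_ring_1 set \<Rightarrow> bool" where
  "prime_subset p \<longleftrightarrow> ring_ideal p \<and> 1 \<notin> p \<and> (\<forall>a b. a * b \<in> p \<longrightarrow> a \<in> p \<or> b \<in> p)"

text \<open>Noetherianity of the quotient by \<open>J\<close>, in the form of maximal
  elements.\<close>

definition max_cond :: "'p::comm_ring_1 set \<Rightarrow> bool" where
  "max_cond J \<longleftrightarrow> (\<forall>C. C \<noteq> {} \<longrightarrow> (\<forall>I\<in>C. ring_ideal I \<and> J \<subseteq> I) \<longrightarrow> (\<exists>M\<in>C. \<forall>I\<in>C. M \<subseteq> I \<longrightarrow> I = M))"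

definition adjoin :: "'p::comm_ring_1 set \<Rightarrow> 'p \<Rightarrow> 'p set" where
  "adjoin K a = {z. \<exists>r. z - r * a \<in> K}"

text \<open>For a prime \<open>p\<close> this is the contraction of the localisation of
  \<open>I\<close> at \<open>p\<close>. An ideal equal to its saturation stands for an ideal of the
  local ring.\<close>

definition sat :: "'p::comm_ring_1 set \<Rightarrow> 'p set \<Rightarrow> 'p set" where
  "sat p I = {a. \<exists>s. s \<notin> p \<and> s * a \<in> I}"

lemma ring_idealD:
  assumes "ring_ideal I"
  shows "0 \<in> I" "x \<in> I \<Longrightarrow> y \<in> I \<Longrightarrow> x + y \<in> I" "x \<in> I \<Longrightarrow> a * x \<in> I" "x \<in> I \<Longrightarrow> x * a \<in> I"
    "x \<in> I \<Longrightarrow> y \<in> I \<Longrightarrow> x - y \<in> I" "x \<in> I \<Longrightarrow> - x \<in> I"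
proof -
  show 1: "0 \<in> I" "x \<in> I \<Longrightarrow> y \<in> I \<Longrightarrow> x + y \<in> I" "x \<in> I \<Longrightarrow> a * x \<in> I" for x y a
    using assms by (auto simp: ring_ideal_def)
  show "x \<in> I \<Longrightarrow> x * a \<in> I" using 1(3)[of x a] by (simp add: mult.commute)
  show "x \<in> I \<Longrightarrow> - x \<in> I" for x using 1(3)[of x "-1"] by simp
  then show "x \<in> I \<Longrightarrow> y \<in> I \<Longrightarrow> x - y \<in> I" using 1(2)[of x "-y"] by simp
qed

lemma ring_ideal_sum: "ring_ideal I \<Longrightarrow> (\<And>i. i \<in> A \<Longrightarrow> g i \<in> I) \<Longrightarrow> sum g A \<in> I"
  by (induction A rule: infinite_finite_induct) (auto intro: ring_idealD)

lemma ring_ideal_cong: "ring_ideal I \<Longrightarrow> x - y \<in> I \<Longrightarrow> x \<in> I \<longleftrightarrow> y \<in> I"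
  using ring_idealD(2)[of I "x - y" y] ring_idealD(5)[of I x "x - y"] by auto

lemma prime_subsetD:
  assumes "prime_subset p"
  shows "ring_ideal p" "1 \<notin> p" "a * b \<in> p \<Longrightarrow> a \<in> p \<or> b \<in> p" "s \<notin> p \<Longrightarrow> s * b \<in> p \<Longrightarrow> b \<in> p"
  using assms by (auto simp: prime_subset_def)

lemma max_condE:
  assumes "max_cond J" "P L" "\<And>I. P I \<Longrightarrow> ring_ideal I \<and> J \<subseteq> I"
  obtains M where "P M" "\<And>I. P I \<Longrightarrow> M \<subseteq> I \<Longrightarrow> I = M"
proof -
  have "Collect P \<noteq> {}" "\<forall>I\<in>Collect P. ring_ideal I \<and> J \<subseteq> I" using assms(2,3) by auto
  from assms(1)[unfolded max_cond_def, THEN spec, THEN mp, OF this(1), THEN mp, OF this(2)] obtain M where "P M" "\<forall>I\<in>Collect P. M \<subseteq> I \<longrightarrow> I = M" by auto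
  then show ?thesis by (intro that[of M]) auto
qed

lemma ring_ideal_adjoin: "ring_ideal K \<Longrightarrow> ring_ideal (adjoin K a)"
  unfolding ring_ideal_def[of "adjoin K a"] unfolding adjoin_def
proof (safe, goal_cases)
  case 1 then show ?case by (auto intro!: exI[of _ 0] ring_idealD)
next
  case (2 x y r r')
  then show ?case using ring_idealD(2)[of K "x - r * a" "y - r' * a"]
    by (intro exI[of _ "r + r'"]) (simp add: algebra_simps)
next
  case (3 b x r)
  then show ?case using ring_idealD(3)[of K "x - r * a" b]
    by (intro exI[of _ "b * r"]) (simp add: algebra_simps)
qed

lemma adjoin_superset: "K \<subseteq> adjoin K a"
  by (auto simp: adjoin_def intro!: exI[of _ 0])

lemma adjoin_mem: "ring_ideal K \<Longrightarrow> a \<in> adjoin K a"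
  by (auto simp: adjoin_def intro!: exI[of _ 1] ring_idealD(1))

lemma adjoin_least: "ring_ideal L \<Longrightarrow> K \<subseteq> L \<Longrightarrow> a \<in> L \<Longrightarrow> adjoin K a \<subseteq> L"
proof
  fix z assume a: "ring_ideal L" "K \<subseteq> L" "a \<in> L" "z \<in> adjoin K a"
  then obtain r where "z - r * a \<in> L" by (auto simp: adjoin_def)
  then show "z \<in> L" using ring_idealD(2)[OF a(1), of "z - r * a" "r * a"] ring_idealD(3)[OF a(1,3)] by simp
qed

lemma adjoin_mono: "K \<subseteq> L \<Longrightarrow> adjoin K a \<subseteq> adjoin L a"
  by (auto simp: adjoin_def)

lemma ring_ideal_sat:
  assumes "prime_subset p" "ring_ideal I"
  shows "ring_ideal (sat p I)"
  unfolding ring_ideal_def[of "sat p I"] unfolding sat_def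
proof (safe, goal_cases)
  case 1 show ?case using assms prime_subsetD(2)[OF assms(1)] by (auto intro!: exI[of _ 1] ring_idealD(1))
next
  case (2 x y s t)
  have "s * t \<notin> p" using 2 prime_subsetD[OF assms(1)] by blast
  moreover have "s * t * (x + y) = t * (s * x) + s * (t * y)" by (simp add: algebra_simps)
  then have "s * t * (x + y) \<in> I" using 2 assms(2) by (auto intro!: ring_idealD(2,3))
  ultimately show ?case by blast
next
  case (3 a x s)
  then have "s * (a * x) \<in> I" using ring_idealD(3)[OF assms(2), of "s*x" a] by (simp add: algebra_simps)
  then show ?case using 3 by blast
qed

lemma sat_superset: "prime_subset p \<Longrightarrow> I \<subseteq> sat p I"
  by (auto simp: sat_def dest: prime_subsetD(2) intro!: exI[of _ 1])

lemma sat_idem: "prime_subset p \<Longrightarrow> sat p (sat p I) \<subseteq> sat p I"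
proof
  fix x assume p: "prime_subset p" and "x \<in> sat p (sat p I)"
  then obtain s t where "s \<notin> p" "t \<notin> p" "t * (s * x) \<in> I" by (auto simp: sat_def)
  moreover have "t * s \<notin> p" using calculation prime_subsetD[OF p] by blast
  ultimately show "x \<in> sat p I" by (auto simp: sat_def mult.assoc intro!: exI[of _ "t * s"])
qed

lemma sat_mono: "I \<subseteq> L \<Longrightarrow> sat p I \<subseteq> sat p L"
  by (auto simp: sat_def)

lemma sat_closedD: "sat p A \<subseteq> A \<Longrightarrow> s \<notin> p \<Longrightarrow> s * a \<in> A \<Longrightarrow> a \<in> A"
  by (auto simp: sat_def)

text \<open>If \<open>p\<close> is minimal over \<open>K0\<close>, the localisation of the quotient by \<open>K0\<close> at \<open>p\<close> is Artinian:
  by Noetherian induction it suffices to pass from \<open>K + (a)\<close> and \<open>K : a\<close> to \<open>K\<close>.\<close>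

lemma saturated_chain_stabilizes:
  assumes N: "max_cond J" and p: "prime_subset p"
    and K0: "ring_ideal K0" "J \<subseteq> K0" "sat p K0 \<subseteq> K0"
    and min: "\<And>q. prime_subset q \<Longrightarrow> K0 \<subseteq> q \<Longrightarrow> q \<subseteq> p \<Longrightarrow> q = p"
    and A: "\<And>i. ring_ideal (A i)" "\<And>i. K0 \<subseteq> A i" "\<And>i. sat p (A i) \<subseteq> A i" "\<And>i::nat. A (Suc i) \<subseteq> A i"
  shows "\<exists>n. \<forall>i\<ge>n. A i = A n"
proof -
  define good where "good K \<longleftrightarrow> (\<forall>A. (\<forall>i. ring_ideal (A i) \<and> K \<subseteq> A i \<and> sat p (A i) \<subseteq> A i \<and> A (Suc (i::nat)) \<subseteq> A i)
     \<longrightarrow> (\<exists>n. \<forall>i\<ge>n. A i = A n))" for K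
  have "good K0"
  proof (rule ccontr)
    assume ng: "\<not> good K0"
    define C where "C K \<longleftrightarrow> ring_ideal K \<and> K0 \<subseteq> K \<and> sat p K \<subseteq> K \<and> \<not> good K" for K
    have "C K0" using ng K0 by (auto simp: C_def)
    then obtain K where K: "C K" and mx: "\<And>I. C I \<Longrightarrow> K \<subseteq> I \<Longrightarrow> I = K"
      by (rule max_condE[OF N, of C]) (use K0(2) in \<open>auto simp: C_def\<close>)
    from K[unfolded C_def] have Ki: "ring_ideal K" "K0 \<subseteq> K" "sat p K \<subseteq> K" "\<not> good K" by auto
    obtain A where A: "\<And>i. ring_ideal (A i)" "\<And>i. K \<subseteq> A i" "\<And>i. sat p (A i) \<subseteq> A i" "\<And>i::nat. A (Suc i) \<subseteq> A i"
      and nst: "\<not> (\<exists>n. \<forall>i\<ge>n. A i = A n)"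
      using Ki(4) unfolding good_def by blast
    have dec: "A j \<subseteq> A i" if "i \<le> j" for i j using lift_Suc_antimono_le[of A, OF A(4) that] .
    show False
    proof (cases "prime_subset K")
      case True
      \<comment> \<open>A saturated ideal that meets the complement of \<open>p\<close> contains 1,
        and the prime \<open>K\<close> does not.\<close>
      have Kp: "K \<subseteq> p"
      proof
        fix s assume "s \<in> K"
        then show "s \<in> p" using sat_closedD[OF Ki(3), of s 1] True prime_subsetD(2) by fastforce
      qed
      have "K = p" using min[OF True Ki(2) Kp] .
      have AU: "A i = UNIV" if nsub: "\<not> A i \<subseteq> p" for i :: nat
      proof -
        obtain s where "s \<in> A i" "s \<notin> p" using nsub by blast
        then have "1 \<in> A i" using sat_closedD[OF A(3)[of i], of s 1] by simp
        then show ?thesis using ring_idealD(3)[OF A(1)[of i], of 1] by auto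
      qed
      show False
      proof (cases "\<exists>n. A n \<subseteq> p")
        case True
        then obtain n where "A n \<subseteq> p" by auto
        then have "\<forall>i\<ge>n. A i = A n" using dec A(2) \<open>K = p\<close> by blast
        then show False using nst by blast
      next
        case False
        then show False using nst AU by blast
      qed
    next
      case False
      have "1 \<notin> K"
      proof
        assume "1 \<in> K"
        then have "A i = UNIV" for i using A(2)[of i] ring_idealD(3)[OF A(1)[of i], of 1] by auto
        then show False using nst by blast
      qed
      then obtain a c where ac: "a * c \<in> K" "a \<notin> K" "c \<notin> K" using False Ki(1) by (auto simp: prime_subset_def)
      \<comment> \<open>Both ideals are strictly larger than \<open>K\<close>: the first gains
        \<open>a\<close>, the second gains \<open>c\<close>. By maximality of \<open>K\<close> both
        are good.\<close>
      let ?K1 = "sat p (adjoin K a)" and ?K2 = "{r. r * a \<in> K}"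
      have i1: "ring_ideal ?K1" using ring_ideal_sat[OF p ring_ideal_adjoin[OF Ki(1)]] .
      have s1: "K \<subseteq> ?K1" "a \<in> ?K1" using sat_superset[OF p] adjoin_superset adjoin_mem[OF Ki(1)] by blast+
      have g1: "good ?K1"
      proof (rule ccontr)
        assume "\<not> good ?K1"
        then have "C ?K1" using i1 s1 Ki(2) sat_idem[OF p] by (auto simp: C_def)
        then show False using mx[OF _ s1(1)] s1(2) ac by blast
      qed
      have col: "ring_ideal {r. r * a \<in> L}" if "ring_ideal L" for L
        using that by (auto simp: ring_ideal_def algebra_simps)
      have cols: "sat p {r. r * a \<in> L} \<subseteq> {r. r * a \<in> L}" if "sat p L \<subseteq> L" for L
        using that by (auto simp: sat_def mult.assoc)
      have s2: "K \<subseteq> ?K2" "c \<in> ?K2" using ring_idealD(4)[OF Ki(1)] ac by (auto simp: mult.commute)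
      have g2: "good ?K2"
      proof (rule ccontr)
        assume "\<not> good ?K2"
        then have "C ?K2" using col[OF Ki(1)] cols[OF Ki(3)] s2 Ki(2) unfolding C_def by blast
        then show False using mx[OF _ s2(1)] s2(2) ac by blast
      qed
      have "\<exists>n. \<forall>i\<ge>n. sat p (adjoin (A i) a) = sat p (adjoin (A n) a)"
        using g1[unfolded good_def, rule_format, of "\<lambda>i. sat p (adjoin (A i) a)"]
          ring_ideal_sat[OF p ring_ideal_adjoin[OF A(1)]] sat_mono[OF adjoin_mono[OF A(2)]]
          sat_idem[OF p] sat_mono[OF adjoin_mono[OF A(4)]] by simp
      then obtain n1 where n1: "\<And>i. i \<ge> n1 \<Longrightarrow> sat p (adjoin (A i) a) = sat p (adjoin (A n1) a)" by blast
      have "\<exists>n. \<forall>i\<ge>n. {r. r * a \<in> A i} = {r. r * a \<in> A n}"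
      proof (rule g2[unfolded good_def, rule_format, of "\<lambda>i. {r. r * a \<in> A i}"])
        fix i show "ring_ideal {r. r * a \<in> A i} \<and> ?K2 \<subseteq> {r. r * a \<in> A i} \<and>
          sat p {r. r * a \<in> A i} \<subseteq> {r. r * a \<in> A i} \<and> {r. r * a \<in> A (Suc i)} \<subseteq> {r. r * a \<in> A i}"
          using col[OF A(1)] cols[OF A(3)] A(2,4) by blast
      qed
      then obtain n2 where n2: "\<And>i. i \<ge> n2 \<Longrightarrow> {r. r * a \<in> A i} = {r. r * a \<in> A n2}" by blast
      let ?n = "max n1 n2"
      have "A i = A ?n" if i: "i \<ge> ?n" for i
      proof
        show "A i \<subseteq> A ?n" using dec[OF i] .
        show "A ?n \<subseteq> A i"
        proof
          fix z assume z: "z \<in> A ?n"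
          \<comment> \<open>The first stationary chain puts \<open>z\<close> into \<open>A i\<close>
            up to a multiple \<open>r * a\<close>, the second one shows that this multiple lies in
            \<open>A i\<close> as well.\<close>
          have "sat p (adjoin (A i) a) = sat p (adjoin (A ?n) a)" using n1[of i] n1[of ?n] i by simp
          then have "z \<in> sat p (adjoin (A i) a)" using z adjoin_superset sat_superset[OF p] by blast
          then obtain s r where s: "s \<notin> p" "s * z - r * a \<in> A i" by (auto simp: sat_def adjoin_def)
          have "s * z - (s * z - r * a) \<in> A ?n"
            using s(2) dec[OF i] ring_idealD(3)[OF A(1) z] ring_idealD(5)[OF A(1)] by blast
          then have "r * a \<in> A i" using n2[of i] n2[of ?n] i by auto
          then have "s * z \<in> A i" using ring_idealD(2)[OF A(1) s(2)] by fastforce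
          then show "z \<in> A i" using sat_closedD[OF A(3) s(1)] by blast
        qed
      qed
      then show False using nst by blast
    qed
  qed
  then show ?thesis using A unfolding good_def by blast
qed

text \<open>Nakayama's lemma after localisation at \<open>p\<close>. The maximal condition replaces
  finite generation: if the claim failed, a maximal proper saturated ideal \<open>L\<close> between
  \<open>Y'\<close> and \<open>Y\<close> would make \<open>Y / L\<close> simple over the local ring,
  so \<open>x\<close> would annihilate it and \<open>Y\<close> would lie in
  \<open>L\<close>.\<close>

lemma saturated_nakayama:
  assumes N: "max_cond J" and p: "prime_subset p"
    and Y: "ring_ideal Y" "sat p Y \<subseteq> Y" and Y': "ring_ideal Y'" "J \<subseteq> Y'" "Y' \<subseteq> Y"
    and x: "x \<in> p" and sub: "\<And>y. y \<in> Y \<Longrightarrow> \<exists>s a. s \<notin> p \<and> a \<in> Y \<and> s * y - x * a \<in> Y'"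
  shows "Y \<subseteq> sat p Y'"
proof (rule ccontr)
  assume ns: "\<not> Y \<subseteq> sat p Y'"
  define C where "C L \<longleftrightarrow> ring_ideal L \<and> Y' \<subseteq> L \<and> L \<subseteq> Y \<and> L \<noteq> Y \<and> sat p L \<subseteq> L" for L
  have "sat p Y' \<subseteq> Y" using sat_mono[OF Y'(3)] Y(2) by blast
  then have "C (sat p Y')" using ns ring_ideal_sat[OF p Y'(1)] sat_superset[OF p] sat_idem[OF p] unfolding C_def by blast
  then obtain L where L: "C L" and mx: "\<And>I. C I \<Longrightarrow> L \<subseteq> I \<Longrightarrow> I = L"
    by (rule max_condE[OF N, of C]) (use Y'(2) in \<open>auto simp: C_def\<close>)
  from L[unfolded C_def] have Li: "ring_ideal L" "Y' \<subseteq> L" "L \<subseteq> Y" "L \<noteq> Y" "sat p L \<subseteq> L" by auto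
  obtain a where a: "a \<in> Y" "a \<notin> L" using Li by auto
  have dich: "sat p (adjoin L z) = Y \<or> sat p (adjoin L z) = L" if z: "z \<in> Y" for z
  proof (rule ccontr)
    assume n: "\<not> ?thesis"
    have "sat p (adjoin L z) \<subseteq> Y" using sat_mono[OF adjoin_least[OF Y(1) Li(3) z]] Y(2) by blast
    moreover have Ls: "L \<subseteq> sat p (adjoin L z)" using adjoin_superset sat_superset[OF p] by blast
    ultimately have "C (sat p (adjoin L z))"
      using n ring_ideal_sat[OF p ring_ideal_adjoin[OF Li(1)]] sat_idem[OF p] Li(2) by (auto simp: C_def)
    then show False using mx Ls n by blast
  qed
  have mem: "z \<in> sat p (adjoin L z)" for z using adjoin_mem[OF Li(1)] sat_superset[OF p] by blast
  have La: "sat p (adjoin L a) = Y" using dich[OF a(1)] mem[of a] a by auto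
  have xa: "x * a \<in> L"
  proof (rule ccontr)
    assume "x * a \<notin> L"
    then have "sat p (adjoin L (x * a)) = Y" using dich[of "x * a"] mem[of "x*a"] ring_idealD(3)[OF Y(1) a(1)] by auto
    then obtain s r where s: "s \<notin> p" "s * a - r * (x * a) \<in> L" using a(1) by (auto simp: sat_def adjoin_def)
    \<comment> \<open>This element is a unit of the local ring, since \<open>x\<close> lies in its
      maximal ideal.\<close>
    have "s - r * x \<notin> p" using s(1) x ring_ideal_cong[OF prime_subsetD(1)[OF p], of s "s - r*x"] ring_idealD(3)[OF prime_subsetD(1)[OF p] x] by simp
    moreover have "(s - r * x) * a \<in> L" using s(2) by (simp add: algebra_simps)
    ultimately show False using sat_closedD[OF Li(5)] a(2) by blast
  qed
  have xY: "x * b \<in> L" if b: "b \<in> Y" for b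
  proof -
    obtain s r where s: "s \<notin> p" "s * b - r * a \<in> L" using b La by (auto simp: sat_def adjoin_def)
    have "s * (x * b) = x * (s * b - r * a) + r * (x * a)" by (simp add: algebra_simps)
    then have "s * (x * b) \<in> L" using s(2) xa Li(1) by (auto intro!: ring_idealD(2,3))
    then show ?thesis using sat_closedD[OF Li(5) s(1)] by blast
  qed
  have "Y \<subseteq> L"
  proof
    fix y assume "y \<in> Y"
    then obtain s b where "s \<notin> p" "b \<in> Y" "s * y - x * b \<in> Y'" using sub by blast
    then have "s * y \<in> L" using xY[of b] Li ring_ideal_cong[OF Li(1), of "s * y" "x * b"] by blast
    then show "y \<in> L" using sat_closedD[OF Li(5) \<open>s \<notin> p\<close>] by blast
  qed
  then show False using Li by blast
qed

text \<open>Krull's principal ideal theorem. If no such \<open>q\<close> existed, the saturations of \<open>(y\<^sup>n) + p0\<close> at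
  \<open>p1\<close>, for any \<open>y\<close> in \<open>p1\<close> outside \<open>p0\<close>, would become stationary, which is absurd.\<close>

lemma prime_between:
  assumes N: "max_cond J" and pr: "prime_subset p0" "prime_subset p1" "prime_subset p2"
    and J: "J \<subseteq> p0" and lt: "p0 \<subset> p1" "p1 \<subset> p2" and x: "x \<in> p2"
  shows "\<exists>q. prime_subset q \<and> p0 \<subseteq> q \<and> x \<in> q \<and> q \<subset> p2"
proof (rule ccontr)
  assume no: "\<not> ?thesis"
  note id = prime_subsetD(1)[OF pr(1)] prime_subsetD(1)[OF pr(2)] prime_subsetD(1)[OF pr(3)]
  have x1: "x \<notin> p1" using no pr lt by blast
  obtain y where y: "y \<in> p1" "y \<notin> p0" using lt by blast
  \<comment> \<open>Krull's symbolic powers of \<open>y\<close> at \<open>p1\<close>, taken modulo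
    \<open>p0\<close>.\<close>
  define Y where "Y n = sat p1 (adjoin p0 (y ^ n))" for n
  have iY: "ring_ideal (Y n)" for n unfolding Y_def by (rule ring_ideal_sat[OF pr(2) ring_ideal_adjoin[OF id(1)]])
  have sY1: "sat p1 (Y n) \<subseteq> Y n" for n unfolding Y_def by (rule sat_idem[OF pr(2)])
  have sY: "sat p2 (Y n) \<subseteq> Y n" for n using sY1[of n] lt(2) by (auto simp: sat_def)
  have p0Y: "p0 \<subseteq> Y n" for n unfolding Y_def using adjoin_superset sat_superset[OF pr(2)] by blast
  have ymem: "y ^ n \<in> adjoin p0 (y ^ n)" for n using adjoin_mem[OF id(1)] .
  have decY: "Y (Suc n) \<subseteq> Y n" for n unfolding Y_def
    by (intro sat_mono adjoin_least[OF ring_ideal_adjoin[OF id(1)] adjoin_superset])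
       (simp add: ring_idealD(3)[OF ring_ideal_adjoin[OF id(1)] ymem])
  define A where "A n = sat p2 (adjoin (Y n) x)" for n
  define K0 where "K0 = sat p2 (adjoin p0 x)"
  have K0: "ring_ideal K0" "J \<subseteq> K0" "sat p2 K0 \<subseteq> K0" "x \<in> K0" "p0 \<subseteq> K0"
    unfolding K0_def using ring_ideal_sat[OF pr(3) ring_ideal_adjoin[OF id(1)]] J adjoin_superset[of p0 x]
      sat_superset[OF pr(3), of "adjoin p0 x"] sat_idem[OF pr(3)] adjoin_mem[OF id(1)] by blast+
  \<comment> \<open>The assumed absence of \<open>q\<close> says exactly that \<open>p2\<close> is
    minimal over \<open>K0\<close>.\<close>
  have "\<exists>n. \<forall>i\<ge>n. A i = A n"
  proof (rule saturated_chain_stabilizes[OF N pr(3) K0(1,2,3)])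
    fix q assume "prime_subset q" "K0 \<subseteq> q" "q \<subseteq> p2"
    then show "q = p2" using no K0(4,5) by blast
  next
    fix i
    show "ring_ideal (A i)" unfolding A_def by (rule ring_ideal_sat[OF pr(3) ring_ideal_adjoin[OF iY]])
    show "K0 \<subseteq> A i" unfolding A_def K0_def by (intro sat_mono adjoin_mono p0Y)
    show "sat p2 (A i) \<subseteq> A i" unfolding A_def by (rule sat_idem[OF pr(3)])
    show "A (Suc i) \<subseteq> A i" unfolding A_def by (intro sat_mono adjoin_mono decY)
  qed
  then obtain n where n: "A (Suc n) = A n" by (metis le_Suc_eq order_refl)
  have "Y n \<subseteq> sat p2 (Y (Suc n))"
  proof (rule saturated_nakayama[OF N pr(3) iY sY iY _ decY x])
    show "J \<subseteq> Y (Suc n)" using J p0Y by blast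
    fix z assume z: "z \<in> Y n"
    have "Y n \<subseteq> A n" unfolding A_def by (rule order.trans[OF adjoin_superset sat_superset[OF pr(3)]])
    then have "z \<in> A (Suc n)" using z n by auto
    then obtain s r where s: "s \<notin> p2" "s * z - r * x \<in> Y (Suc n)" by (auto simp: A_def sat_def adjoin_def)
    have "s * z - (s * z - r * x) \<in> Y n" using decY s(2) ring_idealD(3)[OF iY z] ring_idealD(5)[OF iY] by blast
    \<comment> \<open>Since \<open>x\<close> is outside \<open>p1\<close> and \<open>Y n\<close> is
      saturated at \<open>p1\<close>, the factor \<open>x\<close> cancels. Stationarity modulo
      \<open>x\<close> thus becomes the hypothesis of Nakayama's lemma.\<close>
    then have "x * r \<in> Y n" by (simp add: mult.commute)
    then have "r \<in> Y n" using sat_closedD[OF sY1 x1] by blast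
    then show "\<exists>s a. s \<notin> p2 \<and> a \<in> Y n \<and> s * z - x * a \<in> Y (Suc n)" using s by (auto simp: mult.commute)
  qed
  then have "y ^ n \<in> Y (Suc n)" using sY ymem[of n] sat_superset[OF pr(2)] unfolding Y_def by blast
  then obtain s r where s: "s \<notin> p1" "s * y ^ n - r * y ^ Suc n \<in> p0" by (auto simp: Y_def sat_def adjoin_def)
  have yn: "y ^ m \<notin> p0" for m by (induction m) (auto simp: y(2) prime_subsetD(2)[OF pr(1)] dest: prime_subsetD(3)[OF pr(1)])
  have "y ^ n * (s - r * y) \<in> p0" using s(2) by (simp add: algebra_simps)
  then have "s - r * y \<in> p1" using prime_subsetD(4)[OF pr(1) yn] lt by blast
  then show False using s(1) ring_ideal_cong[OF id(2), of s "r * y"] ring_idealD(3)[OF id(2) y(1)] by blast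
qed

section \<open>Chains of primes and regularity of parameters\<close>

definition prime_chain :: "(nat \<Rightarrow> 'p::comm_ring_1 set) \<Rightarrow> nat \<Rightarrow> bool" where
  "prime_chain q m \<longleftrightarrow> (\<forall>i\<le>m. prime_subset (q i)) \<and> (\<forall>i<m. q i \<subset> q (Suc i))"

lemma prime_chain_mono: "prime_chain q m \<Longrightarrow> i \<le> m \<Longrightarrow> q 0 \<subseteq> q i"
proof (induction i)
  case (Suc i)
  then have "q i \<subset> q (Suc i)" by (auto simp: prime_chain_def)
  then show ?case using Suc by auto
qed simp

text \<open>Forcing \<open>x\<close> into the bottom of a chain costs one step of length:
  \<open>prime_between\<close> replaces the member below the top by one containing \<open>x\<close>,
  and the induction repeats this further down.\<close>

lemma prime_chain_through:
  assumes N: "max_cond J"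
  shows "prime_chain p (Suc m) \<Longrightarrow> J \<subseteq> p 0 \<Longrightarrow> x \<in> p (Suc m) \<Longrightarrow>
    \<exists>q. prime_chain q m \<and> x \<in> q 0 \<and> p 0 \<subseteq> q 0 \<and> q m = p (Suc m)"
proof (induction m arbitrary: p)
  case 0
  then show ?case by (intro exI[of _ "\<lambda>_. p 1"]) (auto simp: prime_chain_def)
next
  case (Suc m)
  have ext: ?case if q: "prime_chain q m" "x \<in> q 0" "p 0 \<subseteq> q 0" "q m \<subset> p (Suc (Suc m))" for q
  proof (intro exI conjI)
    show "prime_chain (\<lambda>i. if i \<le> m then q i else p (Suc (Suc m))) (Suc m)"
      using q Suc.prems(1) by (auto simp: prime_chain_def le_Suc_eq less_Suc_eq)
  qed (use q in auto)
  show ?case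
  proof (cases "x \<in> p (Suc m)")
    case True
    have "prime_chain p (Suc m)" using Suc.prems(1) by (auto simp: prime_chain_def)
    from Suc.IH[OF this Suc.prems(2) True] obtain q where "prime_chain q m" "x \<in> q 0" "p 0 \<subseteq> q 0" "q m = p (Suc m)" by blast
    then show ?thesis using ext[of q] Suc.prems(1) by (auto simp: prime_chain_def)
  next
    case False
    have pm: "prime_subset (p m)" "prime_subset (p (Suc m))" "prime_subset (p (Suc (Suc m)))"
      "p m \<subset> p (Suc m)" "p (Suc m) \<subset> p (Suc (Suc m))" using Suc.prems(1) by (auto simp: prime_chain_def)
    have "J \<subseteq> p m" using Suc.prems(2) prime_chain_mono[OF Suc.prems(1), of m] by auto
    from prime_between[OF N pm(1-3) this pm(4,5) Suc.prems(3)] obtain r where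
      r: "prime_subset r" "p m \<subseteq> r" "x \<in> r" "r \<subset> p (Suc (Suc m))" by blast
    have "p m \<noteq> r" using False r(3) pm(4) by blast
    define p' where "p' i = (if i \<le> m then p i else r)" for i
    have c: "prime_chain p' (Suc m)" 
      using Suc.prems(1) r \<open>p m \<noteq> r\<close> by (auto simp: prime_chain_def p'_def le_Suc_eq less_Suc_eq)
    have "J \<subseteq> p' 0" "x \<in> p' (Suc m)" "p' 0 = p 0" using Suc.prems r by (auto simp: p'_def)
    from Suc.IH[OF c this(1,2)] obtain q where "prime_chain q m" "x \<in> q 0" "p 0 \<subseteq> q 0" "q m = r"
      by (auto simp: p'_def)
    then show ?thesis using ext[of q] r by auto
  qed
qed

primrec gen_ideal :: "'p::comm_ring_1 set \<Rightarrow> (nat \<Rightarrow> 'p) \<Rightarrow> nat \<Rightarrow> 'p set" where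
  "gen_ideal J f 0 = J"
| "gen_ideal J f (Suc s) = adjoin (gen_ideal J f s) (f s)"

lemma gen_ideal_ideal: "ring_ideal J \<Longrightarrow> ring_ideal (gen_ideal J f s)"
  by (induction s) (auto intro: ring_ideal_adjoin)

lemma gen_ideal_superset: "J \<subseteq> gen_ideal J f s"
  by (induction s) (use adjoin_superset in auto)

lemma gen_ideal_mono: "i \<le> j \<Longrightarrow> gen_ideal J f i \<subseteq> gen_ideal J f j"
  by (induction j) (use adjoin_superset in \<open>auto simp: le_Suc_eq\<close>)

lemma gen_ideal_least: "ring_ideal L \<Longrightarrow> J \<subseteq> L \<Longrightarrow> (\<And>j. j < s \<Longrightarrow> f j \<in> L) \<Longrightarrow> gen_ideal J f s \<subseteq> L"
  by (induction s) (simp_all add: adjoin_least)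

lemma gen_ideal_mem: "ring_ideal J \<Longrightarrow> j < s \<Longrightarrow> f j \<in> gen_ideal J f s"
  using gen_ideal_mono[of "Suc j" s J f] adjoin_mem[OF gen_ideal_ideal[of J f j], of "f j"] by auto

definition regular_mod :: "'p::comm_ring_1 set \<Rightarrow> (nat \<Rightarrow> 'p) \<Rightarrow> nat \<Rightarrow> bool" where
  "regular_mod J f s \<longleftrightarrow> (\<forall>j<s. \<forall>a. f j * a \<in> gen_ideal J f j \<longrightarrow> a \<in> gen_ideal J f j)"

text \<open>Every \<open>gen_ideal J x i\<close> is prime: going down from \<open>N\<close>, the bottom \<open>q 0\<close> of a chain of length
  \<open>e - i + 1\<close> above \<open>gen_ideal J x (i - 1)\<close> avoids \<open>x (i - 1)\<close> and lies in \<open>gen_ideal J x i\<close>, so it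
  equals \<open>gen_ideal J x (i - 1)\<close> by Nakayama.\<close>

lemma regular_of_prime_chain:
  assumes M: "max_cond J" and J: "ring_ideal J" and N: "prime_subset N" and loc: "\<And>q. prime_subset q \<Longrightarrow> J \<subseteq> q \<Longrightarrow> q \<subseteq> N"
    and unit: "\<And>s. s \<notin> N \<Longrightarrow> \<exists>t. t * s - 1 \<in> J"
    and gen: "N = gen_ideal J x e" and ch: "prime_chain p e" "J \<subseteq> p 0"
  shows "regular_mod J x e"
proof -
  let ?P = "gen_ideal J x"
  have Pi: "ring_ideal (?P i)" for i using gen_ideal_ideal[OF J] .
  have JP: "J \<subseteq> ?P i" for i using gen_ideal_superset .
  have xN: "x i \<in> N" if "i < e" for i unfolding gen using gen_ideal_mem[OF J that] .
  have thr: "\<exists>q. prime_chain q m \<and> x i \<in> q 0 \<and> p 0 \<subseteq> q 0" if c: "prime_chain p (Suc m)" "J \<subseteq> p 0" and i: "i < e" for p m i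
  proof (cases "p (Suc m) = N")
    case True
    then show ?thesis using prime_chain_through[OF M c(1,2), of "x i"] xN[OF i] by auto
  next
    case False
    \<comment> \<open>The top need not contain \<open>x i\<close>, so \<open>N\<close> is appended
      first; the resulting chain is one step too long and loses its top again.\<close>
    have "p (Suc m) \<subset> N"
      using False loc c prime_chain_mono[OF c(1), of "Suc m"] by (auto simp: prime_chain_def)
    then have c': "prime_chain (\<lambda>i. if i \<le> Suc m then p i else N) (Suc (Suc m))"
      using c(1) N by (auto simp: prime_chain_def le_Suc_eq less_Suc_eq)
    obtain q where "prime_chain q (Suc m)" "x i \<in> q 0" "p 0 \<subseteq> q 0"
      using prime_chain_through[OF M c', of "x i"] c(2) xN[OF i] by auto
    moreover from this(1) have "prime_chain q m" by (auto simp: prime_chain_def)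
    ultimately show ?thesis by blast
  qed
  have absorb: "?P (Suc i) \<subseteq> q" if "prime_subset q" "?P i \<subseteq> q" "x i \<in> q" for q i
    using adjoin_least[OF prime_subsetD(1)[OF that(1)] that(2,3)] by simp
  \<comment> \<open>Modulo \<open>?P i\<close> the dimension is at most \<open>e - i\<close>, as
    each further parameter shortens a chain by at most one step. The bound \<open>lower\<close> is
    the converse and starts from the given chain of length \<open>e\<close>.\<close>
  have upper: "m \<le> e - i" if "i \<le> e" "prime_chain q m" "?P i \<subseteq> q 0" for i q m
    using that
  proof (induction "e - i" arbitrary: i q m)
    case 0
    then have "N \<subseteq> q 0" using gen by simp
    show ?case
    proof (rule ccontr)
      assume "\<not> ?thesis"
      then have "q 0 \<subset> q 1" "prime_subset (q 1)" using 0 by (auto simp: prime_chain_def)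
      then show False using loc[of "q 1"] \<open>N \<subseteq> q 0\<close> JP 0 by blast
    qed
  next
    case (Suc k)
    show ?case
    proof (cases m)
      case (Suc m')
      have "J \<subseteq> q 0" "i < e" using JP[of i] Suc.prems \<open>Suc k = e - i\<close> by auto
      then obtain r where r: "prime_chain r m'" "x i \<in> r 0" "q 0 \<subseteq> r 0"
        using thr[of q m' i] Suc Suc.prems(2) by blast
      then have "?P (Suc i) \<subseteq> r 0" using absorb[of "r 0" i] Suc.prems by (auto simp: prime_chain_def)
      then have "m' \<le> e - Suc i" using Suc.hyps(1)[of "Suc i" r m'] Suc.hyps(2) r by simp
      then show ?thesis using Suc Suc.hyps by simp
    qed simp
  qed
  have lower: "\<exists>q. prime_chain q (e - i) \<and> ?P i \<subseteq> q 0" if "i \<le> e" for i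
    using that
  proof (induction i)
    case 0 then show ?case using ch by auto
  next
    case (Suc i)
    then obtain q where q: "prime_chain q (e - i)" "?P i \<subseteq> q 0" by auto
    have "e - i = Suc (e - Suc i)" using Suc by simp
    then obtain r where "prime_chain r (e - Suc i)" "x i \<in> r 0" "q 0 \<subseteq> r 0"
      using thr[of q "e - Suc i" i] q JP[of i] Suc by auto
    then show ?case using absorb[of "r 0" i] q by (auto simp: prime_chain_def)
  qed
  have step: "prime_subset (?P i) \<and> x i \<notin> ?P i" if i: "i < e" and pr: "prime_subset (?P (Suc i))" for i
  proof -
    obtain q where q: "prime_chain q (e - i)" "?P i \<subseteq> q 0" using lower[of i] i by auto
    have q0: "prime_subset (q 0)" using q by (auto simp: prime_chain_def)
    have xq: "x i \<notin> q 0"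
    proof
      assume "x i \<in> q 0"
      then have "?P (Suc i) \<subseteq> q 0" using absorb[OF q0 q(2)] by blast
      then show False using upper[of "Suc i" q "e - i"] q i by simp
    qed
    have "e - i = Suc (e - Suc i)" using i by simp
    then obtain r where r: "prime_chain r (e - Suc i)" "x i \<in> r 0" "q 0 \<subseteq> r 0"
      using thr[of q "e - Suc i" i] q JP[of i] i by auto
    have Pr: "?P (Suc i) \<subseteq> r 0" using absorb[of "r 0" i] r q by (auto simp: prime_chain_def)
    \<comment> \<open>Otherwise the prime \<open>?P (Suc i)\<close> could be placed below
      \<open>r\<close>, and the longer chain would violate \<open>upper\<close>.\<close>
    have "r 0 = ?P (Suc i)"
    proof (rule ccontr)
      assume "r 0 \<noteq> ?P (Suc i)"
      then have "prime_chain (case_nat (?P (Suc i)) r) (Suc (e - Suc i))"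
        using r(1) Pr pr by (auto simp: prime_chain_def split: nat.splits)
      then have "Suc (e - Suc i) \<le> e - Suc i" using upper[of "Suc i"] i by (metis Suc_leI Nitpick.case_nat_unfold order_refl)
      then show False by simp
    qed
    then have qP: "q 0 \<subseteq> ?P (Suc i)" using r by simp
    \<comment> \<open>Elements outside \<open>N\<close> are units modulo \<open>J\<close>, so
      saturation at \<open>N\<close> adds nothing.\<close>
    have satN: "sat N L \<subseteq> L" if L: "ring_ideal L" "J \<subseteq> L" for L
    proof
      fix a assume "a \<in> sat N L"
      then obtain s where s: "s \<notin> N" "s * a \<in> L" by (auto simp: sat_def)
      then obtain t where "t * s - 1 \<in> J" using unit by blast
      then have "(t * s - 1) * a \<in> L" "t * (s * a) \<in> L" using L s ring_idealD(3,4)[OF L(1)] by auto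
      moreover have "a = t * (s * a) - (t * s - 1) * a" by (simp add: algebra_simps)
      ultimately show "a \<in> L" using ring_idealD(5)[OF L(1)] by metis
    qed
    have "q 0 \<subseteq> sat N (?P i)"
    proof (rule saturated_nakayama[OF M N prime_subsetD(1)[OF q0] _ Pi JP q(2) xN[OF i]])
      show "sat N (q 0) \<subseteq> q 0" using satN[OF prime_subsetD(1)[OF q0]] JP q(2) by blast
      fix y assume y: "y \<in> q 0"
      then obtain b where b: "y - b * x i \<in> ?P i" using qP by (auto simp: adjoin_def)
      then have "y - (y - b * x i) \<in> q 0" using ring_idealD(5)[OF prime_subsetD(1)[OF q0] y] q(2) by blast
      then have "x i * b \<in> q 0" by (simp add: mult.commute)
      then have "b \<in> q 0" using prime_subsetD(4)[OF q0 xq] by blast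
      then show "\<exists>s a. s \<notin> N \<and> a \<in> q 0 \<and> s * y - x i * a \<in> ?P i"
        using b prime_subsetD(2)[OF N] by (intro exI[of _ 1] exI[of _ b]) (auto simp: mult.commute)
    qed
    then have "q 0 = ?P i" using satN[OF Pi JP] q(2) by blast
    then show ?thesis using q0 xq by simp
  qed
  have pr: "prime_subset (?P (e - k))" if "k \<le> e" for k using that
  proof (induction k)
    case 0 then show ?case using N gen by simp
  next
    case (Suc k)
    then have "e - k = Suc (e - Suc k)" by simp
    then show ?case using step[of "e - Suc k"] Suc by simp
  qed
  show ?thesis unfolding regular_mod_def
  proof (intro allI impI)
    fix j a assume j: "j < e" and m: "x j * a \<in> ?P j"
    have "prime_subset (?P (Suc j))" "prime_subset (?P j)" using pr[of "e - Suc j"] pr[of "e - j"] j by (simp_all del: gen_ideal.simps)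
    then show "a \<in> ?P j" using step[OF j] prime_subsetD(4) m by blast
  qed
qed

section \<open>Complexes modulo a regular sequence\<close>

text \<open>The arguments are the homological degree and the index of a basis element. Integer
  degrees let operators lower the degree without truncation at 0.\<close>

type_synonym 'p vec = "int \<Rightarrow> nat \<Rightarrow> 'p"

definition smul :: "'p::comm_ring_1 \<Rightarrow> 'p vec \<Rightarrow> 'p vec" where
  "smul a v = (\<lambda>m i. a * v m i)"

definition lin :: "('p::comm_ring_1 vec \<Rightarrow> 'p vec) \<Rightarrow> bool" where
  "lin L \<longleftrightarrow> (\<forall>v w. L (v + w) = L v + L w) \<and> (\<forall>a v. L (smul a v) = smul a (L v))"

text \<open>Stands for membership in \<open>I F\<close>; congruence of vectors modulo
  \<open>I\<close> is \<open>vin I (v - w)\<close>.\<close>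

definition vin :: "'p set \<Rightarrow> 'p::comm_ring_1 vec \<Rightarrow> bool" where
  "vin I v \<longleftrightarrow> (\<forall>m i. v m i \<in> I)"

definition graded_free :: "(int \<Rightarrow> nat set) \<Rightarrow> int \<Rightarrow> 'p::comm_ring_1 vec set" where
  "graded_free S n = {v. \<forall>m i. v m i \<noteq> 0 \<longrightarrow> m = n \<and> i \<in> S m}"

definition homog :: "(int \<Rightarrow> nat set) \<Rightarrow> int \<Rightarrow> ('p::comm_ring_1 vec \<Rightarrow> 'p vec) \<Rightarrow> bool" where
  "homog S q L \<longleftrightarrow> (\<forall>n. \<forall>v\<in>graded_free S n. L v \<in> graded_free S (n - q))"

definition basis_vec :: "int \<Rightarrow> nat \<Rightarrow> 'p::comm_ring_1 vec" where
  "basis_vec n i = (\<lambda>m j. if m = n \<and> j = i then 1 else 0)"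

lemma sum_vec_apply: "(\<Sum>x\<in>A. g x) m i = (\<Sum>x\<in>A. g x m i)" for g :: "'x \<Rightarrow> 'p::comm_ring_1 vec"
  by (induction A rule: infinite_finite_induct) auto

lemma smul_apply [simp]: "smul a v m i = a * v m i"
  by (simp add: smul_def)

lemma smul_simps:
  "smul a (v + w) = smul a v + smul a w" "smul a (v - w) = smul a v - smul a w"
  "smul (a + b) v = smul a v + smul b v" "smul a (smul b v) = smul (a * b) v"
  "smul a (- v) = - smul a v" "smul a 0 = 0" "smul 0 v = 0" "smul 1 v = v" "smul (- 1) v = - v"
  by (auto simp: fun_eq_iff algebra_simps)

lemma lin_simps:
  assumes "lin L"
  shows "L (v + w) = L v + L w" "L (smul a v) = smul a (L v)" "L 0 = 0" "L (- v) = - L v" "L (v - w) = L v - L w"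
proof -
  show 1: "L (v + w) = L v + L w" "L (smul a v) = smul a (L v)" for v w a using assms by (auto simp: lin_def)
  show "L 0 = 0" using 1(2)[of 0 0] by (simp add: smul_simps)
  show 2: "L (- v) = - L v" for v using 1(2)[of "-1" v] by (simp add: smul_simps)
  show "L (v - w) = L v - L w" using 1(1)[of v "- w"] 2[of w] by simp
qed

lemma lin_sum: "lin L \<Longrightarrow> L (\<Sum>x\<in>A. g x) = (\<Sum>x\<in>A. L (g x))"
  by (induction A rule: infinite_finite_induct) (simp_all add: lin_simps(1,3)[of L])

lemma lin_sum_smul: "lin L \<Longrightarrow> L (\<Sum>x\<in>A. smul (c x) (g x)) = (\<Sum>x\<in>A. smul (c x) (L (g x)))"
  by (simp add: lin_sum[of L] lin_simps(2)[of L])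

lemma vinD:
  assumes "ring_ideal I"
  shows "vin I 0" "vin I v \<Longrightarrow> vin I w \<Longrightarrow> vin I (v + w)" "vin I v \<Longrightarrow> vin I (smul a v)"
    "vin I v \<Longrightarrow> vin I w \<Longrightarrow> vin I (v - w)" "vin I v \<Longrightarrow> vin I (- v)" "a \<in> I \<Longrightarrow> vin I (smul a v)"
  using ring_idealD[OF assms] by (auto simp: vin_def)

lemma vin_sum: "ring_ideal I \<Longrightarrow> (\<And>x. x \<in> A \<Longrightarrow> vin I (g x)) \<Longrightarrow> vin I (\<Sum>x\<in>A. g x)"
  by (induction A rule: infinite_finite_induct) (auto simp: vinD)

lemma vin_mono: "vin I v \<Longrightarrow> I \<subseteq> I' \<Longrightarrow> vin I' v"
  by (auto simp: vin_def)

lemma graded_free_closed: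
  "0 \<in> graded_free S n" "v \<in> graded_free S n \<Longrightarrow> w \<in> graded_free S n \<Longrightarrow> v + w \<in> graded_free S n"
  "v \<in> graded_free S n \<Longrightarrow> w \<in> graded_free S n \<Longrightarrow> v - w \<in> graded_free S n"
  "v \<in> graded_free S n \<Longrightarrow> - v \<in> graded_free S n" "v \<in> graded_free S n \<Longrightarrow> smul a v \<in> graded_free S n"
proof -
  show 1: "v \<in> graded_free S n \<Longrightarrow> w \<in> graded_free S n \<Longrightarrow> v + w \<in> graded_free S n" for v w
    unfolding graded_free_def mem_Collect_eq by (metis add.right_neutral plus_fun_apply)
  show 2: "v \<in> graded_free S n \<Longrightarrow> smul a v \<in> graded_free S n" for a v
    unfolding graded_free_def mem_Collect_eq by (metis mult_zero_right smul_apply)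
  show "0 \<in> graded_free S n" by (simp add: graded_free_def)
  show 3: "v \<in> graded_free S n \<Longrightarrow> - v \<in> graded_free S n" for v using 2[of v "-1"] by (simp add: smul_simps)
  show "v \<in> graded_free S n \<Longrightarrow> w \<in> graded_free S n \<Longrightarrow> v - w \<in> graded_free S n"
    using 1[of v "- w"] 3[of w] by simp
qed

lemma graded_free_sum: "(\<And>x. x \<in> A \<Longrightarrow> g x \<in> graded_free S n) \<Longrightarrow> (\<Sum>x\<in>A. g x) \<in> graded_free S n"
  by (induction A rule: infinite_finite_induct) (auto simp: graded_free_closed)

lemma homogD: "homog S q L \<Longrightarrow> v \<in> graded_free S n \<Longrightarrow> k = n - q \<Longrightarrow> L v \<in> graded_free S k"
  by (auto simp: homog_def)

lemma basis_vec_mem: "i \<in> S n \<Longrightarrow> basis_vec n i \<in> graded_free S n"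
  by (auto simp: basis_vec_def graded_free_def)

lemma basis_expansion:
  assumes "finite (S n)" "v \<in> graded_free S n"
  shows "v = (\<Sum>i\<in>S n. smul (v n i) (basis_vec n i))"
proof (rule ext, rule ext)
  fix m j
  have "(\<Sum>i\<in>S n. smul (v n i) (basis_vec n i)) m j = (\<Sum>i\<in>S n. if j = i then (if m = n then v n i else 0) else 0)"
    unfolding sum_vec_apply by (rule sum.cong) (auto simp: basis_vec_def)
  also have "\<dots> = v m j" using assms by (auto simp: graded_free_def)
  finally show "v m j = (\<Sum>i\<in>S n. smul (v n i) (basis_vec n i)) m j" by simp
qed

lemma lin_vin:
  assumes "lin L" "ring_ideal I" "finite (S n)" "v \<in> graded_free S n" "vin I v"
  shows "vin I (L v)"
proof -
  have "L v = (\<Sum>i\<in>S n. smul (v n i) (L (basis_vec n i)))"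
    using basis_expansion[OF assms(3,4)] lin_sum_smul[OF assms(1)] by metis
  moreover have "vin I (\<Sum>i\<in>S n. smul (v n i) (L (basis_vec n i)))"
    by (intro vin_sum vinD(6) assms(2)) (use assms(5) in \<open>auto simp: vin_def\<close>)
  ultimately show ?thesis by simp
qed

section \<open>Decomposition along a regular sequence\<close>

lemma gen_ideal_iff:
  assumes "ring_ideal J"
  shows "x \<in> gen_ideal J f s \<longleftrightarrow> (\<exists>a. x - (\<Sum>j<s. f j * a j) \<in> J)"
proof
  show "x \<in> gen_ideal J f s \<Longrightarrow> \<exists>a. x - (\<Sum>j<s. f j * a j) \<in> J"
  proof (induction s arbitrary: x)
    case (Suc s)
    then obtain r where "x - r * f s \<in> gen_ideal J f s" by (auto simp: adjoin_def)
    then obtain a where a: "x - r * f s - (\<Sum>j<s. f j * a j) \<in> J" using Suc by blast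
    have "(\<Sum>j<s. f j * (a(s := r)) j) = (\<Sum>j<s. f j * a j)" by (rule sum.cong) auto
    then have "x - (\<Sum>j<Suc s. f j * (a(s := r)) j) = x - r * f s - (\<Sum>j<s. f j * a j)"
      by (simp add: mult.commute)
    then have "x - (\<Sum>j<Suc s. f j * (a(s := r)) j) \<in> J" using a by metis
    then show ?case by blast
  qed auto
next
  assume "\<exists>a. x - (\<Sum>j<s. f j * a j) \<in> J"
  then obtain a where "x - (\<Sum>j<s. f j * a j) \<in> gen_ideal J f s" using gen_ideal_superset by blast
  moreover have "(\<Sum>j<s. f j * a j) \<in> gen_ideal J f s"
    using gen_ideal_mem[OF assms] by (auto intro!: ring_ideal_sum ring_idealD(4) gen_ideal_ideal assms)
  ultimately show "x \<in> gen_ideal J f s" using ring_ideal_cong[OF gen_ideal_ideal[OF assms]] by blast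
qed

text \<open>Coefficients are chosen once for each matrix entry, which makes every \<open>h j\<close>
  linear and homogeneous. This yields the operators \<open>T j\<close> from the square of
  \<open>D\<close>, and the homotopies of the cone from the commutator of \<open>D\<close> with
  \<open>T t\<close>.\<close>

lemma lin_decompose:
  assumes L: "lin L" "homog S q L" and fin: "\<And>n. finite (S n)" and J: "ring_ideal J"
    and sub: "\<And>n v. v \<in> graded_free S n \<Longrightarrow> vin (gen_ideal J f s) (L v)"
  obtains h where "\<And>j. j < s \<Longrightarrow> lin (h j)" "\<And>j. j < s \<Longrightarrow> homog S q (h j)"
    "\<And>n v. v \<in> graded_free S n \<Longrightarrow> vin J (L v - (\<Sum>j<s. smul (f j) (h j v)))"
proof -
  have "\<exists>a. i \<in> S n \<longrightarrow> L (basis_vec n i) (n - q) r - (\<Sum>j<s. f j * a j) \<in> J" for n i r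
    using sub[OF basis_vec_mem, of i n] gen_ideal_iff[OF J] unfolding vin_def by blast
  note ex = this
  define H where "H n i r = (SOME a. i \<in> S n \<longrightarrow> L (basis_vec n i) (n - q) r - (\<Sum>j<s. f j * a j) \<in> J)" for n i r
  have H: "i \<in> S n \<Longrightarrow> L (basis_vec n i) (n - q) r - (\<Sum>j<s. f j * H n i r j) \<in> J" for n i r
    using someI_ex[OF ex[of i n r]] unfolding H_def by blast
  define h where "h j v = (\<lambda>m r. if r \<in> S m then \<Sum>i\<in>S (m + q). H (m + q) i r j * v (m + q) i else 0)" for j :: nat and v
  have lh: "lin (h j)" for j
  proof -
    have "h j (v + w) m r = h j v m r + h j w m r" for v w m r
      unfolding h_def plus_fun_apply distrib_left sum.distrib by simp
    moreover have "h j (smul a v) m r = a * h j v m r" for v a m r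
      unfolding h_def smul_apply mult.left_commute[of _ a] by (simp add: sum_distrib_left)
    ultimately show ?thesis by (simp add: lin_def fun_eq_iff)
  qed
  have hh: "homog S q (h j)" for j
    unfolding homog_def graded_free_def mem_Collect_eq
  proof (intro allI ballI impI)
    fix n m :: int and v i assume v: "v \<in> {v. \<forall>m i. v m i \<noteq> 0 \<longrightarrow> m = n \<and> i \<in> S m}" and nz: "h j v m i \<noteq> 0"
    have i: "i \<in> S m" using nz by (simp add: h_def split: if_splits)
    have "m + q = n"
    proof (rule ccontr)
      assume "m + q \<noteq> n"
      then have "v (m + q) i = 0" for i using v by blast
      then show False using nz by (simp add: h_def split: if_splits)
    qed
    then show "m = n - q \<and> i \<in> S m" using i by auto
  qed
  have "vin J (L v - (\<Sum>j<s. smul (f j) (h j v)))" if v: "v \<in> graded_free S n" for n v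
    unfolding vin_def
  proof (intro allI)
    fix m r
    let ?d = "(L v - (\<Sum>j<s. smul (f j) (h j v))) m r"
    show "?d \<in> J"
    proof (cases "m = n - q \<and> r \<in> S m")
      case True
      have Lv: "L v m r = (\<Sum>i\<in>S n. v n i * L (basis_vec n i) (n - q) r)"
        using basis_expansion[OF fin v] lin_sum_smul[OF L(1), of "\<lambda>i. v n i" "\<lambda>i. basis_vec n i" "S n"] True
        by (metis (mono_tags, lifting) smul_apply sum.cong sum_vec_apply)
      have "(\<Sum>j<s. smul (f j) (h j v)) m r = (\<Sum>j<s. \<Sum>i\<in>S n. v n i * (f j * H n i r j))"
        unfolding sum_vec_apply using True by (auto simp: h_def sum_distrib_left algebra_simps intro!: sum.cong)
      also have "\<dots> = (\<Sum>i\<in>S n. v n i * (\<Sum>j<s. f j * H n i r j))"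
        by (subst sum.swap) (simp add: sum_distrib_left)
      finally have "?d = (\<Sum>i\<in>S n. v n i * (L (basis_vec n i) (n - q) r - (\<Sum>j<s. f j * H n i r j)))"
        using Lv by (simp add: sum_subtractf right_diff_distrib)
      then show ?thesis using H by (auto intro!: ring_ideal_sum[OF J] ring_idealD(3)[OF J])
    next
      case False
      have "L v \<in> graded_free S (n - q)" "(\<Sum>j<s. smul (f j) (h j v)) \<in> graded_free S (n - q)"
        using homogD[OF L(2) v] homogD[OF hh v] by (auto intro!: graded_free_sum graded_free_closed)
      then have "L v m r = 0" "(\<Sum>j<s. smul (f j) (h j v)) m r = 0" using False unfolding graded_free_def by blast+
      then show ?thesis using ring_idealD(1)[OF J] by simp
    qed
  qed
  then show ?thesis using that[of h] lh hh by blast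
qed

lemma regular_mod_mono: "regular_mod J f t \<Longrightarrow> s \<le> t \<Longrightarrow> regular_mod J f s"
  by (auto simp: regular_mod_def)

lemma regular_mod_last:
  assumes "regular_mod J f (Suc s)" "ring_ideal J" "(\<Sum>j<Suc s. f j * a j) \<in> J"
  shows "a s \<in> gen_ideal J f s"
proof -
  have "f s * a s - (\<Sum>j<s. f j * (- a j)) \<in> J" using assms(3) by (simp add: sum_negf add.commute)
  then have "f s * a s \<in> gen_ideal J f s" unfolding gen_ideal_iff[OF assms(2)] by (rule exI[of _ "\<lambda>j. - a j"])
  then show ?thesis using assms(1) by (auto simp: regular_mod_def)
qed

lemma regular_mod_coeffs:
  assumes "ring_ideal J"
  shows "regular_mod J f s \<Longrightarrow> (\<Sum>j<s. f j * a j) \<in> J \<Longrightarrow> j < s \<Longrightarrow> a j \<in> gen_ideal J f s"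
proof (induction s arbitrary: a j)
  case (Suc s)
  have as: "a s \<in> gen_ideal J f s" using regular_mod_last[OF Suc.prems(1) assms Suc.prems(2)] .
  then obtain c where c: "a s - (\<Sum>j<s. f j * c j) \<in> J" unfolding gen_ideal_iff[OF assms] by blast
  \<comment> \<open>Modulo \<open>J\<close>, the coefficient \<open>a s\<close> is a combination of
    the earlier elements; distributing it over their coefficients leaves a relation of length
    \<open>s\<close>.\<close>
  have "(\<Sum>j<s. f j * (a j + f s * c j)) = (\<Sum>j<Suc s. f j * a j) - f s * (a s - (\<Sum>j<s. f j * c j))"
    by (simp add: algebra_simps sum.distrib sum_distrib_left)
  also have "\<dots> \<in> J" by (intro ring_idealD(5)[OF assms Suc.prems(2)] ring_idealD(3)[OF assms c])
  finally have IH: "j < s \<Longrightarrow> a j + f s * c j \<in> gen_ideal J f s" for j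
    using Suc.IH[OF regular_mod_mono[OF Suc.prems(1)]] by simp
  note G = gen_ideal_ideal[OF assms, of f "Suc s"]
  have sub: "gen_ideal J f s \<subseteq> gen_ideal J f (Suc s)" by (rule gen_ideal_mono) simp
  show ?case
  proof (cases "j = s")
    case True then show ?thesis using as sub by blast
  next
    case False
    then have "a j + f s * c j \<in> gen_ideal J f (Suc s)" using IH[of j] sub Suc.prems(3) by auto
    moreover have "f s * c j \<in> gen_ideal J f (Suc s)"
      by (intro ring_idealD(4)[OF G] gen_ideal_mem[OF assms]) simp
    ultimately show ?thesis using ring_idealD(5)[OF G, of "a j + f s * c j" "f s * c j"] by simp
  qed
qed simp

lemma vin_regular_coeffs:
  assumes "ring_ideal J" "regular_mod J f s" "vin J (\<Sum>j<s. smul (f j) (w j))" "j < s"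
  shows "vin (gen_ideal J f s) (w j)"
  unfolding vin_def
proof (intro allI)
  fix m i
  have "(\<Sum>j<s. f j * w j m i) \<in> J" using assms(3) unfolding vin_def sum_vec_apply smul_apply by blast
  then show "w j m i \<in> gen_ideal J f s" using regular_mod_coeffs[OF assms(1,2) _ assms(4), of "\<lambda>j. w j m i"] by simp
qed

lemma vin_regular_last:
  assumes "ring_ideal J" "regular_mod J f (Suc s)" "vin J (\<Sum>j<Suc s. smul (f j) (w j))"
  shows "vin (gen_ideal J f s) (w s)"
  unfolding vin_def
proof (intro allI)
  fix m i
  have "(\<Sum>j<Suc s. f j * w j m i) \<in> J" using assms(3) unfolding vin_def sum_vec_apply smul_apply by blast
  then show "w s m i \<in> gen_ideal J f s" using regular_mod_last[OF assms(2,1), of "\<lambda>j. w j m i"] by simp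
qed

text \<open>Lifts to the ambient ring of a complex of finite free modules over the quotient by
  \<open>gen_ideal J f s\<close>, together with Eisenbud's operators \<open>T j\<close>.\<close>

locale lifted_complex =
  fixes J N :: "'p::comm_ring_1 set" and f :: "nat \<Rightarrow> 'p" and s :: nat and S :: "int \<Rightarrow> nat set"
    and D :: "'p vec \<Rightarrow> 'p vec" and T :: "nat \<Rightarrow> 'p vec \<Rightarrow> 'p vec"
  assumes J: "ring_ideal J" and N: "ring_ideal N" and JN: "J \<subseteq> N" and fN: "\<And>j. j < s \<Longrightarrow> f j \<in> N"
    and reg: "regular_mod J f s" and fin: "\<And>n. finite (S n)" and neg: "\<And>n. n < 0 \<Longrightarrow> S n = {}"
    and linD: "lin D" and homD: "homog S 1 D"
    and linT: "\<And>j. j < s \<Longrightarrow> lin (T j)" and homT: "\<And>j. j < s \<Longrightarrow> homog S 2 (T j)"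
    and DD: "\<And>n v. v \<in> graded_free S n \<Longrightarrow> vin J (D (D v) - (\<Sum>j<s. smul (f j) (T j v)))"
begin

abbreviation "F \<equiv> graded_free S :: int \<Rightarrow> 'p vec set"
abbreviation "I \<equiv> gen_ideal J f"

text \<open>\<open>Z n\<close> and \<open>B n\<close> are the preimages of the cycles and boundaries
  of the complex reduced modulo \<open>N\<close>. For a resolution and maximal \<open>N\<close>, the
  quotient is Tor with the residue field.\<close>

definition Z :: "int \<Rightarrow> 'p vec set" where "Z n = {x \<in> F n. vin N (D x)}"
definition B :: "int \<Rightarrow> 'p vec set" where "B n = {x \<in> F n. \<exists>z\<in>F (n + 1). vin N (x - D z)}"

text \<open>Preimages of graded submodules of the homology that are closed under the
  operators.\<close>

definition stable :: "(int \<Rightarrow> 'p vec set) \<Rightarrow> bool" where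
  "stable U \<longleftrightarrow> (\<forall>n. B n \<subseteq> U n \<and> U n \<subseteq> Z n \<and> (\<forall>x\<in>U n. \<forall>y\<in>U n. x + y \<in> U n) \<and>
     (\<forall>a. \<forall>x\<in>U n. smul a x \<in> U n) \<and> (\<forall>j<s. \<forall>x\<in>U n. T j x \<in> U (n - 2)))"

definition dcc :: bool where
  "dcc \<longleftrightarrow> (\<forall>U. (\<forall>i::nat. stable (U i)) \<longrightarrow> (\<forall>i n. U (Suc i) n \<subseteq> U i n) \<longrightarrow> (\<exists>k. \<forall>i\<ge>k. U i = U k))"

text \<open>The bound \<open>n0\<close> leaves room for the resolved module, which is the homology
  in degree 0. Passing to the cone does not change it.\<close>

definition exact_from :: "int \<Rightarrow> bool" where
  "exact_from n0 \<longleftrightarrow> (\<forall>n\<ge>n0. \<forall>x\<in>F n. vin (I s) (D x) \<longrightarrow> (\<exists>z\<in>F (n + 1). vin (I s) (x - D z)))"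

lemmas vinN = vinD[OF N] and vinJ = vinD[OF J] and vinI = vinD[OF gen_ideal_ideal[OF J]]
lemmas lD = lin_simps[OF linD] and lT = lin_simps[OF linT]
lemmas F = graded_free_closed[where S = S]

lemma vD: "ring_ideal K \<Longrightarrow> v \<in> F n \<Longrightarrow> vin K v \<Longrightarrow> vin K (D v)"
  by (rule lin_vin[OF linD _ fin])

lemma vT: "j < s \<Longrightarrow> ring_ideal K \<Longrightarrow> v \<in> F n \<Longrightarrow> vin K v \<Longrightarrow> vin K (T j v)"
  by (rule lin_vin[OF linT _ fin])

lemma IN: "k \<le> s \<Longrightarrow> I k \<subseteq> N"
  using gen_ideal_least[OF N JN] fN by auto

lemma DF: "x \<in> F n \<Longrightarrow> k = n - 1 \<Longrightarrow> D x \<in> F k"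
  using homogD[OF homD] .

lemma TF: "j < s \<Longrightarrow> x \<in> F n \<Longrightarrow> k = n - 2 \<Longrightarrow> T j x \<in> F k"
  using homogD[OF homT] .

abbreviation "R v \<equiv> D (D v) - (\<Sum>j<s. smul (f j) (T j v))"

lemma RF: "x \<in> F n \<Longrightarrow> R x \<in> F (n - 2)"
  by (intro F(3) DF graded_free_sum F(5) TF) auto

text \<open>\<open>D\<close> commutes with its own square. Writing that square as \<open>R\<close>
  plus the sum of the \<open>f j\<close> times \<open>T j\<close>, and discarding \<open>R\<close>,
  whose values have entries in \<open>J\<close>, leaves the commutators.\<close>

lemma comm_sum:
  assumes "v \<in> F n"
  shows "vin J (\<Sum>j<s. smul (f j) (D (T j v) - T j (D v)))"
proof -
  have "vin J (R (D v) - D (R v))"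
    by (intro vinJ(4) DD[OF DF[OF assms refl]] vD[OF J RF[OF assms] DD[OF assms]])
  moreover have "R (D v) - D (R v) = (\<Sum>j<s. smul (f j) (D (T j v) - T j (D v)))"
    unfolding lD(5) lin_sum_smul[OF linD] by (simp add: smul_simps sum_subtractf)
  ultimately show ?thesis by simp
qed

lemma comm_DT: "v \<in> F n \<Longrightarrow> j < s \<Longrightarrow> vin (I s) (D (T j v) - T j (D v))"
  using vin_regular_coeffs[OF J reg comm_sum] by blast

text \<open>The cone needs the sharper ideal \<open>I t\<close>: this commutator is a component of
  the square of its differential, which has to vanish modulo the first \<open>t\<close>
  elements.\<close>

lemma comm_DT_last: "v \<in> F n \<Longrightarrow> s = Suc t \<Longrightarrow> vin (I t) (D (T t v) - T t (D v))"
  using vin_regular_last[OF J, of f t "\<lambda>j. D (T j v) - T j (D v)"] reg comm_sum[of v n] by simp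

lemma DD_N: "x \<in> F n \<Longrightarrow> vin N (D (D x))"
proof -
  assume x: "x \<in> F n"
  have "vin N (R x + (\<Sum>j<s. smul (f j) (T j x)))"
    using vin_mono[OF DD[OF x] JN] fN by (intro vinN(2) vin_sum[OF N] vinN(6)) auto
  then show ?thesis by simp
qed

lemma B_Z: "B n \<subseteq> Z n"
proof
  fix x assume "x \<in> B n"
  then obtain z where x: "x \<in> F n" "z \<in> F (n + 1)" "vin N (x - D z)" by (auto simp: B_def)
  have "vin N (D (x - D z))" using x by (intro vD[OF N F(3)[of x n "D z"]] DF) auto
  then have "vin N (D (x - D z) + D (D z))" by (intro vinN(2) DD_N[OF x(2)])
  then show "x \<in> Z n" using x by (simp add: Z_def lD)
qed

lemma B_closed: "x \<in> B n \<Longrightarrow> y \<in> B n \<Longrightarrow> x + y \<in> B n" "x \<in> B n \<Longrightarrow> smul a x \<in> B n"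
  "vin N x \<Longrightarrow> x \<in> F n \<Longrightarrow> x \<in> B n" "x \<in> B n \<Longrightarrow> y \<in> B n \<Longrightarrow> x - y \<in> B n"
proof -
  show 1: "x + y \<in> B n" if "x \<in> B n" "y \<in> B n" for x y
  proof -
    obtain z z' where z: "x \<in> F n" "z \<in> F (n + 1)" "vin N (x - D z)" "y \<in> F n" "z' \<in> F (n + 1)" "vin N (y - D z')"
      using \<open>x \<in> B n\<close> \<open>y \<in> B n\<close> by (auto simp: B_def)
    have "vin N ((x - D z) + (y - D z'))" using z by (intro vinN(2))
    then have "vin N (x + y - D (z + z'))" by (simp add: lD algebra_simps)
    then show ?thesis using z F(2) by (auto simp: B_def)
  qed
  show 2: "smul a x \<in> B n" if "x \<in> B n" for a x
  proof -
    obtain z where z: "x \<in> F n" "z \<in> F (n + 1)" "vin N (x - D z)" using \<open>x \<in> B n\<close> by (auto simp: B_def)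
    have "vin N (smul a (x - D z))" using z by (intro vinN(3))
    then have "vin N (smul a x - D (smul a z))" by (simp add: lD smul_simps)
    then show ?thesis using z F(5) by (auto simp: B_def)
  qed
  show "vin N x \<Longrightarrow> x \<in> F n \<Longrightarrow> x \<in> B n" by (auto simp: B_def lD intro!: bexI[of _ 0] F)
  show "x - y \<in> B n" if "x \<in> B n" "y \<in> B n" using 1[OF that(1) 2[OF that(2), of "-1"]] by (simp add: smul_simps)
qed

lemma T_Z: "x \<in> Z n \<Longrightarrow> j < s \<Longrightarrow> k = n - 2 \<Longrightarrow> T j x \<in> Z k"
proof -
  assume x: "x \<in> Z n" and j: "j < s" and k: "k = n - 2"
  then have "x \<in> F n" "vin N (D x)" by (auto simp: Z_def)
  then have "vin N ((D (T j x) - T j (D x)) + T j (D x))"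
    using vin_mono[OF comm_DT IN] j by (intro vinN(2) vT[OF j N DF]) auto
  then show ?thesis using TF[OF j \<open>x \<in> F n\<close>] k by (simp add: Z_def)
qed

lemma T_B: "x \<in> B n \<Longrightarrow> j < s \<Longrightarrow> k = n - 2 \<Longrightarrow> T j x \<in> B k"
proof -
  assume "x \<in> B n" and j: "j < s" and k: "k = n - 2"
  then obtain z where x: "x \<in> F n" "z \<in> F (n + 1)" "vin N (x - D z)" by (auto simp: B_def)
  have "vin N (T j (x - D z))" using x by (intro vT[OF j N F(3)[of x n "D z"]] DF) auto
  then have "vin N (T j (x - D z) - (D (T j z) - T j (D z)))"
    by (intro vinN(4) vin_mono[OF comm_DT[OF x(2) j] IN]) auto
  then have "vin N (T j x - D (T j z))" by (simp add: lT[OF j])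
  then show ?thesis using TF[OF j x(1)] TF[OF j x(2)] k by (auto simp: B_def intro!: bexI[of _ "T j z"])
qed

lemma stableD:
  assumes "stable U"
  shows "B n \<subseteq> U n" "U n \<subseteq> Z n" "x \<in> U n \<Longrightarrow> y \<in> U n \<Longrightarrow> x + y \<in> U n" "x \<in> U n \<Longrightarrow> smul a x \<in> U n"
    "j < s \<Longrightarrow> x \<in> U n \<Longrightarrow> k = n - 2 \<Longrightarrow> T j x \<in> U k" "x \<in> U n \<Longrightarrow> y \<in> U n \<Longrightarrow> x - y \<in> U n" "0 \<in> U n"
proof -
  show 1: "B n \<subseteq> U n" "U n \<subseteq> Z n" "x \<in> U n \<Longrightarrow> y \<in> U n \<Longrightarrow> x + y \<in> U n" "x \<in> U n \<Longrightarrow> smul a x \<in> U n"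
    "j < s \<Longrightarrow> x \<in> U n \<Longrightarrow> k = n - 2 \<Longrightarrow> T j x \<in> U k" for x y a
    using assms by (auto simp: stable_def)
  show "x \<in> U n \<Longrightarrow> y \<in> U n \<Longrightarrow> x - y \<in> U n" using 1(3)[of x "- y"] 1(4)[of y "-1"] by (simp add: smul_simps)
  have "0 \<in> B n" by (intro B_closed vinN F)
  then show "0 \<in> U n" using 1(1) by blast
qed

lemma F_neg: "n < 0 \<Longrightarrow> x \<in> F n \<Longrightarrow> x = 0"
  using neg by (auto simp: graded_free_def fun_eq_iff)

end

text \<open>Degree \<open>n\<close> of the cone is the sum of degrees \<open>n\<close> and \<open>n - 1\<close> of the complex. To keep the
  index type, basis elements of the first summand get even and those of the second odd indices.\<close>

definition pr1 :: "'p::comm_ring_1 vec \<Rightarrow> 'p vec" where "pr1 v = (\<lambda>m i. v m (2 * i))"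
definition pr2 :: "'p::comm_ring_1 vec \<Rightarrow> 'p vec" where "pr2 v = (\<lambda>m i. v (m + 1) (2 * i + 1))"
definition pair_vec :: "'p::comm_ring_1 vec \<Rightarrow> 'p vec \<Rightarrow> 'p vec" where
  "pair_vec x y = (\<lambda>m i. if even i then x m (i div 2) else y (m - 1) (i div 2))"
definition cone_index :: "(int \<Rightarrow> nat set) \<Rightarrow> int \<Rightarrow> nat set" where
  "cone_index S n = {i. if even i then i div 2 \<in> S n else i div 2 \<in> S (n - 1)}"

lemma pair_vec_simps [simp]: "pr1 (pair_vec x y) = x" "pr2 (pair_vec x y) = y" "pair_vec (pr1 v) (pr2 v) = v"
  by (auto simp: pr1_def pr2_def pair_vec_def fun_eq_iff)

lemma pair_vec_lin: "pair_vec x y + pair_vec x' y' = pair_vec (x + x') (y + y')"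
  "smul a (pair_vec x y) = pair_vec (smul a x) (smul a y)"
  "pair_vec x y - pair_vec x' y' = pair_vec (x - x') (y - y')"
  by (auto simp: pair_vec_def fun_eq_iff)

lemma pair_vec_sum: "(\<Sum>j\<in>A. pair_vec (g j) (h j)) = pair_vec (\<Sum>j\<in>A. g j) (\<Sum>j\<in>A. h j)"
proof (rule ext, rule ext)
  fix m i show "(\<Sum>j\<in>A. pair_vec (g j) (h j)) m i = pair_vec (\<Sum>j\<in>A. g j) (\<Sum>j\<in>A. h j) m i"
    unfolding sum_vec_apply pair_vec_def by (auto simp: sum_vec_apply)
qed

lemma pr_lin: "pr1 (v + w) = pr1 v + pr1 w" "pr1 (smul a v) = smul a (pr1 v)"
  "pr2 (v + w) = pr2 v + pr2 w" "pr2 (smul a v) = smul a (pr2 v)" "pr1 (v - w) = pr1 v - pr1 w" "pr2 (v - w) = pr2 v - pr2 w"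
  by (auto simp: pr1_def pr2_def fun_eq_iff)

lemma vin_pair_vec: "vin I (pair_vec x y) \<longleftrightarrow> vin I x \<and> vin I y"
proof
  assume a: "vin I (pair_vec x y)"
  have "x m i \<in> I" "y m i \<in> I" for m i
    using a[unfolded vin_def, THEN spec, THEN spec, of m "2 * i"] a[unfolded vin_def, THEN spec, THEN spec, of "m + 1" "2 * i + 1"]
    by (auto simp: pair_vec_def)
  then show "vin I x \<and> vin I y" by (auto simp: vin_def)
qed (auto simp: vin_def pair_vec_def)

lemma finite_cone_index: "finite (S n) \<Longrightarrow> finite (S (n - 1)) \<Longrightarrow> finite (cone_index S n)"
proof -
  assume f: "finite (S n)" "finite (S (n - 1))"
  have "cone_index S n \<subseteq> (\<lambda>i. 2 * i) ` S n \<union> (\<lambda>i. 2 * i + 1) ` S (n - 1)"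
  proof
    fix i assume i: "i \<in> cone_index S n"
    show "i \<in> (\<lambda>i. 2 * i) ` S n \<union> (\<lambda>i. 2 * i + 1) ` S (n - 1)"
    proof (cases "even i")
      case True
      then show ?thesis using i by (intro UnI1 image_eqI[of _ _ "i div 2"]) (auto simp: cone_index_def)
    next
      case False
      then show ?thesis using i by (intro UnI2 image_eqI[of _ _ "i div 2"]) (auto simp: cone_index_def)
    qed
  qed
  then show ?thesis using f finite_subset by blast
qed

lemma cone_mem: "pair_vec x y \<in> graded_free (cone_index S) n \<longleftrightarrow> x \<in> graded_free S n \<and> y \<in> graded_free S (n - 1)"
proof
  assume a: "pair_vec x y \<in> graded_free (cone_index S) n"
  have "x m i \<noteq> 0 \<longrightarrow> m = n \<and> i \<in> S m" "y m i \<noteq> 0 \<longrightarrow> m = n - 1 \<and> i \<in> S m" for m i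
    using a[unfolded graded_free_def mem_Collect_eq, THEN spec, THEN spec, of m "2 * i"]
      a[unfolded graded_free_def mem_Collect_eq, THEN spec, THEN spec, of "m + 1" "2 * i + 1"]
    by (auto simp: pair_vec_def cone_index_def)
  then show "x \<in> graded_free S n \<and> y \<in> graded_free S (n - 1)" by (auto simp: graded_free_def)
next
  assume "x \<in> graded_free S n \<and> y \<in> graded_free S (n - 1)"
  then have x: "x m i \<noteq> 0 \<Longrightarrow> m = n \<and> i \<in> S m" "y m i \<noteq> 0 \<Longrightarrow> m = n - 1 \<and> i \<in> S m" for m i
    by (auto simp: graded_free_def)
  show "pair_vec x y \<in> graded_free (cone_index S) n"
    unfolding graded_free_def mem_Collect_eq
  proof (intro allI impI)
    fix m i assume "pair_vec x y m i \<noteq> 0"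
    then show "m = n \<and> i \<in> cone_index S m"
      using x[of m "i div 2"] x(2)[of "m - 1" "i div 2"] by (auto simp: pair_vec_def cone_index_def split: if_splits)
  qed
qed

lemma cone_mem': "v \<in> graded_free (cone_index S) n \<longleftrightarrow> pr1 v \<in> graded_free S n \<and> pr2 v \<in> graded_free S (n - 1)"
  using cone_mem[of "pr1 v" "pr2 v"] by simp

text \<open>A resolution modulo \<open>f 0, \<dots>, f t\<close> yields one modulo \<open>f 0, \<dots>, f (t - 1)\<close>, the cone with
  \<open>(x, y) \<mapsto> (D x + f t y, - D y - T t x)\<close>. The maps \<open>h j\<close> express that \<open>D\<close> and \<open>T t\<close> commute up to \<open>f\<close>;
  they enter the operators \<open>TC j\<close> of the cone.\<close>

locale cone_step = lifted_complex J N f "Suc t" S D T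
  for J N :: "'p::comm_ring_1 set" and f t S D T +
  fixes h :: "nat \<Rightarrow> 'p vec \<Rightarrow> 'p vec"
  assumes linh: "\<And>j. j < t \<Longrightarrow> lin (h j)" and homh: "\<And>j. j < t \<Longrightarrow> homog S 3 (h j)"
    and h: "\<And>n v. v \<in> graded_free S n \<Longrightarrow> vin J (D (T t v) - T t (D v) - (\<Sum>j<t. smul (f j) (h j v)))"
begin

abbreviation "\<tau> \<equiv> T t"

definition DC :: "'p vec \<Rightarrow> 'p vec" where
  "DC v = pair_vec (D (pr1 v) + smul (f t) (pr2 v)) (- D (pr2 v) - \<tau> (pr1 v))"
definition TC :: "nat \<Rightarrow> 'p vec \<Rightarrow> 'p vec" where
  "TC j v = pair_vec (T j (pr1 v)) (T j (pr2 v) + h j (pr1 v))"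

lemmas ltau = lT[OF lessI] and lh = lin_simps[OF linh]

lemma hF: "j < t \<Longrightarrow> v \<in> F n \<Longrightarrow> k = n - 3 \<Longrightarrow> h j v \<in> F k"
  using homogD[OF homh] by blast

lemma vh: "j < t \<Longrightarrow> ring_ideal K \<Longrightarrow> v \<in> F n \<Longrightarrow> vin K v \<Longrightarrow> vin K (h j v)"
  by (rule lin_vin[OF linh _ fin])

lemma sum_Suc: "(\<Sum>j<Suc t. g j) = (\<Sum>j<t. g j) + g t" for g :: "nat \<Rightarrow> 'p vec"
  by simp

lemma cone: "lifted_complex J N f t (cone_index S) DC TC"
proof
  show "ring_ideal J" "ring_ideal N" "J \<subseteq> N" using J N JN by auto
  show "j < t \<Longrightarrow> f j \<in> N" for j using fN by simp
  show "regular_mod J f t" using regular_mod_mono[OF reg] by simp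
  show "finite (cone_index S n)" for n by (rule finite_cone_index[OF fin fin])
  show "n < 0 \<Longrightarrow> cone_index S n = {}" for n by (simp add: cone_index_def neg)
  show "lin DC" unfolding lin_def DC_def pr_lin lD ltau pair_vec_lin smul_simps
    by (intro conjI allI arg_cong2[of _ _ _ _ pair_vec]) (simp_all add: algebra_simps)
  show "homog (cone_index S) 1 DC" unfolding homog_def
  proof (intro allI ballI)
    fix n and v :: "'p vec" assume "v \<in> graded_free (cone_index S) n"
    then have "pr1 v \<in> F n" "pr2 v \<in> F (n - 1)" by (simp_all add: cone_mem')
    then show "DC v \<in> graded_free (cone_index S) (n - 1)"
      unfolding DC_def cone_mem by (intro conjI F(2,3,4,5) DF TF) auto
  qed
  show "lin (TC j)" if j: "j < t" for j
  proof -
    have "T j (v + w) = T j v + T j w" "T j (smul a v) = smul a (T j v)" for v w a using lT[of j] j by auto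
    then show ?thesis unfolding lin_def TC_def pr_lin pair_vec_lin lh[OF j]
      by (simp add: smul_simps algebra_simps)
  qed
  show "homog (cone_index S) 2 (TC j)" if j: "j < t" for j
  proof -
    have j': "j < Suc t" using j by simp
    show ?thesis unfolding homog_def
    proof (intro allI ballI)
      fix n and v :: "'p vec" assume "v \<in> graded_free (cone_index S) n"
      then have "pr1 v \<in> F n" "pr2 v \<in> F (n - 1)" by (simp_all add: cone_mem')
      then show "TC j v \<in> graded_free (cone_index S) (n - 2)"
        unfolding TC_def cone_mem by (intro conjI F(2) TF[OF j'] hF[OF j]) auto
    qed
  qed
  show "vin J (DC (DC v) - (\<Sum>j<t. smul (f j) (TC j v)))" if v: "v \<in> graded_free (cone_index S) n" for n v
  proof -
    let ?x = "pr1 v" and ?y = "pr2 v"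
    have xy: "?x \<in> F n" "?y \<in> F (n - 1)" using v by (simp_all add: cone_mem')
    have 1: "DC (DC v) = pair_vec (D (D ?x) - smul (f t) (\<tau> ?x))
       (D (D ?y) - smul (f t) (\<tau> ?y) + (D (\<tau> ?x) - \<tau> (D ?x)))"
      unfolding DC_def by (simp add: lD ltau smul_simps algebra_simps)
    have 2: "(\<Sum>j<t. smul (f j) (TC j v)) = pair_vec (\<Sum>j<t. smul (f j) (T j ?x))
       ((\<Sum>j<t. smul (f j) (T j ?y)) + (\<Sum>j<t. smul (f j) (h j ?x)))"
      unfolding TC_def pair_vec_lin pair_vec_sum smul_simps sum.distrib ..
    have "vin J (R ?y + (D (\<tau> ?x) - \<tau> (D ?x) - (\<Sum>j<t. smul (f j) (h j ?x))))" "vin J (R ?x)"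
      using DD[OF xy(1)] DD[OF xy(2)] h[OF xy(1)] vinJ(2) by blast+
    then show ?thesis unfolding 1 2 pair_vec_lin vin_pair_vec sum_Suc by (simp add: algebra_simps)
  qed
qed

interpretation C: lifted_complex J N f t "cone_index S" DC TC by (rule cone)

text \<open>If \<open>(x, y)\<close> is a cycle of the cone modulo \<open>I t\<close>, then
  \<open>x\<close> is a cycle modulo \<open>I (Suc t)\<close>, so \<open>x\<close> is
  \<open>D z\<close> plus \<open>f t\<close> times \<open>u\<close> modulo \<open>I t\<close>.
  Comparing differentials and cancelling \<open>f t\<close>, which is regular modulo
  \<open>I t\<close>, determines \<open>y\<close>, and \<open>(x, y)\<close> is the image of
  \<open>(z, u)\<close>.\<close>

lemma cone_exact:
  assumes "exact_from n0"
  shows "C.exact_from n0"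
  unfolding C.exact_from_def
proof (intro allI ballI impI)
  fix n v assume n: "n0 \<le> n" and v: "v \<in> C.F n" and Dv: "vin (I t) (DC v)"
  let ?x = "pr1 v" and ?y = "pr2 v"
  have xy: "?x \<in> F n" "?y \<in> F (n - 1)" using v by (simp_all add: cone_mem')
  have D1: "vin (I t) (D ?x + smul (f t) ?y)" using Dv by (simp add: DC_def vin_pair_vec)
  have sub: "I t \<subseteq> I (Suc t)" by (rule gen_ideal_mono) simp
  have ft: "f t \<in> I (Suc t)" by (rule gen_ideal_mem[OF J]) simp
  have "vin (I (Suc t)) (D ?x + smul (f t) ?y - smul (f t) ?y)"
    by (intro vinI(4) vin_mono[OF D1 sub] vinI(6) ft)
  then have "vin (I (Suc t)) (D ?x)" by simp
  then obtain z where z: "z \<in> F (n + 1)" "vin (I (Suc t)) (?x - D z)"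
    using assms n xy(1) unfolding exact_from_def by blast
  define w where "w = ?x - D z"
  have wF: "w \<in> F n" unfolding w_def using xy(1) z(1) by (intro F(3) DF) auto
  have "\<forall>m i. \<exists>r. w m i - r * f t \<in> I t" using z(2) by (auto simp: w_def vin_def adjoin_def)
  then obtain u0 where u0: "\<And>m i. w m i - u0 m i * f t \<in> I t" by metis
  \<comment> \<open>The coordinatewise choice \<open>u0\<close> may leave \<open>F n\<close>;
    putting 0 where \<open>w\<close> vanishes repairs this and keeps the congruence.\<close>
  define u where "u = (\<lambda>m i. if w m i = 0 then 0 else u0 m i)"
  have uF: "u \<in> F n" using wF by (auto simp: u_def graded_free_def)
  have wu: "vin (I t) (w - smul (f t) u)"
    using u0 by (auto simp: u_def vin_def mult.commute gen_ideal_ideal[OF J] ring_idealD)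
  have e1: "vin (I t) (?x - (D z + smul (f t) u))" using wu by (simp add: w_def algebra_simps)
  have uD: "vin (I t) (D (w - smul (f t) u))"
    by (intro vD[OF gen_ideal_ideal[OF J] _ wu, of n] F(3,5) wF uF)
  have "vin (I t) (R z)" by (rule vin_mono[OF DD[OF z(1)] gen_ideal_superset])
  moreover have "vin (I t) (\<Sum>j<t. smul (f j) (T j z))"
    by (intro vin_sum gen_ideal_ideal[OF J] vinI(6) gen_ideal_mem[OF J]) simp
  ultimately have "vin (I t) (D ?x + smul (f t) ?y - D (w - smul (f t) u) - R z - (\<Sum>j<t. smul (f j) (T j z)))"
    by (rule vinI(4)[OF vinI(4)[OF vinI(4)[OF D1 uD]]])
  \<comment> \<open>\<open>R z\<close> trades \<open>D (D z)\<close> for the operators on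
    \<open>z\<close>, those below \<open>t\<close> are subtracted, and only multiples of
    \<open>f t\<close> survive.\<close>
  moreover have "D ?x + smul (f t) ?y - D (w - smul (f t) u) - R z - (\<Sum>j<t. smul (f j) (T j z))
     = smul (f t) (?y - (- D u - \<tau> z))"
    unfolding w_def lD sum_Suc smul_simps by simp
  ultimately have "vin (I t) (smul (f t) (?y - (- D u - \<tau> z)))" by simp
  then have "vin (I t) (?y - (- D u - \<tau> z))"
    using reg unfolding vin_def regular_mod_def smul_apply by blast
  then have "vin (I t) (v - DC (pair_vec z u))"
    using e1 pair_vec_lin(3)[of ?x ?y] by (simp add: DC_def vin_pair_vec)
  moreover have "pair_vec z u \<in> C.F (n + 1)" using z(1) uF by (simp add: cone_mem)
  ultimately show "\<exists>z\<in>C.F (n + 1). vin (I t) (v - DC z)" by blast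
qed

text \<open>The map \<open>h j\<close> is the homotopy. Commuting \<open>\<tau>\<close> with the
  square of \<open>D\<close>, once through the operators and once through \<open>h\<close>, gives a
  relation in which the term of \<open>\<tau>\<close> with itself cancels. Regularity of the first
  \<open>t\<close> elements then identifies the commutator with \<open>D (h j x) + h j (D x)\<close>
  modulo \<open>N\<close>.\<close>

lemma comm_TT:
  assumes x: "x \<in> Z n" and j: "j < t" and k: "k = n - 4"
  shows "T j (\<tau> x) - \<tau> (T j x) \<in> B k"
proof -
  have j': "j < Suc t" using j by simp
  have xF: "x \<in> F n" and DxN: "vin N (D x)" using x by (auto simp: Z_def)
  define E where "E v = D (\<tau> v) - \<tau> (D v) - (\<Sum>j<t. smul (f j) (h j v))" for v
  have EJ: "vin J (E v)" if "v \<in> F m" for v m unfolding E_def using h[OF that] .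
  have EF: "E x \<in> F (n - 3)" unfolding E_def using xF j
    by (intro F(3) DF[OF TF] TF[OF _ DF] graded_free_sum F(5) hF) auto
  have tF: "\<tau> x \<in> F (n - 2)" "D x \<in> F (n - 1)" "R x \<in> F (n - 2)" using TF DF RF xF by auto
  define a where "a j = T j (\<tau> x) - \<tau> (T j x) - (D (h j x) + h j (D x))" for j
  have "(\<Sum>j<t. smul (f j) (a j)) = (D (E x) + E (D x)) - (R (\<tau> x) - \<tau> (R x))"
  proof -
    have "D (E x) = D (D (\<tau> x)) - D (\<tau> (D x)) - (\<Sum>j<t. smul (f j) (D (h j x)))"
      unfolding E_def lD(5) lin_sum_smul[OF linD] ..
    moreover have "\<tau> (R x) = \<tau> (D (D x)) - (\<Sum>j<t. smul (f j) (\<tau> (T j x))) - smul (f t) (\<tau> (\<tau> x))"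
      unfolding ltau(5) lin_sum_smul[OF linT[OF lessI]] unfolding sum_Suc by simp
    ultimately show ?thesis
      unfolding a_def E_def[of "D x"] sum_Suc smul_simps sum.distrib sum_subtractf by simp
  qed
  moreover have "vin J \<dots>"
    by (intro vinJ(2,4) EJ[OF tF(2)] vD[OF J EF EJ[OF xF]] DD[OF tF(1)] vT[OF _ J tF(3) DD[OF xF]]) simp
  ultimately have "vin (I t) (a j)"
    using vin_regular_coeffs[OF J regular_mod_mono[OF reg], of t a j] j by simp
  then have "vin N (a j)" using vin_mono IN[of t] by simp
  then have "vin N (a j + h j (D x))" by (intro vinN(2) vh[OF j N tF(2) DxN])
  then have "vin N (T j (\<tau> x) - \<tau> (T j x) - D (h j x))" by (simp add: a_def algebra_simps)
  moreover have "T j (\<tau> x) - \<tau> (T j x) \<in> F k" using xF j' k by (intro F(3) TF[OF _ TF]) auto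
  moreover have "h j x \<in> F (k + 1)" using hF[OF j xF] k by simp
  ultimately show ?thesis by (auto simp: B_def)
qed

abbreviation "\<tau>n r \<equiv> (\<tau> ^^ r)"

lemma tau_pow: "\<tau>n r (x + y) = \<tau>n r x + \<tau>n r y" "\<tau>n r (smul a x) = smul a (\<tau>n r x)" "\<tau>n r 0 = 0"
  "\<tau>n r (x - y) = \<tau>n r x - \<tau>n r y"
  by (induction r) (simp_all add: ltau)

lemma tau_pow_Z: "x \<in> Z n \<Longrightarrow> k = n - 2 * int r \<Longrightarrow> \<tau>n r x \<in> Z k"
  by (induction r arbitrary: k) (auto intro: T_Z)

lemma tau_pow_stable: "stable U \<Longrightarrow> x \<in> U n \<Longrightarrow> k = n - 2 * int r \<Longrightarrow> \<tau>n r x \<in> U k"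
  by (induction r arbitrary: k) (auto intro: stableD(5))

lemma comm_pow:
  assumes x: "x \<in> Z n" and j: "j < t"
  shows "k = n - 2 * int r - 2 \<Longrightarrow> T j (\<tau>n r x) - \<tau>n r (T j x) \<in> B k"
proof (induction r arbitrary: k)
  case 0
  have "T j (\<tau>n 0 x) - \<tau>n 0 (T j x) \<in> B k" using B_closed(3)[OF vinN(1) F(1)] by simp
  then show ?case .
next
  case (Suc r)
  have 1: "T j (\<tau> (\<tau>n r x)) - \<tau> (T j (\<tau>n r x)) \<in> B k"
    by (rule comm_TT[OF tau_pow_Z[OF x refl] j]) (use Suc.prems in simp)
  have "\<tau> (T j (\<tau>n r x) - \<tau>n r (T j x)) \<in> B k" 
    by (rule T_B[OF Suc.IH[OF refl]]) (use Suc.prems in auto)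
  from B_closed(1)[OF 1 this] have "T j (\<tau>n (Suc r) x) - \<tau>n (Suc r) (T j x) \<in> B k" by (simp add: ltau)
  then show ?case .
qed

text \<open>The analogue of the ideals of leading coefficients in Hilbert's basis theorem, for the operator
  \<open>\<tau>\<close>: the classes of \<open>pr1 v\<close> for cycles \<open>v\<close> of the cone form the kernel of \<open>\<tau>\<close> on homology.\<close>

definition K :: "nat \<Rightarrow> (int \<Rightarrow> 'p vec set) \<Rightarrow> int \<Rightarrow> 'p vec set" where
  "K r U n = {v \<in> C.Z n. \<exists>u\<in>U (n + 2 * int r). pr1 v - \<tau>n r u \<in> B n}"

text \<open>Only the operators below \<open>t\<close> act here, so the induction hypothesis for the
  cone applies. Closure under \<open>TC j\<close> rests on \<open>comm_pow\<close>:
  \<open>T j\<close> commutes with powers of \<open>\<tau>\<close> up to boundaries.\<close>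

lemma K_stable:
  assumes U: "stable U"
  shows "C.stable (K r U)"
  unfolding C.stable_def
proof (intro allI conjI ballI impI)
  fix n
  show "C.B n \<subseteq> K r U n"
  proof
    fix v assume v: "v \<in> C.B n"
    then obtain z where z: "v \<in> C.F n" "z \<in> C.F (n + 1)" "vin N (v - DC z)" by (auto simp: C.B_def)
    have "vin N (pair_vec (pr1 v) (pr2 v) - DC z)" using z(3) by simp
    then have "vin N (pr1 v - (D (pr1 z) + smul (f t) (pr2 z)))"
      unfolding DC_def pair_vec_lin vin_pair_vec by blast
    then have "vin N (pr1 v - (D (pr1 z) + smul (f t) (pr2 z)) + smul (f t) (pr2 z))"
      by (intro vinN(2) vinN(6) fN) simp_all
    then have "pr1 v \<in> B n" using z(1,2) by (auto simp: B_def cone_mem')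
    then show "v \<in> K r U n" using v C.B_Z stableD(7)[OF U]
      by (auto simp: K_def tau_pow intro!: bexI[of _ 0])
  qed
  show "K r U n \<subseteq> C.Z n" by (auto simp: K_def)
next
  fix n x y assume "x \<in> K r U n" "y \<in> K r U n"
  then obtain u w where u: "x \<in> C.Z n" "u \<in> U (n + 2 * int r)" "pr1 x - \<tau>n r u \<in> B n"
    "y \<in> C.Z n" "w \<in> U (n + 2 * int r)" "pr1 y - \<tau>n r w \<in> B n" by (auto simp: K_def)
  have "(pr1 x - \<tau>n r u) + (pr1 y - \<tau>n r w) \<in> B n" using u by (intro B_closed(1))
  then have "pr1 (x + y) - \<tau>n r (u + w) \<in> B n" by (simp add: pr_lin tau_pow algebra_simps)
  moreover have "x + y \<in> C.Z n"
    using u(1,4) by (auto simp: C.Z_def C.lD C.F intro: vinN)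
  ultimately show "x + y \<in> K r U n" using stableD(3)[OF U u(2,5)] by (auto simp: K_def)
next
  fix n a x assume "x \<in> K r U n"
  then obtain u where u: "x \<in> C.Z n" "u \<in> U (n + 2 * int r)" "pr1 x - \<tau>n r u \<in> B n" by (auto simp: K_def)
  have "smul a (pr1 x - \<tau>n r u) \<in> B n" using u by (intro B_closed(2))
  then have "pr1 (smul a x) - \<tau>n r (smul a u) \<in> B n" by (simp add: pr_lin tau_pow smul_simps)
  moreover have "smul a x \<in> C.Z n"
    using u(1) by (auto simp: C.Z_def C.lD C.F intro: vinN)
  ultimately show "smul a x \<in> K r U n" using stableD(4)[OF U u(2)] by (auto simp: K_def)
next
  fix n j x assume j: "j < t" and "x \<in> K r U n"
  then obtain u where u: "x \<in> C.Z n" "u \<in> U (n + 2 * int r)" "pr1 x - \<tau>n r u \<in> B n" by (auto simp: K_def)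
  have j': "j < Suc t" using j by simp
  have "T j (pr1 x - \<tau>n r u) \<in> B (n - 2)" by (rule T_B[OF u(3) j' refl])
  moreover have "T j (\<tau>n r u) - \<tau>n r (T j u) \<in> B (n - 2)"
    by (rule comm_pow[OF _ j]) (use stableD(2)[OF U] u(2) in auto)
  ultimately have "T j (pr1 x - \<tau>n r u) + (T j (\<tau>n r u) - \<tau>n r (T j u)) \<in> B (n - 2)" by (rule B_closed(1))
  then have "pr1 (TC j x) - \<tau>n r (T j u) \<in> B (n - 2)" by (simp add: TC_def lT[OF j'])
  moreover have "T j u \<in> U (n - 2 + 2 * int r)" by (rule stableD(5)[OF U j' u(2)]) simp
  ultimately show "TC j x \<in> K r U (n - 2)" using C.T_Z[OF u(1) j refl] by (auto simp: K_def)
qed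

lemma K_mono: "(\<And>n. U n \<subseteq> U' n) \<Longrightarrow> K r U n \<subseteq> K r U' n"
  by (auto simp: K_def)

lemma K_Suc:
  assumes "stable U"
  shows "K (Suc r) U n \<subseteq> K r U n"
proof
  fix v assume "v \<in> K (Suc r) U n"
  then obtain u where u: "v \<in> C.Z n" "u \<in> U (n + 2 * int (Suc r))" "pr1 v - \<tau>n (Suc r) u \<in> B n" by (auto simp: K_def)
  have "\<tau>n (Suc r) u = \<tau>n r (\<tau> u)" by (simp add: funpow_swap1)
  moreover have "\<tau> u \<in> U (n + 2 * int r)" using stableD(5)[OF assms lessI u(2)] by simp
  ultimately show "v \<in> K r U n" using u by (auto simp: K_def)
qed

text \<open>If \<open>\<tau>\<close> kills the class of \<open>\<tau>n r u'\<close>, that class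
  occurs in \<open>K r U'\<close>, hence in \<open>K r U\<close>, so some \<open>u\<close> in
  \<open>U n\<close> has the same image under \<open>\<tau>n r\<close>. The difference
  \<open>u' - u\<close> is killed by one power less.\<close>

lemma K_determines:
  assumes U: "stable U" "stable U'" and K: "\<And>r. K r U = K r U'" and sub: "U n \<subseteq> U' n"
  shows "u' \<in> U' n \<Longrightarrow> \<tau>n r u' \<in> B (n - 2 * int r) \<Longrightarrow> u' \<in> U n"
proof (induction r arbitrary: u')
  case 0
  then show ?case using stableD(1)[OF U(1)] by auto
next
  case (Suc r)
  let ?m = "n - 2 * int r" and ?x = "\<tau>n r u'"
  have xU: "?x \<in> U' ?m" by (rule tau_pow_stable[OF U(2) Suc.prems(1) refl])
  then have xZ: "?x \<in> F ?m" "vin N (D ?x)" using stableD(2)[OF U(2)] by (auto simp: Z_def)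
  from Suc.prems(2) obtain z where z: "z \<in> F (n - 2 * int (Suc r) + 1)" "vin N (\<tau> ?x - D z)" by (auto simp: B_def)
  \<comment> \<open>The vector \<open>z\<close> bounding \<open>\<tau> ?x\<close> supplies the
    second component that completes \<open>?x\<close> to a cycle of the cone.\<close>
  let ?v = "pair_vec ?x (- z)"
  have "?v \<in> C.F ?m" using xZ(1) z(1) F(4) by (auto simp: cone_mem algebra_simps)
  moreover have "vin N (DC ?v)"
    using vinN(2)[OF xZ(2) vinN(6)[OF fN[OF lessI], of "- z"]] vinN(5)[OF z(2)]
    by (simp add: DC_def vin_pair_vec lD)
  ultimately have "?v \<in> C.Z ?m" by (simp add: C.Z_def)
  then have "?v \<in> K r U' ?m" using Suc.prems(1) B_closed(3)[OF vinN(1) F(1)]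
    by (auto simp: K_def intro!: bexI[of _ u'])
  then have "?v \<in> K r U ?m" using K by simp
  then obtain u where u: "u \<in> U n" "?x - \<tau>n r u \<in> B ?m" by (auto simp: K_def)
  have "\<tau>n r (u' - u) \<in> B ?m" using u(2) by (simp add: tau_pow)
  moreover have "u' - u \<in> U' n" using stableD(6)[OF U(2) Suc.prems(1)] u(1) sub by blast
  ultimately have "u' - u \<in> U n" using Suc.IH by blast
  then have "u' - u + u \<in> U n" using u(1) by (intro stableD(3)[OF U(1)])
  then show ?case by simp
qed

text \<open>The family \<open>K r (U i)\<close> decreases in both \<open>r\<close> and
  \<open>i\<close>. Its diagonal settles all \<open>r\<close> beyond some \<open>k0\<close> at once,
  the finitely many smaller \<open>r\<close> are treated one by one, and \<open>K_determines\<close>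
  recovers the members of the chain.\<close>

lemma dcc_step:
  assumes "C.dcc"
  shows dcc
  unfolding dcc_def
proof (intro allI impI)
  fix U assume st: "\<forall>i::nat. stable (U i)" and dec: "\<forall>i n. U (Suc i) n \<subseteq> U i n"
  have dec': "U j n \<subseteq> U i n" if "i \<le> j" for i j n
    using lift_Suc_antimono_le[of "\<lambda>i. U i n" i j] dec that by blast
  have Kr: "K r' (U i) n \<subseteq> K r (U i) n" if "r \<le> r'" for r r' i n
    using lift_Suc_antimono_le[of "\<lambda>r. K r (U i) n" r r'] K_Suc st that by blast
  have Kd: "K r' (U j) n \<subseteq> K r (U i) n" if "r \<le> r'" "i \<le> j" for r r' i j n
    using K_mono[of "U j" "U i" r' n] dec'[OF that(2)] Kr[OF that(1)] by blast
  have stab: "\<exists>k. \<forall>i\<ge>k. K (\<rho> i) (U i) = K (\<rho> k) (U k)" if "\<And>i. \<rho> i \<le> \<rho> (Suc i)" for \<rho>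
    using assms[unfolded C.dcc_def, rule_format, of "\<lambda>i. K (\<rho> i) (U i)"] K_stable st Kd[OF that le_SucI[OF order_refl]] by blast
  obtain k0 where k0: "\<And>i. i \<ge> k0 \<Longrightarrow> K i (U i) = K k0 (U k0)" using stab[of "\<lambda>i. i"] by auto
  have "\<exists>k. \<forall>i\<ge>k. K r (U i) = K r (U k)" for r using stab[of "\<lambda>_. r"] by auto
  then obtain \<kappa> where \<kappa>: "\<And>r i. i \<ge> \<kappa> r \<Longrightarrow> K r (U i) = K r (U (\<kappa> r))" by metis
  define k where "k = Max (insert k0 (\<kappa> ` {..k0}))"
  have kk: "k0 \<le> k" "\<And>r. r \<le> k0 \<Longrightarrow> \<kappa> r \<le> k" unfolding k_def by (rule Max_ge; simp)+
  have Keq: "K r (U i) = K r (U k)" if i: "i \<ge> k" for i r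
  proof (cases "r \<le> k0")
    case True
    then show ?thesis using \<kappa>[of r i] \<kappa>[of r k] kk(2)[of r] i by simp
  next
    case False
    have "K r (U j) = K k0 (U k0)" if j: "j \<ge> k0" for j
    proof (rule antisym)
      \<comment> \<open>\<open>K r (U j)\<close> is squeezed between the diagonal members with
        indices \<open>?m\<close> and \<open>k0\<close>, which agree.\<close>
      let ?m = "max r j"
      show "K r (U j) \<le> K k0 (U k0)" using Kd[of k0 r k0 j] False j by (simp add: le_fun_def)
      have "K ?m (U ?m) \<le> K r (U j)" using Kd[of r ?m j ?m] by (simp add: le_fun_def)
      then show "K k0 (U k0) \<le> K r (U j)" using k0[of ?m] j by simp
    qed
    then show ?thesis using kk(1) i by simp
  qed
  have "U i = U k" if i: "i \<ge> k" for i
  proof (rule ext)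
    fix n
    show "U i n = U k n"
    proof
      show "U i n \<subseteq> U k n" using dec'[OF i] .
      show "U k n \<subseteq> U i n"
      proof
        fix u assume u: "u \<in> U k n"
        \<comment> \<open>Every element is killed by a power of \<open>\<tau>\<close>: for
          \<open>n\<close> at least 0, lowering the degree by 2 this many times makes it
          negative.\<close>
        let ?r = "nat (n + 1)"
        have neg: "n - 2 * int ?r < 0" by simp
        have "\<tau>n ?r u \<in> Z (n - 2 * int ?r)" using tau_pow_Z[of u n] u stableD(2) st by blast
        then have "\<tau>n ?r u = 0" using F_neg[OF neg] by (auto simp: Z_def)
        then have "\<tau>n ?r u \<in> B (n - 2 * int ?r)" using B_closed(3)[OF vinN(1) F(1)] by simp
        then show "u \<in> U i n" using K_determines[of "U i" "U k"] st Keq[OF i] dec'[OF i] u by blast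
      qed
    qed
  qed
  then show "\<exists>k. \<forall>i\<ge>k. U i = U k" by blast
qed

end

text \<open>Modulo \<open>N\<close> this concerns subspaces of a finite-dimensional vector space. A
  chain is controlled by its image under one coordinate and by its part where that coordinate
  vanishes; the index set does not depend on the degree, so that it can carry the induction.\<close>

lemma subspace_chain_stabilizes:
  assumes N: "ring_ideal N" "\<And>a. a \<notin> N \<Longrightarrow> \<exists>t. t * a - 1 \<in> N" and "finite Y"
    and A: "\<And>i::nat. A i \<subseteq> graded_free (\<lambda>m. Y) n" "\<And>i v w. v \<in> A i \<Longrightarrow> w \<in> A i \<Longrightarrow> v + w \<in> A i"
      "\<And>i a v. v \<in> A i \<Longrightarrow> smul a v \<in> A i" "\<And>i v. v \<in> graded_free (\<lambda>m. Y) n \<Longrightarrow> vin N v \<Longrightarrow> v \<in> A i"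
      "\<And>i. A (Suc i) \<subseteq> A i"
  shows "\<exists>k. \<forall>i\<ge>k. A i = A k"
  using assms(3) A
proof (induction Y arbitrary: A)
  case empty
  have "A i = {0}" for i
  proof
    show "A i \<subseteq> {0}" using empty(1)[of i] by (auto simp: graded_free_def fun_eq_iff)
    have "0 \<in> A i" by (rule empty(4)) (rule graded_free_closed(1), rule vinD(1)[OF N(1)])
    then show "{0} \<subseteq> A i" by simp
  qed
  then show ?case by simp
next
  case (insert x Y)
  have cl: "v \<in> A i \<Longrightarrow> w \<in> A i \<Longrightarrow> v + w \<in> A i" "v \<in> A i \<Longrightarrow> smul a v \<in> A i" for i v w a
    by (rule insert.prems(2), assumption, assumption) (rule insert.prems(3))
  have dec: "A j \<subseteq> A i" if "i \<le> j" for i j using lift_Suc_antimono_le[of A, OF insert.prems(5) that] .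
  define c where "c i = (\<lambda>v. v n x) ` A i" for i
  have Nc: "N \<subseteq> c i" for i
  proof
    fix a assume "a \<in> N"
    then have "smul a (basis_vec n x) \<in> A i"
      by (intro insert.prems(4) graded_free_closed(5) basis_vec_mem vinD(6)[OF N(1)]) simp_all
    then show "a \<in> c i" unfolding c_def by (rule rev_image_eqI) (simp add: basis_vec_def)
  qed
  \<comment> \<open>The ring modulo \<open>N\<close> is a field, so the image under the coordinate
    is \<open>N\<close> or everything.\<close>
  have cU: "c i = UNIV" if ac: "a \<in> c i" and aN: "a \<notin> N" for a i
  proof -
    obtain v where v: "v \<in> A i" "a = v n x" using ac by (auto simp: c_def)
    obtain t where t: "t * a - 1 \<in> N" using N(2) aN by blast
    then have "t * a - 1 \<in> c i" using Nc by blast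
    then obtain w where w: "w \<in> A i" "t * a - 1 = w n x" by (auto simp: c_def)
    have u: "smul t v + smul (- 1) w \<in> A i" by (intro cl v w)
    have "b \<in> c i" for b
      unfolding c_def by (rule image_eqI[OF _ cl(2)[OF u, of b]]) (simp add: v(2)[symmetric] w(2)[symmetric])
    then show ?thesis by blast
  qed
  have "\<exists>k. \<forall>i\<ge>k. c i = c k"
  proof (cases "\<exists>k. c k = N")
    case True
    then obtain k where k: "c k = N" by auto
    have "c i = N" if "i \<ge> k" for i using Nc[of i] dec[OF that] k by (auto simp: c_def)
    then show ?thesis using k by blast
  next
    case False
    then have "c i = UNIV" for i using cU[of _ i] Nc[of i] by blast
    then show ?thesis by simp
  qed
  then obtain k1 where k1: "\<And>i. i \<ge> k1 \<Longrightarrow> c i = c k1" by blast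
  define A' where "A' i = A i \<inter> graded_free (\<lambda>m. Y) n" for i
  have subX: "graded_free (\<lambda>m. Y) n \<subseteq> graded_free (\<lambda>m. insert x Y) n" by (auto simp: graded_free_def)
  have "\<exists>k. \<forall>i\<ge>k. A' i = A' k"
  proof (rule insert.IH)
    fix i and v w :: "'a vec" and a
    show "A' i \<subseteq> graded_free (\<lambda>m. Y) n" "A' (Suc i) \<subseteq> A' i" using insert.prems(5) by (auto simp: A'_def)
    show "v \<in> A' i \<Longrightarrow> w \<in> A' i \<Longrightarrow> v + w \<in> A' i" "v \<in> A' i \<Longrightarrow> smul a v \<in> A' i"
      using cl graded_free_closed(2,5) by (auto simp: A'_def)
    show "v \<in> graded_free (\<lambda>m. Y) n \<Longrightarrow> vin N v \<Longrightarrow> v \<in> A' i"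
      using insert.prems(4)[of v i] subX by (auto simp: A'_def)
  qed
  then obtain k2 where k2: "\<And>i. i \<ge> k2 \<Longrightarrow> A' i = A' k2" by blast
  let ?k = "max k1 k2"
  have "A i = A ?k" if i: "i \<ge> ?k" for i
  proof
    show "A i \<subseteq> A ?k" using dec[OF i] .
    show "A ?k \<subseteq> A i"
    proof
      fix v assume v: "v \<in> A ?k"
      have "c i = c ?k" using k1[of i] k1[of ?k] i by simp
      then have "v n x \<in> c i" using v by (auto simp: c_def)
      then obtain w where w: "w \<in> A i" "v n x = w n x" by (auto simp: c_def)
      have d: "v + smul (- 1) w \<in> A ?k" using cl(1)[OF v cl(2)] w(1) dec[OF i] by blast
      then have g: "v + smul (- 1) w \<in> graded_free (\<lambda>m. insert x Y) n" using insert.prems(1) by blast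
      have z: "(v + smul (- 1) w) n x = 0" using w(2) by simp
      have "v + smul (- 1) w \<in> graded_free (\<lambda>m. Y) n"
        unfolding graded_free_def mem_Collect_eq
      proof (intro allI impI)
        fix m j assume nz: "(v + smul (- 1) w) m j \<noteq> 0"
        then have "m = n \<and> j \<in> insert x Y" using g unfolding graded_free_def by blast
        then show "m = n \<and> j \<in> Y" using nz z by blast
      qed
      then have "v + smul (- 1) w \<in> A' ?k" using d by (simp add: A'_def)
      then have "v + smul (- 1) w \<in> A' i" using k2[of i] k2[of ?k] i by simp
      then have "v + smul (- 1) w + w \<in> A i" using w(1) by (intro cl(1)[of "v + smul (- 1) w" i w]) (auto simp: A'_def)
      moreover have "v + smul (- 1) w + w = v" by (simp add: smul_simps)
      ultimately show "v \<in> A i" by metis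
    qed
  qed
  then show ?case by blast
qed

context lifted_complex
begin

text \<open>Each parameter costs one degree, as in the long exact sequence of multiplication by
  \<open>x i\<close>: the differential of \<open>v\<close> is \<open>x i\<close> times some
  \<open>y\<close> modulo the smaller ideal, and this \<open>y\<close>, one degree lower, is a cycle
  that has to bound too.\<close>

lemma exact_mod_regular:
  assumes s0: "s = 0" and ex: "exact_from n0" and rx: "regular_mod J x e" and i: "i \<le> e"
    and n: "n0 + int i \<le> n" and v: "v \<in> F n" "vin (gen_ideal J x i) (D v)"
  shows "\<exists>z\<in>F (n + 1). vin (gen_ideal J x i) (v - D z)"
  using i n v
proof (induction i arbitrary: n v)
  case 0
  then have "\<exists>z\<in>F (n + 1). vin (gen_ideal J x 0) (v - D z)" using ex[unfolded exact_from_def] by (simp add: s0)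
  then show ?case .
next
  case (Suc i)
  let ?P = "gen_ideal J x i"
  have IH: "\<exists>z\<in>F (n + 1). vin ?P (v - D z)" if "n0 + int i \<le> n" "v \<in> F n" "vin ?P (D v)" for n v
    by (rule Suc.IH) (use that Suc.prems(1) in simp_all)
  note P = vinD[OF gen_ideal_ideal[OF J, of x i]]
  have sub: "?P \<subseteq> gen_ideal J x (Suc i)" by (rule gen_ideal_mono) simp
  have xi: "x i \<in> gen_ideal J x (Suc i)" by (rule gen_ideal_mem[OF J]) simp
  have DvF: "D v \<in> F (n - 1)" using DF Suc.prems(3) by blast
  have "\<forall>m j. \<exists>r. D v m j - r * x i \<in> ?P" using Suc.prems(4) by (auto simp: vin_def adjoin_def)
  then obtain y0 where y0: "\<And>m j. D v m j - y0 m j * x i \<in> ?P" by metis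
  define y where "y = (\<lambda>m j. if D v m j = 0 then 0 else y0 m j)"
  have yF: "y \<in> F (n - 1)" using DvF by (auto simp: y_def graded_free_def)
  have e1: "vin ?P (D v - smul (x i) y)"
    using y0 by (auto simp: y_def vin_def mult.commute gen_ideal_ideal[OF J] ring_idealD)
  have "vin ?P (D (D v - smul (x i) y))"
    by (intro vD[OF gen_ideal_ideal[OF J] _ e1, of "n - 1"] F(3,5) DvF yF)
  moreover have "vin ?P (D (D v))" using vin_mono[OF DD[OF Suc.prems(3)] gen_ideal_superset] s0 by simp
  ultimately have "vin ?P (D (D v) - D (D v - smul (x i) y))" by (intro P(4))
  then have "vin ?P (smul (x i) (D y))" by (simp add: lD)
  then have "vin ?P (D y)" using rx Suc.prems(1) unfolding vin_def regular_mod_def smul_apply by auto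
  then obtain z where z: "z \<in> F (n - 1 + 1)" "vin ?P (y - D z)" using IH[of "n - 1" y] Suc.prems(2) yF by auto
  have zF: "z \<in> F n" using z(1) by simp
  have "vin ?P (D v - smul (x i) y + smul (x i) (y - D z))" by (intro P(2,3) e1 z(2))
  then have "vin ?P (D (v - smul (x i) z))" by (simp add: lD smul_simps)
  then obtain w where w: "w \<in> F (n + 1)" "vin ?P (v - smul (x i) z - D w)"
    using IH[of n "v - smul (x i) z"] Suc.prems(2) F(3)[OF Suc.prems(3) F(5)[OF zF]] by auto
  have "vin (gen_ideal J x (Suc i)) ((v - smul (x i) z - D w) + smul (x i) z)"
    by (intro vinD(2,6)[OF gen_ideal_ideal[OF J]] xi vin_mono[OF w(2) sub])
  then have "vin (gen_ideal J x (Suc i)) (v - D w)" by simp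
  then have "\<exists>z\<in>F (n + 1). vin (gen_ideal J x (Suc i)) (v - D z)" using w(1) by blast
  then show ?case .
qed

text \<open>Negative degrees are zero and the homology vanishes beyond \<open>n0 + e\<close>. What
  remains are finitely many degrees, each with a finite-dimensional space.\<close>

lemma dcc_base:
  assumes s0: "s = 0" and ex: "exact_from n0" and rx: "regular_mod J x e" and Nx: "N = gen_ideal J x e"
    and mx: "\<And>a. a \<notin> N \<Longrightarrow> \<exists>t. t * a - 1 \<in> N"
  shows dcc
  unfolding dcc_def
proof (intro allI impI)
  fix U assume st: "\<forall>i::nat. stable (U i)" and dec: "\<forall>i n. U (Suc i) n \<subseteq> U i n"
  define n1 where "n1 = n0 + int e"
  have "\<exists>k. \<forall>i\<ge>k. U i n = U k n" for n
  proof (rule subspace_chain_stabilizes[OF N mx fin[of n]])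
    fix i and v w :: "'p vec" and a
    have eq: "graded_free (\<lambda>m. S n) n = F n" by (auto simp: graded_free_def)
    show "U i n \<subseteq> graded_free (\<lambda>m. S n) n" unfolding eq using stableD(2) st by (auto simp: Z_def)
    show "v \<in> U i n \<Longrightarrow> w \<in> U i n \<Longrightarrow> v + w \<in> U i n" "v \<in> U i n \<Longrightarrow> smul a v \<in> U i n" using stableD(3,4) st by blast+
    show "v \<in> graded_free (\<lambda>m. S n) n \<Longrightarrow> vin N v \<Longrightarrow> v \<in> U i n"
      unfolding eq using B_closed(3)[of v n] stableD(1)[of "U i" n] st by blast
    show "U (Suc i) n \<subseteq> U i n" using dec by blast
  qed
  then have "\<forall>n. \<exists>k. \<forall>i\<ge>k. U i n = U k n" by blast
  from choice[OF this] obtain \<kappa> where \<kappa>: "\<And>n i. i \<ge> \<kappa> n \<Longrightarrow> U i n = U (\<kappa> n) n" by blast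
  define k where "k = Max (insert 0 (\<kappa> ` {0..n1}))"
  have kk: "\<kappa> n \<le> k" if "0 \<le> n" "n \<le> n1" for n unfolding k_def by (rule Max_ge) (use that in auto)
  have "U i n = U k n" if i: "i \<ge> k" for i n
  proof -
    consider "n < 0" | "0 \<le> n" "n \<le> n1" | "n1 < n" by linarith
    then show ?thesis
    proof cases
      case 1
      have "U j n = {0}" for j
      proof
        show "U j n \<subseteq> {0}" using stableD(2)[of "U j" n] st F_neg[OF 1] by (auto simp: Z_def)
        show "{0} \<subseteq> U j n" using stableD(7)[of "U j" n] st by simp
      qed
      then show ?thesis by simp
    next
      case 2
      then show ?thesis using kk[of n] \<kappa>[of n i] \<kappa>[of n k] i by simp
    next
      case 3
      have "Z n \<subseteq> B n"
      proof
        fix x' assume "x' \<in> Z n"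
        then show "x' \<in> B n"
          using exact_mod_regular[OF s0 ex rx order_refl, of n x'] 3 unfolding Nx[symmetric] n1_def
          by (auto simp: Z_def B_def)
      qed
      then have "U j n = B n" for j using stableD(1,2)[of "U j" n] st by blast
      then show ?thesis by simp
    qed
  qed
  then have "U i = U k" if "i \<ge> k" for i using that by (intro ext)
  then show "\<exists>k. \<forall>i\<ge>k. U i = U k" by blast
qed

end

text \<open>The complex varies in the induction because each step replaces it by its cone, while
  \<open>J\<close>, \<open>N\<close> and \<open>n0\<close> stay fixed. The parameters
  \<open>x\<close> enter at the bottom, where the sequence \<open>f\<close> is exhausted.\<close>

theorem lifted_complex_dcc:
  assumes rx: "regular_mod J x e" and Nx: "N = gen_ideal J x e"
    and mx: "\<And>a. a \<notin> N \<Longrightarrow> \<exists>t. t * a - 1 \<in> N"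
  shows "lifted_complex J N f s S D T \<Longrightarrow> lifted_complex.exact_from J f s S D n0 \<Longrightarrow> lifted_complex.dcc N s S D T"
proof (induction s arbitrary: S D T)
  case 0
  interpret lifted_complex J N f 0 S D T by (rule 0(1))
  show ?case using dcc_base[OF refl 0(2) rx Nx mx] .
next
  case (Suc t)
  interpret lifted_complex J N f "Suc t" S D T by (rule Suc.prems(1))
  have tT: "lin (T t)" "homog S 2 (T t)" using linT homT by auto
  have "lin (\<lambda>v. D (T t v) - T t (D v))"
    unfolding lin_def by (simp add: lD lin_simps[OF tT(1)] smul_simps)
  moreover have "homog S 3 (\<lambda>v. D (T t v) - T t (D v))"
    unfolding homog_def by (intro allI ballI F(3) DF[OF TF] TF[OF _ DF]) auto
  ultimately obtain h where h: "\<And>j. j < t \<Longrightarrow> lin (h j)" "\<And>j. j < t \<Longrightarrow> homog S 3 (h j)"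
    "\<And>n v. v \<in> F n \<Longrightarrow> vin J (D (T t v) - T t (D v) - (\<Sum>j<t. smul (f j) (h j v)))"
    by (rule lin_decompose[OF _ _ fin J]) (use comm_DT_last in auto)
  interpret cone_step J N f t S D T h by unfold_locales (fact h)+
  show ?case by (rule dcc_step[OF Suc.IH[OF cone cone_exact[OF Suc.prems(2)]]])
qed

text \<open>If all operators vanish modulo \<open>N\<close> in degrees \<open>n\<close>
  from an infinite set \<open>A\<close>, then the families which are full in the degrees \<open>n \<in> A\<close> with
  \<open>n \<ge> i\<close> form a strictly descending chain.\<close>

lemma (in lifted_complex) operators_eventually_nonzero:
  assumes dcc: dcc and min: "\<And>n v. v \<in> F n \<Longrightarrow> vin N (D v)" and one: "1 \<notin> N"
    and ne: "\<And>n. n \<in> A \<Longrightarrow> S n \<noteq> {}" and van: "\<And>n j v. n \<in> A \<Longrightarrow> j < s \<Longrightarrow> v \<in> F n \<Longrightarrow> vin N (T j v)"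
  shows "\<exists>k::nat. \<forall>n\<in>A. n < int k"
proof (rule ccontr)
  assume no: "\<not> ?thesis"
  \<comment> \<open>By minimality all vectors are cycles and only those with entries in
    \<open>N\<close> are boundaries. From degrees in \<open>A\<close> the operators end in
    boundaries, so full pieces may be placed there freely.\<close>
  define U where "U i n = (if n \<in> A \<and> int i \<le> n then F n else {v \<in> F n. vin N v})" for i :: nat and n
  have Bn: "B n = {v \<in> F n. vin N v}" for n
  proof -
    have "vin N x" if "z \<in> F (n + 1)" "vin N (x - D z)" for x z
      using vinN(2)[OF that(2) min[OF that(1)]] by simp
    then show ?thesis using B_closed(3) by (auto simp: B_def)
  qed
  have st: "stable (U i)" for i
    unfolding stable_def
  proof (intro allI conjI ballI impI)
    fix n and x y :: "'p vec" and a
    show "B n \<subseteq> U i n" "U i n \<subseteq> Z n" using min by (auto simp: Bn U_def Z_def)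
    show "x \<in> U i n \<Longrightarrow> y \<in> U i n \<Longrightarrow> x + y \<in> U i n" "x \<in> U i n \<Longrightarrow> smul a x \<in> U i n"
      using F(2,5) vinN(2,3) by (auto simp: U_def split: if_splits)
    fix j assume j: "j < s" and x: "x \<in> U i n"
    have xF: "x \<in> F n" using x by (auto simp: U_def split: if_splits)
    have "vin N (T j x)" using van[of n j x] x j vT[OF j N xF] xF by (auto simp: U_def split: if_splits)
    then show "T j x \<in> U i (n - 2)" using TF[OF j xF refl] by (auto simp: U_def)
  qed
  have dec: "U (Suc i) n \<subseteq> U i n" for i n by (auto simp: U_def)
  have "\<exists>k. \<forall>i\<ge>k. U i = U k"
    by (rule mp[OF mp[OF spec[OF dcc[unfolded dcc_def], of U]]]) (use st dec in blast)+
  then obtain k where kk: "\<forall>i\<ge>k. U i = U k" ..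
  have k: "U i = U k" if "i \<ge> k" for i by (rule mp[OF spec[OF kk, of i] that])
  have "\<not> (\<forall>n\<in>A. n < int k)" using no by blast
  then obtain n where n: "n \<in> A" "int k \<le> n" by (auto simp: not_less)
  obtain i where i: "i \<in> S n" using ne[OF n(1)] by blast
  have mem: "basis_vec n i \<in> U k n" using n basis_vec_mem[of i S n] i by (simp add: U_def)
  \<comment> \<open>The member with index \<open>n + 1\<close> is already reduced to boundaries in
    degree \<open>n\<close>, so it misses the basis vector.\<close>
  have "k \<le> nat (n + 1)" using n(2) by simp
  then have "U (nat (n + 1)) = U k" by (rule k)
  then have "basis_vec n i \<in> U (nat (n + 1)) n" using mem by metis
  then have "vin N (basis_vec n i)" using n(2) by (auto simp: U_def split: if_splits)
  then have "basis_vec n i n i \<in> N" unfolding vin_def by blast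
  then show False using one by (simp add: basis_vec_def)
qed

section \<open>Presentations of rings with carrier\<close>

lemma enat_Sup_mem:
  assumes "Sup A = enat k" "A \<noteq> {}"
  shows "enat k \<in> A"
proof -
  have "finite A" using assms by (auto simp: Sup_enat_def split: if_splits)
  then show ?thesis using assms Max_in[of A] by (simp add: Sup_enat_def)
qed

text \<open>A commutative ring on a carrier set is handled as a quotient of a type class ring \<open>'p\<close>, so that
  its ideals become ideals of \<open>'p\<close> containing the kernel \<open>ker\<close>.\<close>

locale ring_presentation = cring R for R (structure) +
  fixes \<phi> :: "'p::comm_ring_1 \<Rightarrow> 'a"
  assumes closed [simp]: "\<phi> x \<in> carrier R"
    and hom_add: "\<phi> (x + y) = \<phi> x \<oplus> \<phi> y"
    and hom_mult: "\<phi> (x * y) = \<phi> x \<otimes> \<phi> y"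
    and hom_one: "\<phi> 1 = \<one>"
    and surj: "r \<in> carrier R \<Longrightarrow> \<exists>x. \<phi> x = r"
begin

lemma hom_zero: "\<phi> 0 = \<zero>"
proof -
  have "\<phi> 0 \<oplus> \<phi> 0 = \<phi> 0" using hom_add[of 0 0] by simp
  then show ?thesis by (metis add.r_cancel_one closed)
qed

lemma hom_uminus: "\<phi> (- x) = \<ominus> \<phi> x"
proof -
  have "\<phi> (- x) \<oplus> \<phi> x = \<zero>" using hom_add[of "- x" x] hom_zero by simp
  then show ?thesis by (metis minus_equality closed)
qed

lemma hom_diff: "\<phi> (x - y) = \<phi> x \<ominus> \<phi> y"
  using hom_add[of x "- y"] hom_uminus by (simp add: a_minus_def)

lemma hom_sum: "\<phi> (\<Sum>x\<in>A. g x) = (\<Oplus>x\<in>A. \<phi> (g x))"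
  by (induction A rule: infinite_finite_induct) (auto simp: hom_zero hom_add finsum_infinite)

definition ker :: "'p set" where "ker = {x. \<phi> x = \<zero>}"

lemma eq_iff: "\<phi> x = \<phi> y \<longleftrightarrow> x - y \<in> ker"
  using hom_diff[of x y] by (simp add: ker_def r_right_minus_eq)

lemma vimage_ideal: "ideal I R \<Longrightarrow> ring_ideal (\<phi> -` I)"
proof -
  assume "ideal I R"
  then interpret I: ideal I R .
  show ?thesis by (auto simp: ring_ideal_def hom_zero hom_add hom_mult I.I_l_closed)
qed

lemma ker_subset: "ideal I R \<Longrightarrow> ker \<subseteq> \<phi> -` I"
  by (auto simp: ker_def additive_subgroup.zero_closed ideal_def)

lemma ker_ideal: "ring_ideal ker"
  using vimage_ideal[OF zeroideal] by (simp add: ker_def vimage_def)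

lemma image_ideal: "ring_ideal L \<Longrightarrow> ideal (\<phi> ` L) R"
proof (rule idealI)
  assume L: "ring_ideal L"
  show "ring R" ..
  show "subgroup (\<phi> ` L) (add_monoid R)"
  proof (rule add.subgroupI)
    show "\<phi> ` L \<subseteq> carrier R" by auto
    show "\<phi> ` L \<noteq> {}" using ring_idealD(1)[OF L] by auto
    show "\<ominus> a \<in> \<phi> ` L" if "a \<in> \<phi> ` L" for a using that ring_idealD(6)[OF L] hom_uminus by (auto simp: image_iff) metis
    show "a \<oplus> b \<in> \<phi> ` L" if "a \<in> \<phi> ` L" "b \<in> \<phi> ` L" for a b
      using that ring_idealD(2)[OF L] hom_add by (auto simp: image_iff) metis
  qed
  show "x \<otimes> a \<in> \<phi> ` L" if a: "a \<in> \<phi> ` L" and x: "x \<in> carrier R" for a x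
  proof -
    obtain y z where "y \<in> L" "a = \<phi> y" "x = \<phi> z" using a surj[OF x] by blast
    then show ?thesis using ring_idealD(3)[OF L, of y z] hom_mult[of z y] by (auto intro!: rev_image_eqI[of "z * y"])
  qed
  then show "a \<otimes> x \<in> \<phi> ` L" if "a \<in> \<phi> ` L" "x \<in> carrier R" for a x
    using that m_comm[of a x] by (metis closed imageE)
qed

lemma vimage_image: "ring_ideal L \<Longrightarrow> ker \<subseteq> L \<Longrightarrow> \<phi> -` (\<phi> ` L) = L"
proof
  assume L: "ring_ideal L" "ker \<subseteq> L"
  show "\<phi> -` (\<phi> ` L) \<subseteq> L"
  proof
    fix x assume "x \<in> \<phi> -` (\<phi> ` L)"
    then obtain y where "y \<in> L" "\<phi> x = \<phi> y" by auto
    then show "x \<in> L" using ring_ideal_cong[OF L(1), of x y] eq_iff L(2) by blast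
  qed
qed auto

lemma image_vimage: "I \<subseteq> carrier R \<Longrightarrow> \<phi> ` (\<phi> -` I) = I"
  using surj by (auto simp: image_iff) (metis subsetD)

text \<open>The dictionary through which hypotheses on sequences in \<open>R\<close> become
  statements about lifts modulo \<open>ker\<close>.\<close>

lemma vimage_Idl: "\<phi> -` (Idl (\<phi> ` g ` {..<s})) = gen_ideal ker g s"
proof
  have c: "\<phi> ` g ` {..<s} \<subseteq> carrier R" by auto
  show "gen_ideal ker g s \<subseteq> \<phi> -` (Idl (\<phi> ` g ` {..<s}))"
    using genideal_self[OF c] by (intro gen_ideal_least vimage_ideal ker_subset genideal_ideal c) auto
  have "Idl (\<phi> ` g ` {..<s}) \<subseteq> \<phi> ` gen_ideal ker g s"
    by (rule genideal_minimal) (auto intro!: image_ideal gen_ideal_ideal ker_ideal gen_ideal_mem)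
  then show "\<phi> -` (Idl (\<phi> ` g ` {..<s})) \<subseteq> gen_ideal ker g s"
    using vimage_image[OF gen_ideal_ideal[OF ker_ideal] gen_ideal_superset] by blast
qed

lemma vimage_prime: "primeideal p R \<Longrightarrow> prime_subset (\<phi> -` p)"
proof -
  assume "primeideal p R"
  then interpret p: primeideal p R .
  have "\<one> \<notin> p" using p.I_notcarr p.one_imp_carrier by auto
  then show ?thesis
    using vimage_ideal[OF p.is_ideal] p.I_prime by (auto simp: prime_subset_def hom_one hom_mult)
qed

lemma max_cond_ker:
  assumes "Defs.noetherian_ring R"
  shows "max_cond ker"
  unfolding max_cond_def
proof (intro allI impI)
  fix C assume C: "C \<noteq> {}" "\<forall>I\<in>C. ring_ideal I \<and> ker \<subseteq> I"
  interpret nr: noetherian_ring R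
    by unfold_locales (use assms in \<open>unfold Defs.noetherian_ring_def, blast\<close>)
  let ?A = "(`) \<phi> ` C"
  have Aid: "?A \<subseteq> {I. ideal I R}" using C(2) image_ideal by auto
  have "\<exists>M\<in>?A. \<forall>I\<in>?A. M \<subseteq> I \<longrightarrow> I = M"
  proof (rule subset_Zorn)
    fix D assume D: "subset.chain ?A D"
    show "\<exists>U\<in>?A. \<forall>I\<in>D. I \<subseteq> U"
    proof (cases "D = {}")
      case True
      then show ?thesis using C(1) by auto
    next
      case False
      have "D \<subseteq> {I. ideal I R}" using D Aid order_trans unfolding subset.chain_def by metis
      then have "subset.chain {I. ideal I R} D" using D by (simp add: subset.chain_def)
      then have "\<Union>D \<in> D" using nr.ideal_chain_is_trivial[OF False] by blast
      moreover from this have "\<Union>D \<in> ?A" using D unfolding subset.chain_def by blast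
      ultimately show ?thesis by (intro bexI[of _ "\<Union>D"]) auto
    qed
  qed
  then obtain M where M: "M \<in> C" "\<And>I. I \<in> C \<Longrightarrow> \<phi> ` M \<subseteq> \<phi> ` I \<Longrightarrow> \<phi> ` I = \<phi> ` M" by auto
  have "I = M" if "I \<in> C" "M \<subseteq> I" for I
    using M(2)[OF that(1) image_mono[OF that(2)]] vimage_image C(2) M(1) that(1) by metis
  then show "\<exists>M\<in>C. \<forall>I\<in>C. M \<subseteq> I \<longrightarrow> I = M" using M(1) by blast
qed

text \<open>Otherwise \<open>ker\<close> and \<open>s\<close> generate a proper ideal. Enlarged to a
  maximal one by the maximal condition, its image is a maximal ideal of \<open>R\<close>, hence
  \<open>n\<close>, although \<open>s\<close> was outside.\<close>

lemma local_unit: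
  assumes "Defs.noetherian_ring R" "local_ring R n" "s \<notin> \<phi> -` n"
  shows "\<exists>t. t * s - 1 \<in> ker"
proof (rule ccontr)
  assume no: "\<not> ?thesis"
  define P where "P L \<longleftrightarrow> ring_ideal L \<and> ker \<subseteq> L \<and> s \<in> L \<and> 1 \<notin> L" for L
  have "1 \<notin> adjoin ker s"
  proof
    assume "1 \<in> adjoin ker s"
    then obtain r where "1 - r * s \<in> ker" by (auto simp: adjoin_def)
    then have "r * s - 1 \<in> ker" using ring_idealD(6)[OF ker_ideal, of "1 - r * s"] by simp
    then show False using no by blast
  qed
  then have "P (adjoin ker s)"
    using ring_ideal_adjoin[OF ker_ideal] adjoin_superset adjoin_mem[OF ker_ideal] by (auto simp: P_def)
  then obtain M where M: "P M" and mx: "\<And>I. P I \<Longrightarrow> M \<subseteq> I \<Longrightarrow> I = M"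
    by (rule max_condE[OF max_cond_ker[OF assms(1)]]) (auto simp: P_def)
  from M[unfolded P_def] have Mi: "ring_ideal M" "ker \<subseteq> M" "s \<in> M" "1 \<notin> M" by auto
  have "maximalideal (\<phi> ` M) R"
  proof (rule maximalidealI)
    show "ideal (\<phi> ` M) R" by (rule image_ideal[OF Mi(1)])
    have "\<phi> 1 \<notin> \<phi> ` M" using vimage_image[OF Mi(1,2)] Mi(4) by blast
    then show "carrier R \<noteq> \<phi> ` M" by auto
    fix L assume L: "ideal L R" "\<phi> ` M \<subseteq> L" "L \<subseteq> carrier R"
    show "L = \<phi> ` M \<or> L = carrier R"
    proof (cases "\<one> \<in> L")
      case True
      then show ?thesis using ideal.one_imp_carrier[OF L(1)] by auto
    next
      case False
      have "M \<subseteq> \<phi> -` L" using L(2) by auto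
      moreover have "P (\<phi> -` L)"
        using vimage_ideal[OF L(1)] ker_subset[OF L(1)] False calculation Mi(3) by (auto simp: P_def hom_one)
      ultimately have "\<phi> -` L = M" using mx by blast
      then show ?thesis using image_vimage[OF L(3)] by auto
    qed
  qed
  then have "\<phi> ` M = n" using assms(2) by (auto simp: local_ring_def)
  then show False using assms(3) Mi(3) by auto
qed

text \<open>Regularity of the local ring supplies \<open>edim R n\<close> generators of
  \<open>n\<close> together with a chain of primes of the same length, as
  \<open>regular_of_prime_chain\<close> requires.\<close>

lemma regular_parameters:
  assumes "regular_local_ring R n"
  obtains x e where "regular_mod ker x e" "\<phi> -` n = gen_ideal ker x e"
proof -
  have nr: "Defs.noetherian_ring R" and lr: "local_ring R n" and dim: "krull_dim R = enat (edim R n)"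
    using assms by (auto simp: regular_local_ring_def)
  have mn: "maximalideal n R" using lr by (simp add: local_ring_def)
  then have pn: "primeideal n R" by (rule maximalideal_prime)
  let ?e = "edim R n"
  have "\<exists>k S. finite S \<and> S \<subseteq> carrier R \<and> card S = k \<and> n = Idl S"
    using nr maximalideal.axioms(1)[OF mn] by (auto simp: Defs.noetherian_ring_def)
  then have "\<exists>S. finite S \<and> S \<subseteq> carrier R \<and> card S = ?e \<and> n = Idl S"
    unfolding edim_def by (rule LeastI_ex[of "\<lambda>k. \<exists>S. finite S \<and> S \<subseteq> carrier R \<and> card S = k \<and> n = Idl S"])
  then obtain S where S: "finite S" "S \<subseteq> carrier R" "card S = ?e" "n = Idl S" by blast
  obtain g where g: "S = g ` {..<?e}"
    using ex_bij_betw_nat_finite[OF S(1)] S(3) by (auto simp: bij_betw_def atLeast0LessThan)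
  have "\<forall>i<?e. \<exists>y. \<phi> y = g i" using surj g S(2) by auto
  then obtain x where x: "\<And>i. i < ?e \<Longrightarrow> \<phi> (x i) = g i" by metis
  then have "S = \<phi> ` x ` {..<?e}" using g by (auto simp: image_iff)
  then have Nx: "\<phi> -` n = gen_ideal ker x ?e" using vimage_Idl[of x ?e] S(4) by simp
  \<comment> \<open>In \<open>enat\<close> the empty set has supremum 0, so dimension 0 alone does
    not provide a chain; there the single prime \<open>n\<close> serves.\<close>
  have "\<exists>p. (\<forall>i\<le>?e. primeideal (p i) R) \<and> (\<forall>i<?e. p i \<subset> p (Suc i))"
  proof (cases "?e = 0")
    case True
    then show ?thesis using pn by (intro exI[of _ "\<lambda>i. n"]) auto
  next
    case False
    define A where "A = {enat k | k. \<exists>p. (\<forall>i\<le>k. primeideal (p i) R) \<and> (\<forall>i<k. p i \<subset> p (Suc i))}"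
    have "Sup A = enat ?e" using dim by (simp add: krull_dim_def A_def)
    moreover from this have "A \<noteq> {}" using False by (auto simp: Sup_enat_def zero_enat_def)
    ultimately have "enat ?e \<in> A" by (rule enat_Sup_mem)
    then show ?thesis by (auto simp: A_def)
  qed
  then obtain p where p: "\<And>i. i \<le> ?e \<Longrightarrow> primeideal (p i) R" "\<And>i. i < ?e \<Longrightarrow> p i \<subset> p (Suc i)" by auto
  have pc: "p i \<subseteq> carrier R" if "i \<le> ?e" for i
    by (rule additive_subgroup.a_subset[OF ideal.axioms(1)[OF primeideal.axioms(1)[OF p(1)[OF that]]]])
  have "prime_chain (\<lambda>i. \<phi> -` p i) ?e"
    unfolding prime_chain_def
  proof (intro conjI allI impI)
    fix i assume i: "i < ?e"
    have "\<phi> -` p i \<noteq> \<phi> -` p (Suc i)"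
      using image_vimage[OF pc, of i] image_vimage[OF pc, of "Suc i"] p(2)[OF i] i by (metis Suc_leI less_imp_le psubset_eq)
    then show "\<phi> -` p i \<subset> \<phi> -` p (Suc i)" using p(2)[OF i] by auto
  qed (use vimage_prime p(1) in auto)
  moreover have "ker \<subseteq> \<phi> -` p 0" using ker_subset p(1)[of 0] primeideal.axioms(1) by blast
  moreover have "q \<subseteq> \<phi> -` n" if q: "prime_subset q" "ker \<subseteq> q" for q
  proof
    fix s assume s: "s \<in> q"
    show "s \<in> \<phi> -` n"
    proof (rule ccontr)
      assume "s \<notin> \<phi> -` n"
      then obtain t where "t * s - 1 \<in> ker" using local_unit[OF nr lr] by blast
      then have "t * s - (t * s - 1) \<in> q" using q s prime_subsetD(1)[OF q(1)] ring_idealD(3,5) by blast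
      then show False using prime_subsetD(2)[OF q(1)] by simp
    qed
  qed
  ultimately have "regular_mod ker x ?e"
    using regular_of_prime_chain[OF max_cond_ker[OF nr] ker_ideal vimage_prime[OF pn] _ local_unit[OF nr lr] Nx]
    by blast
  then show ?thesis using that Nx by blast
qed

lemma regular_seq_mod:
  assumes "regular_seq R (map \<phi> (map g [0..<s]))"
  shows "regular_mod ker g s"
  unfolding regular_mod_def
proof (intro allI impI)
  fix j a assume j: "j < s" and m: "g j * a \<in> gen_ideal ker g j"
  have st: "set (take j (map \<phi> (map g [0..<s]))) = \<phi> ` g ` {..<j}"
    using j by (auto simp: take_map atLeast0LessThan)
  let ?xs = "map \<phi> (map g [0..<s])"
  have "g j * a \<in> \<phi> -` (Idl (\<phi> ` g ` {..<j}))" using m vimage_Idl[of g j] by simp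
  then have "?xs ! j \<otimes> \<phi> a \<in> Idl (set (take j ?xs))" unfolding st using j by (simp add: hom_mult)
  moreover have "\<forall>i<length ?xs. \<forall>y\<in>carrier R. ?xs ! i \<otimes> y \<in> Idl (set (take i ?xs)) \<longrightarrow> y \<in> Idl (set (take i ?xs))"
    using assms unfolding regular_seq_def by blast
  ultimately have "\<phi> a \<in> Idl (set (take j ?xs))" using j by simp
  then have "\<phi> a \<in> Idl (\<phi> ` g ` {..<j})" unfolding st .
  then show "a \<in> gen_ideal ker g j" using vimage_Idl[of g j] by auto
qed

text \<open>A quotient of \<open>R\<close> is presented by the same ambient ring with a larger
  kernel, which lets matrices over it be lifted without changing the type.\<close>

lemma vimage_quot:
  assumes I: "ideal I R"
  shows "ring_presentation (R Quot I) (\<lambda>x. I +> \<phi> x)" "ring_presentation.ker (R Quot I) (\<lambda>x. I +> \<phi> x) = \<phi> -` I"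
proof -
  interpret I: ideal I R by (rule I)
  have h: "(+>) I \<in> ring_hom R (R Quot I)" by (rule I.rcos_ring_hom)
  interpret Q: cring "R Quot I" by (rule I.quotient_is_cring) (rule is_cring)
  show rp: "ring_presentation (R Quot I) (\<lambda>x. I +> \<phi> x)"
  proof
    show "I +> \<phi> x \<in> carrier (R Quot I)" for x using ring_hom_closed[OF h] by simp
    show "I +> \<phi> (x + y) = (I +> \<phi> x) \<oplus>\<^bsub>R Quot I\<^esub> (I +> \<phi> y)" for x y using ring_hom_add[OF h] hom_add by simp
    show "I +> \<phi> (x * y) = (I +> \<phi> x) \<otimes>\<^bsub>R Quot I\<^esub> (I +> \<phi> y)" for x y using ring_hom_mult[OF h] hom_mult by simp
    show "I +> \<phi> 1 = \<one>\<^bsub>R Quot I\<^esub>" using ring_hom_one[OF h] hom_one by simp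
    show "\<exists>x. I +> \<phi> x = r" if r: "r \<in> carrier (R Quot I)" for r
    proof -
      obtain q where "q \<in> carrier R" "r = I +> q" using r by (auto simp: FactRing_def A_RCOSETS_def')
      then show ?thesis using surj by blast
    qed
  qed
  have "I +> \<phi> x = I \<longleftrightarrow> \<phi> x \<in> I" for x
    using I.a_rcos_const I.a_rcos_self[of "\<phi> x"] by auto
  then show "ring_presentation.ker (R Quot I) (\<lambda>x. I +> \<phi> x) = \<phi> -` I"
    unfolding ring_presentation.ker_def[OF rp] by (auto simp: FactRing_def)
qed

end

text \<open>The presenting ring is the polynomial ring over the integers on the elements of the carrier.\<close>

lemma (in cring) presentation_exists:
  "\<exists>\<phi> :: ('a multiset \<Rightarrow>\<^sub>0 int) \<Rightarrow> 'a. ring_presentation R \<phi>"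
proof -
  define c where "c x = (if x \<in> carrier R then x else \<one>)" for x
  have cc [simp]: "c x \<in> carrier R" for x by (simp add: c_def)
  \<comment> \<open>The case distinction makes \<open>step\<close> commute on all arguments, also
    outside the carrier, as \<open>comp_fun_commute\<close> demands.\<close>
  define step where "step x y = (if y \<in> carrier R then c x \<otimes> y else y)" for x y
  interpret st: comp_fun_commute step
    by unfold_locales (auto simp: step_def fun_eq_iff m_lcomm)
  define \<mu> where "\<mu> m = fold_mset step \<one> m" for m
  have mu0: "\<mu> {#} = \<one>" by (simp add: \<mu>_def)
  have muc [simp]: "\<mu> m \<in> carrier R" for m by (induction m) (auto simp: \<mu>_def step_def)
  have mu_add1: "\<mu> (add_mset x m) = c x \<otimes> \<mu> m" for x m
    using muc[of m] by (simp add: \<mu>_def step_def)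
  have mu_add: "\<mu> (m + m') = \<mu> m \<otimes> \<mu> m'" for m m'
    by (induction m) (simp_all add: mu0 mu_add1 m_assoc)
  \<comment> \<open>Additively the presenting ring is the free abelian group on multisets, whose
    universal property gives \<open>h\<close>. Multiplicativity is checked on generators.\<close>
  obtain h where h: "h \<in> hom (free_Abelian_group UNIV) (add_monoid R)" "\<And>m. h (frag_of m) = \<mu> m"
    by (rule add.free_Abelian_group_universal[of \<mu> UNIV]) auto
  have hc [simp]: "h p \<in> carrier R" for p using hom_in_carrier[OF h(1), of p] by simp
  have ha: "h (p + q) = h p \<oplus> h q" for p q using hom_mult[OF h(1), of p q] by simp
  have h0: "h 0 = \<zero>" using ha[of 0 0] by (metis add.r_cancel_one hc add_0)
  have hd: "h (p - q) = h p \<ominus> h q" for p q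
  proof -
    have "h (p - q) \<oplus> h q = h p" using ha[of "p - q" q] by simp
    then show ?thesis by (metis a_minus_def add.inv_solve_right' hc add.m_comm add.inv_closed)
  qed
  have hm1: "h (frag_of m * q) = \<mu> m \<otimes> h q" for m q
  proof (rule frag_induction[of q UNIV])
    fix m'
    have "frag_of m * frag_of m' = frag_of (m + m')" by (simp add: mult_single)
    then show "h (frag_of m * frag_of m') = \<mu> m \<otimes> h (frag_of m')" using h(2) mu_add by simp
  qed (simp_all add: h0 hd right_diff_distrib r_minus a_minus_def r_distr)
  have hm: "h (p * q) = h p \<otimes> h q" for p q
    by (rule frag_induction[of p UNIV])
      (simp_all add: h0 hd hm1 h(2) left_diff_distrib l_minus a_minus_def l_distr)
  have "ring_presentation R h"
  proof
    have "(1 :: 'a multiset \<Rightarrow>\<^sub>0 int) = frag_of 0" by simp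
    then show "h 1 = \<one>" using h(2)[of 0] mu0 by simp
    show "\<exists>p. h p = r" if "r \<in> carrier R" for r
      using h(2)[of "{#r#}"] mu_add1[of r "{#}"] mu0 that by (intro exI[of _ "frag_of {#r#}"]) (simp add: c_def)
  qed (auto simp: ha hm)
  then show ?thesis by blast
qed

section \<open>Initial forms\<close>

text \<open>The intended instance consists of the preimages of the powers of the maximal
  ideal.\<close>

locale ring_filtration =
  fixes W :: "nat \<Rightarrow> 'p::comm_ring_1 set"
  assumes W_ideal: "ring_ideal (W i)" and W_0: "W 0 = UNIV" and W_Suc: "W (Suc i) \<subseteq> W i"
    and W_mult: "x \<in> W i \<Longrightarrow> y \<in> W j \<Longrightarrow> x * y \<in> W (i + j)"
begin

lemmas WD = ring_idealD[OF W_ideal]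

lemma W_antimono: "i \<le> j \<Longrightarrow> W j \<subseteq> W i"
  using lift_Suc_antimono_le[of W, OF W_Suc] .

lemma W_mono_mult: "x \<in> W i \<Longrightarrow> y \<in> W j \<Longrightarrow> k \<le> i + j \<Longrightarrow> x * y \<in> W k"
  using W_mult W_antimono by blast

text \<open>The degree \<open>i\<close> part of the ideal generated by the initial forms of \<open>g 0, \<dots>, g (l - 1)\<close>,
  of degrees \<open>\<delta> 0, \<dots>, \<delta> (l - 1)\<close>, lifted to \<open>W i\<close>.\<close>

primrec initial_part :: "(nat \<Rightarrow> 'p) \<Rightarrow> (nat \<Rightarrow> nat) \<Rightarrow> nat \<Rightarrow> nat \<Rightarrow> 'p set" where
  "initial_part g \<delta> 0 i = W (Suc i)"
| "initial_part g \<delta> (Suc l) i =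
     {z. \<exists>u. (if \<delta> l \<le> i then u \<in> W (i - \<delta> l) else u = 0) \<and> z - u * g l \<in> initial_part g \<delta> l i}"

lemma initial_part_closed:
  "0 \<in> initial_part g \<delta> l i"
  "x \<in> initial_part g \<delta> l i \<Longrightarrow> y \<in> initial_part g \<delta> l i \<Longrightarrow> x + y \<in> initial_part g \<delta> l i"
  "a \<in> W j \<Longrightarrow> x \<in> initial_part g \<delta> l i \<Longrightarrow> a * x \<in> initial_part g \<delta> l (j + i)"
  "W (Suc i) \<subseteq> initial_part g \<delta> l i"
proof (induction l arbitrary: x y)
  case 0
  { case 1 show ?case using WD(1) by simp next
    case 2 then show ?case using WD(2) by simp next
    case 3 then show ?case using W_mult[of a j x "Suc i"] by simp next
    case 4 show ?case by simp }
next
  case (Suc l)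
  { case 1 then show ?case using Suc(1) WD(1) by (auto intro!: exI[of _ 0])
  next
    case 2
    then obtain u v where u: "if \<delta> l \<le> i then u \<in> W (i - \<delta> l) else u = 0" "x - u * g l \<in> initial_part g \<delta> l i"
      "if \<delta> l \<le> i then v \<in> W (i - \<delta> l) else v = 0" "y - v * g l \<in> initial_part g \<delta> l i" by auto
    have "(x + y) - (u + v) * g l \<in> initial_part g \<delta> l i"
      using Suc(2)[OF u(2,4)] by (simp add: algebra_simps)
    moreover have "if \<delta> l \<le> i then u + v \<in> W (i - \<delta> l) else u + v = 0"
      using u(1,3) WD(2) by (auto split: if_splits)
    ultimately show ?case by auto
  next
    case 3
    then obtain u where u: "if \<delta> l \<le> i then u \<in> W (i - \<delta> l) else u = 0" "x - u * g l \<in> initial_part g \<delta> l i" by auto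
    have "a * x - (a * u) * g l \<in> initial_part g \<delta> l (j + i)"
      using Suc(3)[OF 3(1) u(2)] by (simp add: algebra_simps)
    moreover have "if \<delta> l \<le> j + i then a * u \<in> W (j + i - \<delta> l) else a * u = 0"
      using u(1) W_mult[OF 3(1), of u "i - \<delta> l"] WD(1) by (auto split: if_splits)
    ultimately show ?case by auto
  next
    case 4 then show ?case using Suc(4) WD(1) by (auto intro!: exI[of _ 0])
  }
qed

lemma initial_part_uminus: "x \<in> initial_part g \<delta> l i \<Longrightarrow> - x \<in> initial_part g \<delta> l i"
  using initial_part_closed(3)[of "-1" 0 x g \<delta> l i] W_0 by simp

lemma initial_part_diff: "x \<in> initial_part g \<delta> l i \<Longrightarrow> y \<in> initial_part g \<delta> l i \<Longrightarrow> x - y \<in> initial_part g \<delta> l i"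
  using initial_part_closed(2)[of x g \<delta> l i "- y"] initial_part_uminus by simp

lemma initial_part_sum: "(\<And>x. x \<in> A \<Longrightarrow> h x \<in> initial_part g \<delta> l i) \<Longrightarrow> sum h A \<in> initial_part g \<delta> l i"
  by (induction A rule: infinite_finite_induct) (auto simp: initial_part_closed)

lemma initial_part_mono: "l \<le> l' \<Longrightarrow> initial_part g \<delta> l i \<subseteq> initial_part g \<delta> l' i"
proof (induction l')
  case (Suc l')
  have "initial_part g \<delta> l' i \<subseteq> initial_part g \<delta> (Suc l') i" using WD(1) by (auto intro!: exI[of _ 0])
  then show ?case using Suc by (auto simp: le_Suc_eq simp del: initial_part.simps)
qed simp

lemma initial_part_gen: "j < l \<Longrightarrow> g j \<in> initial_part g \<delta> l (\<delta> j)"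
proof -
  assume "j < l"
  have "g j \<in> initial_part g \<delta> (Suc j) (\<delta> j)"
    using W_0 initial_part_closed(1)[of g \<delta> j] by (auto intro!: exI[of _ 1])
  then show ?thesis using initial_part_mono[of "Suc j" l g \<delta> "\<delta> j"] \<open>j < l\<close> by auto
qed

lemma initial_part_sumI:
  assumes "\<And>j. j < l \<Longrightarrow> g j \<in> W (\<delta> j)" "\<And>j. j < l \<Longrightarrow> u j \<in> W (i - \<delta> j)"
  shows "(\<Sum>j<l. g j * u j) \<in> initial_part g \<delta> l i"
  using assms
proof (induction l)
  case (Suc l)
  then have IH: "(\<Sum>j<l. g j * u j) \<in> initial_part g \<delta> l i" by simp
  show ?case
  proof (cases "\<delta> l \<le> i")
    case True
    then show ?thesis using IH Suc.prems(2)[of l] by (auto intro!: exI[of _ "u l"] simp: mult.commute)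
  next
    case False
    \<comment> \<open>Truncated subtraction imposes no condition on \<open>u l\<close> here, but
      \<open>g l\<close> alone has order above \<open>i\<close>.\<close>
    then have "g l * u l \<in> W (Suc i)" using W_mono_mult[OF Suc.prems(1)[of l] Suc.prems(2)[of l], of "Suc i"] by simp
    then have "(\<Sum>j<Suc l. g j * u j) \<in> initial_part g \<delta> l i"
      using initial_part_closed(2)[OF IH subsetD[OF initial_part_closed(4)]] by simp
    then show ?thesis using initial_part_mono[of l "Suc l" g \<delta> i] by (simp del: initial_part.simps add: subset_iff)
  qed
qed (use WD(1) in simp)

lemma initial_part_sumE:
  assumes "z \<in> initial_part g \<delta> l i"
  shows "\<exists>u. (\<forall>j<l. if \<delta> j \<le> i then u j \<in> W (i - \<delta> j) else u j = 0) \<and> z - (\<Sum>j<l. g j * u j) \<in> W (Suc i)"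
  using assms
proof (induction l arbitrary: z)
  case (Suc l)
  then obtain v where v: "if \<delta> l \<le> i then v \<in> W (i - \<delta> l) else v = 0" "z - v * g l \<in> initial_part g \<delta> l i" by auto
  from Suc.IH[OF v(2)] obtain u where u: "\<forall>j<l. if \<delta> j \<le> i then u j \<in> W (i - \<delta> j) else u j = 0"
    "z - v * g l - (\<Sum>j<l. g j * u j) \<in> W (Suc i)" by blast
  have "(\<Sum>j<l. g j * (u(l := v)) j) = (\<Sum>j<l. g j * u j)" by (rule sum.cong) auto
  then have "z - (\<Sum>j<Suc l. g j * (u(l := v)) j) = z - v * g l - (\<Sum>j<l. g j * u j)" by (simp add: mult.commute)
  then have "z - (\<Sum>j<Suc l. g j * (u(l := v)) j) \<in> W (Suc i)" using u(2) by metis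
  moreover have "\<forall>j<Suc l. if \<delta> j \<le> i then (u(l := v)) j \<in> W (i - \<delta> j) else (u(l := v)) j = 0"
    using u(1) v(1) by (auto simp: less_Suc_eq)
  ultimately show ?case by blast
qed auto

text \<open>If the initial forms of the \<open>g j\<close> form a regular sequence, every relation is raised in order,
  degree by degree, by subtracting Koszul relations.\<close>

lemma coefficients_positive_order:
  assumes g: "\<And>j. j < c \<Longrightarrow> g j \<in> W (\<delta> j)" and pos: "\<And>j. j < c \<Longrightarrow> 1 \<le> \<delta> j"
    and reg: "\<And>l a t. l < c \<Longrightarrow> t \<in> W a \<Longrightarrow> g l * t \<in> initial_part g \<delta> l (\<delta> l + a) \<Longrightarrow> t \<in> initial_part g \<delta> l a"
    and d: "\<And>j. j < c \<Longrightarrow> \<delta> j \<le> d" and rel: "(\<Sum>j<c. g j * t j) \<in> W (Suc d)" and j: "j < c"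
  shows "t j \<in> W 1"
proof -
  have g1: "g j \<in> W 1" if "j < c" for j using g[OF that] W_antimono[OF pos[OF that]] by blast
  \<comment> \<open>One round treats the indices from the last to the first; those from
    \<open>l\<close> on have already gained an order. Coefficients change only by elements of
    \<open>W 1\<close>, which is harmless for the conclusion.\<close>
  have step: "\<exists>t'. (\<forall>j<c. t' j - t j \<in> W 1 \<and> t' j \<in> W (\<mu> - \<delta> j) \<and> (l \<le> j \<longrightarrow> t' j \<in> W (Suc \<mu> - \<delta> j))) \<and>
      (\<Sum>j<c. g j * t' j) = (\<Sum>j<c. g j * t j)"
    if t: "\<And>j. j < c \<Longrightarrow> t j \<in> W (\<mu> - \<delta> j)" and S: "(\<Sum>j<c. g j * t j) \<in> W (Suc \<mu>)" and l: "l \<le> c" for t \<mu> l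
    using l
  proof (induction rule: inc_induct)
    case base
    show ?case by (rule exI[of _ t]) (use t WD(1) in auto)
  next
    case (step l)
    then obtain t' where t': "\<And>j. j < c \<Longrightarrow> t' j - t j \<in> W 1" "\<And>j. j < c \<Longrightarrow> t' j \<in> W (\<mu> - \<delta> j)"
      "\<And>j. j < c \<Longrightarrow> Suc l \<le> j \<Longrightarrow> t' j \<in> W (Suc \<mu> - \<delta> j)"
      "(\<Sum>j<c. g j * t' j) = (\<Sum>j<c. g j * t j)" by auto
    have lc: "l < c" using step by simp
    show ?case
    proof (cases "\<delta> l \<le> \<mu>")
      case False
      then have "Suc \<mu> - \<delta> l = 0" by simp
      then have "t' l \<in> W (Suc \<mu> - \<delta> l)" using W_0 by simp
      then have "\<forall>j<c. l \<le> j \<longrightarrow> t' j \<in> W (Suc \<mu> - \<delta> j)" using t'(3) by (metis le_antisym not_less_eq_eq)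
      then show ?thesis using t' by blast
    next
      case True
      have split: "(\<Sum>j<c. h j) = (\<Sum>j<l. h j) + h l + (\<Sum>j\<in>{Suc l..<c}. h j)" for h :: "nat \<Rightarrow> 'p"
      proof -
        have "{..<c} = {..<l} \<union> {l} \<union> {Suc l..<c}" using lc by auto
        then have "(\<Sum>j<c. h j) = (\<Sum>j\<in>{..<l} \<union> {l} \<union> {Suc l..<c}. h j)" by simp
        also have "\<dots> = (\<Sum>j<l. h j) + h l + (\<Sum>j\<in>{Suc l..<c}. h j)"
          by (subst sum.union_disjoint, auto)+
        finally show ?thesis .
      qed
      have hi: "(\<Sum>j\<in>{Suc l..<c}. g j * t' j) \<in> W (Suc \<mu>)"
        by (intro ring_ideal_sum[OF W_ideal] W_mono_mult[OF g t'(3)]) auto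
      have lo: "(\<Sum>j<l. g j * t' j) \<in> initial_part g \<delta> l \<mu>"
        using g t'(2) lc by (intro initial_part_sumI) auto
      have "(\<Sum>j<c. g j * t' j) - (\<Sum>j\<in>{Suc l..<c}. g j * t' j) \<in> W (Suc \<mu>)"
        using S t'(4) hi by (intro WD(5)) auto
      then have "(\<Sum>j<c. g j * t' j) - (\<Sum>j\<in>{Suc l..<c}. g j * t' j) - (\<Sum>j<l. g j * t' j) \<in> initial_part g \<delta> l \<mu>"
        by (rule initial_part_diff[OF subsetD[OF initial_part_closed(4)] lo])
      then have "g l * t' l \<in> initial_part g \<delta> l (\<delta> l + (\<mu> - \<delta> l))"
        using split[of "\<lambda>j. g j * t' j"] True by simp
      then have "t' l \<in> initial_part g \<delta> l (\<mu> - \<delta> l)" using reg[OF lc t'(2)[OF lc]] by blast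
      then obtain u where u: "\<And>j. j < l \<Longrightarrow> if \<delta> j \<le> \<mu> - \<delta> l then u j \<in> W (\<mu> - \<delta> l - \<delta> j) else u j = 0"
        "t' l - (\<Sum>j<l. g j * u j) \<in> W (Suc (\<mu> - \<delta> l))" using initial_part_sumE by blast
      \<comment> \<open>These are Koszul relations between \<open>g l\<close> and the earlier
        \<open>g j\<close> with factors \<open>u j\<close>: the total sum is unchanged, and the
        coefficient at \<open>l\<close> moves to the next order.\<close>
      define t2 where "t2 j = (if j < l then t' j + g l * u j else if j = l then t' l - (\<Sum>j<l. g j * u j) else t' j)" for j
      have t2: "(\<Sum>j<l. g j * t2 j) = (\<Sum>j<l. g j * t' j) + g l * (\<Sum>j<l. g j * u j)"
        "(\<Sum>j\<in>{Suc l..<c}. g j * t2 j) = (\<Sum>j\<in>{Suc l..<c}. g j * t' j)"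
        by (auto simp: t2_def sum_distrib_left sum.distrib algebra_simps intro!: sum.cong)
      have "(\<Sum>j<c. g j * t2 j) = (\<Sum>j<c. g j * t' j)"
        unfolding split t2 by (simp add: t2_def algebra_simps)
      moreover have "t2 j - t j \<in> W 1 \<and> t2 j \<in> W (\<mu> - \<delta> j) \<and> (l \<le> j \<longrightarrow> t2 j \<in> W (Suc \<mu> - \<delta> j))" if jc: "j < c" for j
      proof -
        consider "j < l" | "j = l" | "l < j" by linarith
        then show ?thesis
        proof cases
          case 1
          have "g l * u j \<in> W 1" using WD(4)[OF g1[OF lc]] by blast
          then have "t' j - t j + g l * u j \<in> W 1" using t'(1)[OF jc] WD(2) by blast
          moreover have "g l * u j \<in> W (\<mu> - \<delta> j)"
            using u(1)[OF 1] WD(1) W_mono_mult[OF g[OF lc], of "u j" "\<mu> - \<delta> l - \<delta> j" "\<mu> - \<delta> j"] by (auto split: if_splits)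
          ultimately show ?thesis using 1 t'(2)[OF jc] WD(2) by (simp add: t2_def algebra_simps)
        next
          case 2
          have "(\<Sum>j<l. g j * u j) \<in> W 1"
            using g1 lc by (intro ring_ideal_sum[OF W_ideal] WD(4)) auto
          then have "t' l - t l - (\<Sum>j<l. g j * u j) \<in> W 1" using t'(1)[OF lc] WD(5) by blast
          moreover have m: "t2 l \<in> W (Suc \<mu> - \<delta> l)" using u(2) True by (simp add: t2_def Suc_diff_le)
          moreover have "t2 l \<in> W (\<mu> - \<delta> l)" by (rule subsetD[OF W_antimono m]) simp
          ultimately show ?thesis using 2 by (simp add: t2_def algebra_simps)
        next
          case 3
          then show ?thesis using t'(1,2,3)[OF jc] by (simp add: t2_def)
        qed
      qed
      ultimately show ?thesis using t'(4) by (intro exI[of _ t2]) auto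
    qed
  qed
  have "\<exists>t'. (\<forall>j<c. t' j - t j \<in> W 1 \<and> t' j \<in> W (\<mu> - \<delta> j)) \<and> (\<Sum>j<c. g j * t' j) = (\<Sum>j<c. g j * t j)"
    if "\<mu> \<le> Suc d" for \<mu> using that
  proof (induction \<mu>)
    case 0
    show ?case by (rule exI[of _ t]) (use W_0 WD(1) in auto)
  next
    case (Suc \<mu>)
    then obtain t' where t': "\<And>j. j < c \<Longrightarrow> t' j - t j \<in> W 1" "\<And>j. j < c \<Longrightarrow> t' j \<in> W (\<mu> - \<delta> j)"
      "(\<Sum>j<c. g j * t' j) = (\<Sum>j<c. g j * t j)" by auto
    have "(\<Sum>j<c. g j * t' j) \<in> W (Suc \<mu>)" using rel t'(3) W_antimono[of "Suc \<mu>" "Suc d"] Suc.prems by auto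
    from step[OF t'(2) this, of 0] obtain t2 where
      t2: "\<And>j. j < c \<Longrightarrow> t2 j - t' j \<in> W 1" "\<And>j. j < c \<Longrightarrow> t2 j \<in> W (Suc \<mu> - \<delta> j)"
      "(\<Sum>j<c. g j * t2 j) = (\<Sum>j<c. g j * t' j)" by auto
    have "t2 j - t j \<in> W 1" if "j < c" for j using WD(2)[OF t2(1)[OF that] t'(1)[OF that]] by simp
    then show ?case using t2(2,3) t'(3) by (intro exI[of _ t2]) auto
  qed
  then obtain t' where t': "t' j - t j \<in> W 1" "t' j \<in> W (Suc d - \<delta> j)" using j by blast
  \<comment> \<open>The bound on the degrees enters here: the order reached after the last round is
    positive for every index.\<close>
  have "1 \<le> Suc d - \<delta> j" using d[OF j] by linarith
  then have "t' j \<in> W 1" using t'(2) W_antimono by blast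
  then show ?thesis using WD(5)[of "t' j" 1 "t' j - t j"] t'(1) by simp
qed

end

section \<open>The associated graded ring as a quotient of a Rees algebra\<close>

locale presented_filtration = ring_presentation R \<phi> for R (structure) and \<phi> :: "'p::comm_ring_1 \<Rightarrow> 'a" +
  fixes n :: "'a set"
  assumes n: "ideal n R"
begin

abbreviation "npow \<equiv> idealpow R n"

lemma pow_ideal: "ideal (npow i) R"
  by (induction i) (auto intro: oneideal ideal_prod_is_ideal n)

lemma pow_carrier: "x \<in> npow i \<Longrightarrow> x \<in> carrier R"
  by (rule ideal.Icarr[OF pow_ideal])

lemma pow_Suc: "npow (Suc i) \<subseteq> npow i"
  using ideal_prod_inter[OF n pow_ideal] by auto

lemma pow_mult: "x \<in> npow i \<Longrightarrow> y \<in> npow j \<Longrightarrow> x \<otimes> y \<in> npow (i + j)"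
proof (induction i arbitrary: x)
  case 0
  then show ?case using ideal.I_l_closed[OF pow_ideal] by simp
next
  case (Suc i)
  have yc: "y \<in> carrier R" using pow_carrier Suc.prems(2) .
  have "x \<in> ideal_prod R n (npow i)" using Suc.prems(1) by simp
  then have "x \<in> carrier R \<and> x \<otimes> y \<in> ideal_prod R n (npow (i + j))"
  proof (induction rule: ideal_prod.induct)
    case (prod a b)
    have "a \<in> carrier R" "b \<in> carrier R" using prod ideal.Icarr[OF n] pow_carrier by auto
    then show ?case using ideal_prod.prod[OF prod(1) Suc.IH[OF prod(2) Suc.prems(2)], of R] yc by (simp add: m_assoc)
  next
    case (sum s1 s2)
    then show ?case using yc by (auto simp: l_distr intro: ideal_prod.sum)
  qed
  then show ?case by simp
qed

definition W :: "nat \<Rightarrow> 'p set" where "W i = \<phi> -` npow i"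

sublocale ring_filtration W
proof
  show "ring_ideal (W i)" for i unfolding W_def by (rule vimage_ideal[OF pow_ideal])
  show "W 0 = UNIV" by (auto simp: W_def)
  show "W (Suc i) \<subseteq> W i" for i unfolding W_def using pow_Suc by blast
  show "x \<in> W i \<Longrightarrow> y \<in> W j \<Longrightarrow> x * y \<in> W (i + j)" for x y i j by (simp add: W_def hom_mult pow_mult)
qed

lemma W_1: "W 1 = \<phi> -` n"
proof -
  have "ideal_prod R n (carrier R) = n"
  proof
    show "ideal_prod R n (carrier R) \<subseteq> n" using ideal_prod_inter[OF n oneideal] by auto
    show "n \<subseteq> ideal_prod R n (carrier R)"
    proof
      fix x assume "x \<in> n"
      then show "x \<in> ideal_prod R n (carrier R)"
        using ideal_prod.prod[of x n \<one> "carrier R" R] ideal.Icarr[OF n] by simp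
    qed
  qed
  then show ?thesis by (simp add: W_def)
qed

lemma ker_W: "ker \<subseteq> W i"
  unfolding W_def by (rule ker_subset[OF pow_ideal])

abbreviation "G \<equiv> assoc_graded R n"

definition cls :: "nat \<Rightarrow> 'p \<Rightarrow> 'a set" where "cls i x = npow (Suc i) +> \<phi> x"

lemma cls_eq_iff: "cls i x = cls i y \<longleftrightarrow> x - y \<in> W (Suc i)"
proof -
  have "cls i x = cls i y \<longleftrightarrow> \<phi> x \<ominus> \<phi> y \<in> npow (Suc i)"
    unfolding cls_def using quotient_eq_iff_same_a_r_cos[OF pow_ideal closed closed] by blast
  then show ?thesis by (simp add: W_def hom_diff del: idealpow.simps)
qed

lemma cls_add: "cls i x <+> cls i y = cls i (x + y)"
  unfolding cls_def hom_add by (rule ideal.a_rcos_sum[OF pow_ideal closed closed])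

text \<open>Products in the graded ring use arbitrary representatives; they differ from the given
  ones by elements of higher order only.\<close>

lemma coset_rep_cls: "\<exists>y. coset_rep (cls i x) = \<phi> y \<and> y - x \<in> W (Suc i)"
proof -
  interpret I: ideal "npow (Suc i)" R by (rule pow_ideal)
  have "\<phi> x \<in> cls i x" unfolding cls_def by (rule I.a_rcos_self) simp
  then have r: "coset_rep (cls i x) \<in> cls i x" unfolding coset_rep_def by (rule someI)
  then have "coset_rep (cls i x) \<in> carrier R" unfolding cls_def using a_r_coset_subset_G[OF I.a_subset closed] by blast
  then obtain y where y: "\<phi> y = coset_rep (cls i x)" using surj by blast
  have "cls i y = cls i x" using r unfolding y[symmetric] unfolding cls_def
    by (rule I.a_repr_independence'[OF _ closed, symmetric])
  then show ?thesis using y cls_eq_iff by metis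
qed

definition gr :: "'p poly \<Rightarrow> nat \<Rightarrow> 'a set" where "gr p = (\<lambda>i. cls i (Polynomial.coeff p i))"

text \<open>The Rees algebra of the filtration, realised inside the polynomials. It maps onto the
  associated graded ring by \<open>gr\<close>, so families of cosets can be replaced by
  coefficients.\<close>

definition rees :: "'p poly set" where "rees = {p. \<forall>i. Polynomial.coeff p i \<in> W i}"

lemma gr_eq_iff: "gr p = gr q \<longleftrightarrow> (\<forall>i. Polynomial.coeff p i - Polynomial.coeff q i \<in> W (Suc i))"
  by (simp add: gr_def fun_eq_iff cls_eq_iff)

lemma carrier_G: "carrier G = gr ` rees"
proof
  show "gr ` rees \<subseteq> carrier G"
  proof
    fix x assume "x \<in> gr ` rees"
    then obtain p where p: "p \<in> rees" "x = gr p" by blast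
    have "finite {i. gr p i \<noteq> npow (Suc i) +> \<zero>}"
    proof (rule finite_subset)
      show "{i. gr p i \<noteq> npow (Suc i) +> \<zero>} \<subseteq> {..Polynomial.degree p}"
        by (auto simp: gr_def cls_def coeff_eq_0 hom_zero intro!: leI)
    qed simp
    then show "x \<in> carrier G" using p by (auto simp: assoc_graded_def graded_carrier_def gr_def cls_def rees_def W_def)
  qed
  show "carrier G \<subseteq> gr ` rees"
  proof
    fix x assume "x \<in> carrier G"
    then have x: "\<And>i. \<exists>r\<in>npow i. x i = npow (Suc i) +> r" "finite {i. x i \<noteq> npow (Suc i) +> \<zero>}"
      by (auto simp: assoc_graded_def graded_carrier_def)
    have "\<exists>y. y \<in> W i \<and> x i = cls i y \<and> (x i = npow (Suc i) +> \<zero> \<longrightarrow> y = 0)" for i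
    proof (cases "x i = npow (Suc i) +> \<zero>")
      case True
      then show ?thesis using WD(1) by (auto simp: cls_def hom_zero intro!: exI[of _ 0])
    next
      case False
      obtain r where r: "r \<in> npow i" "x i = npow (Suc i) +> r" using x(1) by blast
      then obtain y where "\<phi> y = r" using surj pow_carrier by blast
      then show ?thesis using r False by (auto simp: cls_def W_def intro!: exI[of _ y])
    qed
    then obtain y where y: "\<And>i. y i \<in> W i" "\<And>i. x i = cls i (y i)" "\<And>i. x i = npow (Suc i) +> \<zero> \<Longrightarrow> y i = 0" by metis
    have "finite {i. y i \<noteq> 0}" by (rule finite_subset[OF _ x(2)]) (use y(3) in auto)
    then have c: "Polynomial.coeff (Abs_poly y) = y" by (intro Abs_poly_inverse) (simp add: eventually_cofinite)
    have "x = gr (Abs_poly y)" "Abs_poly y \<in> rees" using y by (auto simp: gr_def rees_def c)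
    then show "x \<in> gr ` rees" by blast
  qed
qed

lemma rees_mult: "p \<in> rees \<Longrightarrow> q \<in> rees \<Longrightarrow> p * q \<in> rees"
  unfolding rees_def mem_Collect_eq coeff_mult
  by (intro allI ring_ideal_sum[OF W_ideal] W_mono_mult) auto

lemma rees_closed: "0 \<in> rees" "1 \<in> rees" "p \<in> rees \<Longrightarrow> q \<in> rees \<Longrightarrow> p + q \<in> rees" "p \<in> rees \<Longrightarrow> - p \<in> rees"
  "x \<in> W i \<Longrightarrow> Polynomial.monom x i \<in> rees"
  using WD W_0 by (auto simp: rees_def coeff_eq_0 simp flip: monom_0 one_pCons)

lemma gr_add: "gr p \<oplus>\<^bsub>G\<^esub> gr q = gr (p + q)"
  by (simp add: assoc_graded_def graded_add_def gr_def cls_add fun_eq_iff)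

lemma gr_mult:
  assumes p: "p \<in> rees" and q: "q \<in> rees"
  shows "gr p \<otimes>\<^bsub>G\<^esub> gr q = gr (p * q)"
proof
  fix k
  define a where "a i = (SOME y. coset_rep (gr p i) = \<phi> y \<and> y - Polynomial.coeff p i \<in> W (Suc i))" for i
  define b where "b i = (SOME y. coset_rep (gr q i) = \<phi> y \<and> y - Polynomial.coeff q i \<in> W (Suc i))" for i
  have a: "coset_rep (gr p i) = \<phi> (a i)" "a i - Polynomial.coeff p i \<in> W (Suc i)" for i
    using someI_ex[OF coset_rep_cls[of i "Polynomial.coeff p i"]] unfolding a_def gr_def by blast+
  have b: "coset_rep (gr q i) = \<phi> (b i)" "b i - Polynomial.coeff q i \<in> W (Suc i)" for i
    using someI_ex[OF coset_rep_cls[of i "Polynomial.coeff q i"]] unfolding b_def gr_def by blast+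
  have "(gr p \<otimes>\<^bsub>G\<^esub> gr q) k = cls k (\<Sum>i\<le>k. a i * b (k - i))"
    by (simp add: assoc_graded_def graded_mult_def cls_def hom_sum hom_mult a(1) b(1))
  also have "\<dots> = cls k (Polynomial.coeff (p * q) k)"
    unfolding cls_eq_iff coeff_mult sum_subtractf[symmetric]
  proof (rule ring_ideal_sum[OF W_ideal])
    fix i assume i: "i \<in> {..k}"
    let ?p = "Polynomial.coeff p i" and ?q = "Polynomial.coeff q (k - i)"
    have pW: "?p \<in> W i" "?q \<in> W (k - i)" using p q by (auto simp: rees_def)
    have "b (k - i) \<in> W (k - i)"
      using ring_ideal_cong[OF W_ideal, of "b (k - i)" ?q "k - i"] b(2)[of "k - i"] W_Suc pW by blast
    then have "(a i - ?p) * b (k - i) \<in> W (Suc k)" using W_mono_mult[OF a(2)] i by simp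
    moreover have "?p * (b (k - i) - ?q) \<in> W (Suc k)" using W_mono_mult[OF pW(1) b(2)] i by simp
    ultimately have "(a i - ?p) * b (k - i) + ?p * (b (k - i) - ?q) \<in> W (Suc k)" by (rule WD(2))
    then show "a i * b (k - i) - ?p * ?q \<in> W (Suc k)" by (simp add: algebra_simps)
  qed
  finally show "(gr p \<otimes>\<^bsub>G\<^esub> gr q) k = gr (p * q) k" by (simp add: gr_def)
qed

lemma gr_one: "\<one>\<^bsub>G\<^esub> = gr 1"
  by (auto simp: assoc_graded_def graded_one_def gr_def cls_def fun_eq_iff hom_one hom_zero)

lemma gr_zero: "\<zero>\<^bsub>G\<^esub> = gr 0"
  by (auto simp: assoc_graded_def graded_zero_def gr_def cls_def fun_eq_iff hom_zero)

text \<open>Transported along \<open>gr\<close> as a homomorphic image, so that no axiom has to be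
  checked on cosets.\<close>

lemma ring_G: "ring G"
proof -
  let ?R = "\<lparr>carrier = rees, monoid.mult = (*), one = 1, ring.zero = 0, ring.add = (+)\<rparr>"
  have "ring ?R"
  proof (rule ringI)
    show "abelian_group ?R"
    proof (rule abelian_groupI)
      show "\<exists>y\<in>carrier ?R. y \<oplus>\<^bsub>?R\<^esub> x = \<zero>\<^bsub>?R\<^esub>" if "x \<in> carrier ?R" for x
        using that rees_closed(4)[of x] by (auto intro!: bexI[of _ "- x"])
    qed (auto simp: rees_closed algebra_simps)
    show "Group.monoid ?R" by (rule monoidI) (auto simp: rees_closed rees_mult algebra_simps)
  qed (auto simp: algebra_simps)
  moreover have "gr \<in> ring_hom ?R G"
    by (rule ring_hom_memI) (auto simp: carrier_G gr_mult gr_add gr_one)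
  ultimately show ?thesis
    using ring.ring_hom_imp_img_ring[of ?R gr G] carrier_G gr_zero by (simp add: assoc_graded_def)
qed

lemma gr_carrier: "p \<in> rees \<Longrightarrow> gr p \<in> carrier G"
  using carrier_G by blast

lemma gr_monom_mult:
  "x \<in> W i \<Longrightarrow> y \<in> W j \<Longrightarrow> gr (Polynomial.monom x i) \<otimes>\<^bsub>G\<^esub> gr (Polynomial.monom y j) = gr (Polynomial.monom (x * y) (i + j))"
  by (simp add: gr_mult rees_closed mult_monom)

text \<open>Serves as an upper bound, by minimality, for the ideal generated by initial
  forms.\<close>

lemma initial_ideal: "ideal (gr ` {p \<in> rees. \<forall>i. Polynomial.coeff p i \<in> initial_part g \<delta> l i}) G" (is "ideal (gr ` ?T) G")
proof (rule idealI)
  show "ring G" by (rule ring_G)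
  interpret G: ring G by (rule ring_G)
  show "subgroup (gr ` ?T) (add_monoid G)"
  proof (rule G.add.subgroupI)
    show "gr ` ?T \<subseteq> carrier G" using gr_carrier by auto
    show "gr ` ?T \<noteq> {}" using rees_closed(1) initial_part_closed(1) by force
    show "a \<oplus>\<^bsub>G\<^esub> b \<in> gr ` ?T" if ab: "a \<in> gr ` ?T" "b \<in> gr ` ?T" for a b
    proof -
      obtain p q where "p \<in> ?T" "q \<in> ?T" "a = gr p" "b = gr q" using ab by blast
      then show ?thesis using initial_part_closed(2) rees_closed(3) by (auto simp: gr_add intro!: imageI)
    qed
    show "\<ominus>\<^bsub>G\<^esub> a \<in> gr ` ?T" if a: "a \<in> gr ` ?T" for a
    proof -
      obtain p where p: "p \<in> ?T" "a = gr p" using a by blast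
      have "gr (- p) \<oplus>\<^bsub>G\<^esub> gr p = \<zero>\<^bsub>G\<^esub>" by (simp add: gr_add gr_zero)
      then have "\<ominus>\<^bsub>G\<^esub> gr p = gr (- p)"
        using p rees_closed(4) gr_carrier by (intro G.minus_equality) auto
      moreover have "- p \<in> ?T" using p(1) rees_closed(4) initial_part_uminus by auto
      ultimately show ?thesis using p(2) by auto
    qed
  qed
  have l: "x \<otimes>\<^bsub>G\<^esub> a \<in> gr ` ?T \<and> a \<otimes>\<^bsub>G\<^esub> x \<in> gr ` ?T" if a: "a \<in> gr ` ?T" and x: "x \<in> carrier G" for a x
  proof -
    obtain p q where p: "p \<in> ?T" "a = gr p" and q: "q \<in> rees" "x = gr q" using a x carrier_G by blast
    have "q * p \<in> ?T"
      using p(1) q(1) rees_mult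
    proof (simp, intro allI)
      fix k
      assume *: "p \<in> rees \<and> (\<forall>i. Polynomial.coeff p i \<in> initial_part g \<delta> l i)"
      show "Polynomial.coeff (q * p) k \<in> initial_part g \<delta> l k"
        unfolding coeff_mult
      proof (rule initial_part_sum)
        fix i assume i: "i \<in> {..k}"
        have "Polynomial.coeff q i \<in> W i" using q(1) by (auto simp: rees_def)
        from initial_part_closed(3)[OF this, of "Polynomial.coeff p (k - i)" g \<delta> l "k - i"] *
        show "Polynomial.coeff q i * Polynomial.coeff p (k - i) \<in> initial_part g \<delta> l k" using i by simp
      qed
    qed
    moreover have "x \<otimes>\<^bsub>G\<^esub> a = gr (q * p)" "a \<otimes>\<^bsub>G\<^esub> x = gr (q * p)"
      using p q by (auto simp: gr_mult mult.commute)
    ultimately show ?thesis by auto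
  qed
  show "x \<otimes>\<^bsub>G\<^esub> a \<in> gr ` ?T" "a \<otimes>\<^bsub>G\<^esub> x \<in> gr ` ?T" if "a \<in> gr ` ?T" "x \<in> carrier G" for a x
    using l[OF that] by auto
qed

text \<open>For homogeneous elements, membership in the ideal of the initial forms can be tested in
  a single degree of the filtration. This is what makes regularity in the graded ring usable for
  lifts.\<close>

lemma gr_monom_in_Idl_iff:
  assumes g: "\<And>j. j < l \<Longrightarrow> g j \<in> W (\<delta> j)" and z: "z \<in> W i"
  shows "gr (Polynomial.monom z i) \<in> Idl\<^bsub>G\<^esub> ((\<lambda>j. gr (Polynomial.monom (g j) (\<delta> j))) ` {..<l}) \<longleftrightarrow>
    z \<in> initial_part g \<delta> l i"
proof
  interpret G: ring G by (rule ring_G)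
  let ?T = "{p \<in> rees. \<forall>i. Polynomial.coeff p i \<in> initial_part g \<delta> l i}"
  let ?S = "\<lambda>l. (\<lambda>j. gr (Polynomial.monom (g j) (\<delta> j))) ` {..<l}"
  assume "gr (Polynomial.monom z i) \<in> Idl\<^bsub>G\<^esub> (?S l)"
  moreover have "?S l \<subseteq> gr ` ?T"
    using g initial_part_gen initial_part_closed(1) by (auto simp: rees_closed(5) intro!: imageI)
  ultimately have "gr (Polynomial.monom z i) \<in> gr ` ?T" using G.genideal_minimal[OF initial_ideal] by blast
  then obtain p where p: "p \<in> ?T" "gr (Polynomial.monom z i) = gr p" by blast
  then have "z - Polynomial.coeff p i \<in> W (Suc i)" using gr_eq_iff[of "Polynomial.monom z i" p] by (auto dest: spec[of _ i])
  then have "z - Polynomial.coeff p i + Polynomial.coeff p i \<in> initial_part g \<delta> l i"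
    using p(1) by (intro initial_part_closed(2)[OF subsetD[OF initial_part_closed(4)]]) auto
  then show "z \<in> initial_part g \<delta> l i" by simp
next
  interpret G: ring G by (rule ring_G)
  let ?S = "\<lambda>l. (\<lambda>j. gr (Polynomial.monom (g j) (\<delta> j))) ` {..<l}"
  assume "z \<in> initial_part g \<delta> l i"
  then show "gr (Polynomial.monom z i) \<in> Idl\<^bsub>G\<^esub> (?S l)"
    using g z
  proof (induction l arbitrary: z)
    case 0
    then have "gr (Polynomial.monom z i) = gr 0" unfolding gr_eq_iff using WD(1) by auto
    then show ?case using additive_subgroup.zero_closed[OF ideal.axioms(1)[OF G.genideal_ideal[of "{}"]]] by (simp add: gr_zero)
  next
    case (Suc l)
    have Sc: "?S (Suc l) \<subseteq> carrier G" using Suc.prems(2) by (auto intro: gr_carrier rees_closed(5))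
    interpret I: ideal "Idl\<^bsub>G\<^esub> (?S (Suc l))" G by (rule G.genideal_ideal[OF Sc])
    have sub: "Idl\<^bsub>G\<^esub> (?S l) \<subseteq> Idl\<^bsub>G\<^esub> (?S (Suc l))"
      using G.genideal_self[OF Sc] by (intro G.genideal_minimal I.is_ideal) auto
    have gl: "g l \<in> W (\<delta> l)" "gr (Polynomial.monom (g l) (\<delta> l)) \<in> Idl\<^bsub>G\<^esub> (?S (Suc l))"
      using Suc.prems(2) G.genideal_self[OF Sc] by auto
    obtain u where u: "if \<delta> l \<le> i then u \<in> W (i - \<delta> l) else u = 0" "z - u * g l \<in> initial_part g \<delta> l i"
      using Suc.prems(1) by auto
    have ug: "u * g l \<in> W i" using u(1) gl(1) W_mono_mult[of u "i - \<delta> l" "g l" "\<delta> l" i] WD(1) by (auto split: if_splits)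
    have 1: "gr (Polynomial.monom (z - u * g l) i) \<in> Idl\<^bsub>G\<^esub> (?S (Suc l))"
      using Suc.IH[OF u(2)] Suc.prems(2) WD(5)[OF Suc.prems(3) ug] sub by auto
    have "gr (Polynomial.monom (u * g l) i) \<in> Idl\<^bsub>G\<^esub> (?S (Suc l))"
    proof (cases "\<delta> l \<le> i")
      case True
      then have "gr (Polynomial.monom u (i - \<delta> l)) \<otimes>\<^bsub>G\<^esub> gr (Polynomial.monom (g l) (\<delta> l)) = gr (Polynomial.monom (u * g l) i)"
        using u(1) gl(1) by (simp add: gr_monom_mult)
      then show ?thesis using I.I_l_closed[OF gl(2), of "gr (Polynomial.monom u (i - \<delta> l))"] u(1) True gr_carrier rees_closed(5) by auto
    next
      case False
      then have "gr (Polynomial.monom (u * g l) i) = \<zero>\<^bsub>G\<^esub>" using u(1) by (simp add: gr_zero)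
      then show ?thesis using I.zero_closed by simp
    qed
    from I.a_closed[OF 1 this] show ?case by (simp add: gr_add add_monom)
  qed
qed

lemma ord_in_enatD:
  assumes "ord_in R n x = enat k" "x \<in> carrier R"
  shows "x \<in> npow k"
proof -
  let ?A = "{enat i | i. x \<in> npow i}"
  have "enat 0 \<in> ?A" using assms(2) by force
  then have "enat k \<in> ?A" using assms(1) unfolding ord_in_def by (intro enat_Sup_mem) blast+
  then show ?thesis by auto
qed

lemma ord_in_ge: "x \<in> npow i \<Longrightarrow> enat i \<le> ord_in R n x"
  unfolding ord_in_def by (rule Sup_upper) blast

lemma initial_form_gr:
  assumes "ord_in R n (\<phi> x) = enat k"
  shows "initial_form R n (\<phi> x) = gr (Polynomial.monom x k)"
  using assms by (auto simp: initial_form_def gr_def cls_def fun_eq_iff hom_zero)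

lemma initial_forms_regular:
  assumes reg: "regular_seq G (map (initial_form R n) (map \<phi> (map g [0..<c])))"
  obtains \<delta> where "\<And>j. j < c \<Longrightarrow> ord_in R n (\<phi> (g j)) = enat (\<delta> j)" "\<And>j. j < c \<Longrightarrow> g j \<in> W (\<delta> j)"
    "\<And>l a t. l < c \<Longrightarrow> t \<in> W a \<Longrightarrow> g l * t \<in> initial_part g \<delta> l (\<delta> l + a) \<Longrightarrow> t \<in> initial_part g \<delta> l a"
proof -
  interpret G: ring G by (rule ring_G)
  let ?xs = "map (initial_form R n) (map \<phi> (map g [0..<c]))"
  have R1: "set ?xs \<subseteq> carrier G" "Idl\<^bsub>G\<^esub> (set ?xs) \<noteq> carrier G" and
    R2: "\<And>i y. i < c \<Longrightarrow> y \<in> carrier G \<Longrightarrow> ?xs ! i \<otimes>\<^bsub>G\<^esub> y \<in> Idl\<^bsub>G\<^esub> (set (take i ?xs)) \<Longrightarrow> y \<in> Idl\<^bsub>G\<^esub> (set (take i ?xs))"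
    using reg by (auto simp: regular_seq_def)
  have nth: "?xs ! j = initial_form R n (\<phi> (g j))" if "j < c" for j using that by simp
  have tk: "set (take j ?xs) \<subseteq> carrier G" for j using R1(1) set_take_subset by (meson order_trans)
  \<comment> \<open>An element of infinite order has initial form 0, and a zero entry of a regular
    sequence forces 1 into the ideal of the earlier entries, against properness.\<close>
  have fin: "\<exists>k. ord_in R n (\<phi> (g j)) = enat k" if j: "j < c" for j
  proof (rule ccontr)
    assume "\<not> ?thesis"
    then have "?xs ! j = \<zero>\<^bsub>G\<^esub>"
      unfolding nth[OF j] by (auto simp: initial_form_def gr_zero gr_def cls_def hom_zero fun_eq_iff)
    then have "?xs ! j \<otimes>\<^bsub>G\<^esub> \<one>\<^bsub>G\<^esub> \<in> Idl\<^bsub>G\<^esub> (set (take j ?xs))"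
      using additive_subgroup.zero_closed[OF ideal.axioms(1)[OF G.genideal_ideal[OF tk]]] by simp
    then have "\<one>\<^bsub>G\<^esub> \<in> Idl\<^bsub>G\<^esub> (set (take j ?xs))" by (rule R2[OF j G.one_closed])
    moreover have "Idl\<^bsub>G\<^esub> (set (take j ?xs)) \<subseteq> Idl\<^bsub>G\<^esub> (set ?xs)"
      using G.genideal_self[OF R1(1)] set_take_subset[of j ?xs] by (intro G.genideal_minimal G.genideal_ideal R1(1)) blast
    ultimately have "Idl\<^bsub>G\<^esub> (set ?xs) = carrier G"
      using ideal.one_imp_carrier[OF G.genideal_ideal[OF R1(1)]] by blast
    then show False using R1(2) by blast
  qed
  then have "\<forall>j. \<exists>k. j < c \<longrightarrow> ord_in R n (\<phi> (g j)) = enat k" by blast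
  from choice[OF this] obtain \<delta> where \<delta>: "\<And>j. j < c \<Longrightarrow> ord_in R n (\<phi> (g j)) = enat (\<delta> j)" by blast
  have gW: "g j \<in> W (\<delta> j)" if "j < c" for j using ord_in_enatD[OF \<delta>[OF that] closed] by (simp add: W_def)
  have st: "set (take l ?xs) = (\<lambda>j. gr (Polynomial.monom (g j) (\<delta> j))) ` {..<l}" if "l < c" for l
  proof -
    have "set (take l ?xs) = (\<lambda>j. initial_form R n (\<phi> (g j))) ` {..<l}"
      using that by (auto simp: take_map atLeast0LessThan)
    also have "\<dots> = (\<lambda>j. gr (Polynomial.monom (g j) (\<delta> j))) ` {..<l}"
      using that initial_form_gr[OF \<delta>] by (intro image_cong) auto
    finally show ?thesis .
  qed
  have "t \<in> initial_part g \<delta> l a" if l: "l < c" and t: "t \<in> W a" and m: "g l * t \<in> initial_part g \<delta> l (\<delta> l + a)" for l a t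
  proof -
    have gl: "\<And>j. j < l \<Longrightarrow> g j \<in> W (\<delta> j)" using gW l by simp
    have "?xs ! l \<otimes>\<^bsub>G\<^esub> gr (Polynomial.monom t a) = gr (Polynomial.monom (g l * t) (\<delta> l + a))"
      unfolding nth[OF l] initial_form_gr[OF \<delta>[OF l]] by (rule gr_monom_mult[OF gW[OF l] t])
    then have "?xs ! l \<otimes>\<^bsub>G\<^esub> gr (Polynomial.monom t a) \<in> Idl\<^bsub>G\<^esub> (set (take l ?xs))"
      using gr_monom_in_Idl_iff[OF gl W_mult[OF gW[OF l] t]] m st[OF l] by simp
    then have "gr (Polynomial.monom t a) \<in> Idl\<^bsub>G\<^esub> (set (take l ?xs))"
      by (rule R2[OF l gr_carrier[OF rees_closed(5)[OF t]]])
    then show ?thesis using gr_monom_in_Idl_iff[OF gl t] st[OF l] by simp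
  qed
  then show ?thesis using that \<delta> gW by blast
qed

end

section \<open>Orders of differentials\<close>

context cring
begin

lemma fvec_0: "fvec R 0 = {\<lambda>i. \<zero>}"
  by (auto simp: fvec_def)

lemma mat_app_0: "mat_app R D l 0 v = (\<lambda>i. \<zero>)" "mat_app R D 0 k v = (\<lambda>i. \<zero>)"
  by (auto simp: mat_app_def)

lemma fvec_zero: "(\<lambda>i. \<zero>) \<in> fvec R k"
  by (simp add: fvec_def)

lemma mat_im_0: "mat_im R D l 0 = {\<lambda>i. \<zero>}" "mat_im R D 0 k = {\<lambda>i. \<zero>}"
  using fvec_zero[of k] by (auto simp: mat_im_def fvec_0 mat_app_0)

lemma mat_ker_0: "mat_ker R D l 0 = {\<lambda>i. \<zero>}"
  by (auto simp: mat_ker_def fvec_0 mat_app_0)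

text \<open>A resolution can be cut off at a zero term and stays exact. Hence infinite projective
  dimension makes all ranks nonzero, which provides a basis vector in every degree.\<close>

lemma finite_proj_dim_if_rank_0:
  assumes res: "free_resolution R M b d e" and z: "b k = 0"
  shows "finite_proj_dim R M"
proof -
  define b' where "b' i = (if i < k then b i else 0)" for i
  have b: "b' i = b i" if "i \<le> k" for i using that z by (auto simp: b'_def le_less)
  have "free_resolution R M b' d e"
    unfolding free_resolution_def
  proof (intro conjI allI impI)
    show "j < b' 0 \<Longrightarrow> e j \<in> carrier M" for j using res b[of 0] by (simp add: free_resolution_def)
    show "\<forall>x\<in>carrier M. \<exists>v\<in>fvec R (b' 0). aug M e (b' 0) v = x" using res b[of 0] by (simp add: free_resolution_def)
    show "{v \<in> fvec R (b' 0). aug M e (b' 0) v = \<zero>\<^bsub>M\<^esub>} = mat_im R (d 1) (b' 0) (b' 1)"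
    proof (cases "k = 0")
      case True
      then show ?thesis using res z by (simp add: free_resolution_def b'_def mat_im_0)
    next
      case False
      then show ?thesis using res b[of 0] b[of 1] by (simp add: free_resolution_def)
    qed
    fix i :: nat assume i: "1 \<le> i"
    have r: "is_matrix R (d i) (b (i - 1)) (b i)" "mat_ker R (d i) (b (i - 1)) (b i) = mat_im R (d (Suc i)) (b i) (b (Suc i))"
      using res i by (auto simp: free_resolution_def)
    show "is_matrix R (d i) (b' (i - 1)) (b' i)" using r(1) by (auto simp: is_matrix_def b'_def)
    show "mat_ker R (d i) (b' (i - 1)) (b' i) = mat_im R (d (Suc i)) (b' i) (b' (Suc i))"
    proof (cases "i < k")
      case True
      then show ?thesis using r(2) b[of "i - 1"] b[of i] b[of "Suc i"] by simp
    next
      case False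
      then show ?thesis by (simp add: b'_def mat_ker_0 mat_im_0)
    qed
  qed
  then show ?thesis unfolding finite_proj_dim_def by (intro exI[of _ b'] exI[of _ d] exI[of _ e] exI[of _ k]) (auto simp: b'_def)
qed

end

section \<open>Lifting the resolution and bounding the orders\<close>

context presented_filtration
begin

text \<open>The powers of the maximal ideal of the quotient are images of the powers of
  \<open>n\<close>; products and sums lift one by one.\<close>

lemma quot_pow_lift:
  assumes I: "ideal I R" and a: "a \<in> idealpow (R Quot I) (quot_ideal R I n) k"
  shows "\<exists>p\<in>W k. I +> \<phi> p = a"
proof -
  interpret A: ring_presentation "R Quot I" "\<lambda>x. I +> \<phi> x" by (rule vimage_quot(1)[OF I])
  show ?thesis using a
  proof (induction k arbitrary: a)
    case 0
    then show ?case using A.surj W_0 by auto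
  next
    case (Suc k)
    then have "a \<in> ideal_prod (R Quot I) (quot_ideal R I n) (idealpow (R Quot I) (quot_ideal R I n) k)" by simp
    then show ?case
    proof (induction rule: ideal_prod.induct)
      case (prod x y)
      obtain q where "q \<in> n" "x = I +> q" using prod(1) by (auto simp: quot_ideal_def)
      then obtain p where p: "p \<in> W 1" "x = I +> \<phi> p" using surj[of q] ideal.Icarr[OF n, of q] W_1 by auto
      obtain p' where "p' \<in> W k" "I +> \<phi> p' = y" using Suc.IH[OF prod(2)] by blast
      then show ?case using W_mult[OF p(1), of p' k] A.hom_mult[of p p'] p(2) by (intro bexI[of _ "p * p'"]) auto
    next
      case (sum s1 s2)
      then obtain p q where "p \<in> W (Suc k)" "q \<in> W (Suc k)" "I +> \<phi> p = s1" "I +> \<phi> q = s2" by blast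
      then show ?case using A.hom_add[of p q] WD(2) by (intro bexI[of _ "p + q"]) auto
    qed
  qed
qed

lemma order_of_differentials:
  fixes g :: "nat \<Rightarrow> 'p" and c :: nat
  defines "fs \<equiv> map \<phi> (map g [0..<c])"
  defines "I \<equiv> Idl (set fs)"
  assumes rloc: "regular_local_ring R n" and c: "0 < c" and in_n2: "set fs \<subseteq> npow 2"
    and Qreg: "regular_seq R fs" and Greg: "regular_seq G (map (initial_form R n) fs)"
    and dec: "\<And>j. j < c \<Longrightarrow> ord_in R n (\<phi> (g j)) \<le> ord_in R n (\<phi> (g 0))"
    and infpd: "\<not> finite_proj_dim (R Quot I) M"
    and res: "minimal_resolution (R Quot I) (quot_ideal R I n) M b d e"
  shows "\<exists>N. \<forall>i\<ge>N. ord_map (R Quot I) (quot_ideal R I n) (d i) (b (i - 1)) (b i) \<le> ord_in R n (\<phi> (g 0)) - 1"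
proof -
  let ?A = "R Quot I" and ?m = "quot_ideal R I n" and ?\<psi> = "\<lambda>p. I +> \<phi> p"
  have fsc: "set fs \<subseteq> carrier R" by (auto simp: fs_def)
  have I: "ideal I R" unfolding I_def by (rule genideal_ideal[OF fsc])
  interpret A: ring_presentation ?A ?\<psi> by (rule vimage_quot(1)[OF I])
  have "set fs = \<phi> ` g ` {..<c}" by (auto simp: fs_def)
  then have Ac: "A.ker = gen_ideal ker g c" using vimage_quot(2)[OF I] vimage_Idl[of g c] by (simp add: I_def)

  obtain \<delta> where \<delta>: "\<And>j. j < c \<Longrightarrow> ord_in R n (\<phi> (g j)) = enat (\<delta> j)" "\<And>j. j < c \<Longrightarrow> g j \<in> W (\<delta> j)"
    "\<And>l a t. l < c \<Longrightarrow> t \<in> W a \<Longrightarrow> g l * t \<in> initial_part g \<delta> l (\<delta> l + a) \<Longrightarrow> t \<in> initial_part g \<delta> l a"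
    using initial_forms_regular[OF Greg[unfolded fs_def]] by blast
  have \<delta>2: "2 \<le> \<delta> j" if "j < c" for j
  proof -
    have "\<phi> (g j) \<in> npow 2" using in_n2 that by (auto simp: fs_def)
    then show ?thesis using ord_in_ge[of "\<phi> (g j)" 2] \<delta>(1)[OF that] by simp
  qed
  have \<delta>1: "1 \<le> \<delta> j" if "j < c" for j using \<delta>2[OF that] by simp
  have \<delta>0: "\<delta> j \<le> \<delta> 0" if "j < c" for j using dec[OF that] \<delta>(1)[OF that] \<delta>(1)[OF c] by simp
  have gN: "g j \<in> W 1" if "j < c" for j using \<delta>(2)[OF that] \<delta>2[OF that] W_antimono[of 1 "\<delta> j"] by auto

  have frees: "free_resolution ?A M b d e" and min: "\<And>i r s. 1 \<le> i \<Longrightarrow> r < b (i - 1) \<Longrightarrow> s < b i \<Longrightarrow> d i r s \<in> ?m"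
    using res by (auto simp: minimal_resolution_def)
  have b0: "b i \<noteq> 0" for i using A.finite_proj_dim_if_rank_0[OF frees] infpd by blast
  have exact: "mat_ker ?A (d i) (b (i - 1)) (b i) = mat_im ?A (d (Suc i)) (b i) (b (Suc i))" if "1 \<le> i" for i
    using frees that by (auto simp: free_resolution_def)

  define big where "big i \<longleftrightarrow> (\<forall>r<b (i - 1). \<forall>s<b i. \<exists>p\<in>W (\<delta> 0). ?\<psi> p = d i r s)" for i
  \<comment> \<open>The lift is fixed for all degrees at once, so the choice itself must prefer
    entries of order \<open>\<delta> 0\<close> wherever such lifts exist.\<close>
  define L where "L i r s = (SOME p. ?\<psi> p = d i r s \<and> p \<in> W 1 \<and> (big i \<longrightarrow> p \<in> W (\<delta> 0)))" for i r s
  have L: "?\<psi> (L i r s) = d i r s \<and> L i r s \<in> W 1 \<and> (big i \<longrightarrow> L i r s \<in> W (\<delta> 0))"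
    if irs: "1 \<le> i" "r < b (i - 1)" "s < b i" for i r s
    unfolding L_def
  proof (rule someI_ex, cases "big i")
    case True
    then have "\<exists>p\<in>W (\<delta> 0). ?\<psi> p = d i r s" using irs unfolding big_def by blast
    then obtain p where "p \<in> W (\<delta> 0)" "?\<psi> p = d i r s" by blast
    moreover from this have "p \<in> W 1" using W_antimono[of 1 "\<delta> 0"] \<delta>2[OF c] by auto
    ultimately show "\<exists>p. ?\<psi> p = d i r s \<and> p \<in> W 1 \<and> (big i \<longrightarrow> p \<in> W (\<delta> 0))" by blast
  next
    case False
    obtain q where "q \<in> n" "d i r s = I +> q" using min[OF irs] by (auto simp: quot_ideal_def)
    then obtain p where "p \<in> W 1" "d i r s = ?\<psi> p" using surj[of q] ideal.Icarr[OF n, of q] W_1 by auto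
    then show "\<exists>p. ?\<psi> p = d i r s \<and> p \<in> W 1 \<and> (big i \<longrightarrow> p \<in> W (\<delta> 0))" using False by auto
  qed

  define S where "S m = (if m < 0 then {} else {..<b (nat m)})" for m :: int
  define D :: "'p vec \<Rightarrow> 'p vec" where
    "D v = (\<lambda>m r. if r \<in> S m then \<Sum>s<b (Suc (nat m)). L (Suc (nat m)) r s * v (m + 1) s else 0)" for v
  have Sn: "S (int k) = {..<b k}" for k by (simp add: S_def)
  have finS: "finite (S m)" for m by (simp add: S_def)
  have Dap: "D v (int k) r = (if r < b k then \<Sum>s<b (Suc k). L (Suc k) r s * v (int (Suc k)) s else 0)" for v k r
    by (simp add: D_def Sn add.commute)
  have linD: "lin D"
  proof -
    have "D (v + w) m r = D v m r + D w m r" for v w m r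
      unfolding D_def plus_fun_apply distrib_left sum.distrib by simp
    moreover have "D (smul a v) m r = a * D v m r" for a v m r
      unfolding D_def smul_apply mult.left_commute[of _ a] by (simp add: sum_distrib_left)
    ultimately show ?thesis by (simp add: lin_def fun_eq_iff)
  qed
  have homD: "homog S 1 D"
    unfolding homog_def graded_free_def mem_Collect_eq
  proof (intro allI ballI impI)
    fix n m :: int and v :: "'p vec" and i
    assume v: "v \<in> {v. \<forall>m i. v m i \<noteq> 0 \<longrightarrow> m = n \<and> i \<in> S m}" and nz: "D v m i \<noteq> 0"
    have i: "i \<in> S m" using nz by (simp add: D_def split: if_splits)
    have "m + 1 = n"
    proof (rule ccontr)
      assume "m + 1 \<noteq> n"
      then have "v (m + 1) s = 0" for s using v by blast
      then show False using nz by (simp add: D_def split: if_splits)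
    qed
    then show "m = n - 1 \<and> i \<in> S m" using i by auto
  qed
  let ?F = "graded_free S :: int \<Rightarrow> 'p vec set"
  have Fneg: "v = 0" if "v \<in> ?F m" "m < 0" for v m
  proof -
    have "S m = {}" using that(2) by (simp add: S_def)
    then have "v m' i = 0" for m' i using that(1) unfolding graded_free_def by blast
    then show ?thesis by (simp add: fun_eq_iff)
  qed
  have F0: "v m i = 0" if "v \<in> ?F (int k)" "m \<noteq> int k \<or> \<not> i < b k" for v m i k
    using that Sn[of k] unfolding graded_free_def by blast
  \<comment> \<open>Reduces the degree \<open>k\<close> part of a lifted vector to a vector over the
    quotient ring, where the exactness of the resolution is stated.\<close>
  define vec where "vec v k = (\<lambda>s. ?\<psi> (v (int k) s))" for v :: "'p vec" and k :: nat
  have psi0: "?\<psi> 0 = \<zero>\<^bsub>?A\<^esub>" by (rule A.hom_zero)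
  have vec_F: "vec v k \<in> fvec ?A (b k)" if "v \<in> ?F (int k)" for v k
    using F0[OF that] psi0 A.closed by (auto simp: fvec_def vec_def)
  have vec_D: "vec (D v) k = mat_app ?A (d (Suc k)) (b k) (b (Suc k)) (vec v (Suc k))" for v k
  proof (rule ext)
    fix r
    show "vec (D v) k r = mat_app ?A (d (Suc k)) (b k) (b (Suc k)) (vec v (Suc k)) r"
    proof (cases "r < b k")
      case True
      have "?\<psi> (\<Sum>s<b (Suc k). L (Suc k) r s * v (int (Suc k)) s) =
        (\<Oplus>\<^bsub>?A\<^esub>s\<in>{..<b (Suc k)}. d (Suc k) r s \<otimes>\<^bsub>?A\<^esub> ?\<psi> (v (int (Suc k)) s))"
        unfolding A.hom_sum
      proof (rule A.finsum_cong')
        have dL: "d (Suc k) r s = ?\<psi> (L (Suc k) r s)" if "s < b (Suc k)" for s using L[of "Suc k" r s] that True by simp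
        then show "(\<lambda>s. d (Suc k) r s \<otimes>\<^bsub>?A\<^esub> ?\<psi> (v (int (Suc k)) s)) \<in> {..<b (Suc k)} \<rightarrow> carrier ?A"
          using A.m_closed[OF A.closed A.closed] by (auto simp: Pi_def)
        show "?\<psi> (L (Suc k) r s * v (int (Suc k)) s) = d (Suc k) r s \<otimes>\<^bsub>?A\<^esub> ?\<psi> (v (int (Suc k)) s)"
          if "s \<in> {..<b (Suc k)}" for s using dL that A.hom_mult by simp
      qed simp
      then show ?thesis using True by (simp add: vec_def mat_app_def Dap)
    next
      case False
      then show ?thesis using psi0 by (simp add: vec_def mat_app_def Dap)
    qed
  qed
  have vec_zero: "vin A.ker v \<longleftrightarrow> vec v k = (\<lambda>i. \<zero>\<^bsub>?A\<^esub>)" if vF: "v \<in> ?F (int k)" for v k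
  proof
    assume "vin A.ker v"
    then show "vec v k = (\<lambda>i. \<zero>\<^bsub>?A\<^esub>)" by (auto simp: vin_def A.ker_def vec_def)
  next
    assume z: "vec v k = (\<lambda>i. \<zero>\<^bsub>?A\<^esub>)"
    have "v m i \<in> A.ker" for m i
    proof (cases "m = int k")
      case True
      then show ?thesis using fun_cong[OF z, of i] by (simp add: vec_def A.ker_def)
    next
      case False
      then have "v m i = 0" by (intro F0[OF vF]) simp
      then show ?thesis using psi0 by (simp add: A.ker_def)
    qed
    then show "vin A.ker v" by (simp add: vin_def)
  qed
  have dF: "D v \<in> ?F (int k)" if "v \<in> ?F (int (Suc k))" for v k
    using homogD[OF homD that] by simp

  have homDD: "homog S 2 (\<lambda>v. D (D v))"
    unfolding homog_def by (intro allI ballI homogD[OF homD homogD[OF homD _ refl]]) auto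
  have "vin (gen_ideal ker g c) (D (D v))" if v: "v \<in> ?F m" for m v
  \<comment> \<open>The lifted complex ends in degree 0 without the augmentation, so below degree 2
    the square of \<open>D\<close> has negative degree and vanishes.\<close>
  proof (cases "m < 2")
    case True
    have "D (D v) \<in> ?F (m - 2)" using homDD v by (auto simp: homog_def)
    then have "D (D v) = 0" using Fneg True by auto
    then show ?thesis using vinD(1)[OF gen_ideal_ideal[OF ker_ideal]] by simp
  next
    case False
    then have "m = int (Suc (Suc (nat (m - 2))))" by simp
    then obtain k where k: "m = int (Suc (Suc k))" by blast
    have v': "v \<in> ?F (int (Suc (Suc k)))" using v k by simp
    have "vec (D v) (Suc k) \<in> mat_im ?A (d (Suc (Suc k))) (b (Suc k)) (b (Suc (Suc k)))"
      unfolding vec_D mat_im_def using vec_F[OF v'] by blast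
    then have "vec (D v) (Suc k) \<in> mat_ker ?A (d (Suc k)) (b k) (b (Suc k))" using exact[of "Suc k"] by simp
    then have "vec (D (D v)) k = (\<lambda>i. \<zero>\<^bsub>?A\<^esub>)" unfolding vec_D[of "D v"] by (simp add: mat_ker_def)
    then show ?thesis using vec_zero[OF dF[OF dF[OF v']]] Ac by simp
  qed
  moreover have "lin (\<lambda>v. D (D v))" using lin_simps(1,2)[OF linD] by (simp add: lin_def)
  ultimately obtain T where T: "\<And>j. j < c \<Longrightarrow> lin (T j)" "\<And>j. j < c \<Longrightarrow> homog S 2 (T j)"
    "\<And>m v. v \<in> ?F m \<Longrightarrow> vin ker (D (D v) - (\<Sum>j<c. smul (g j) (T j v)))"
    using lin_decompose[OF _ homDD finS ker_ideal] by blast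
  interpret lifted_complex ker "W 1" g c S D T
    by unfold_locales
      (use ker_ideal W_ideal ker_W gN regular_seq_mod[OF Qreg[unfolded fs_def]] finS linD homD T in \<open>auto simp: S_def\<close>)
  \<comment> \<open>Exactness starts in degree 1, since the homology in degree 0 is
    \<open>M\<close>.\<close>
  have ex: "exact_from 1"
    unfolding exact_from_def Ac[symmetric]
  proof (intro allI ballI impI)
    fix m x assume m: "1 \<le> m" and x: "x \<in> ?F m" and Dx: "vin A.ker (D x)"
    have "m = int (Suc (nat (m - 1)))" using m by simp
    then obtain k where k: "m = int (Suc k)" by blast
    have x': "x \<in> ?F (int (Suc k))" using x k by simp
    have "vec (D x) k = (\<lambda>i. \<zero>\<^bsub>?A\<^esub>)" using vec_zero[OF dF[OF x']] Dx by simp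
    then have "vec x (Suc k) \<in> mat_ker ?A (d (Suc k)) (b k) (b (Suc k))"
      using vec_F[OF x'] unfolding vec_D by (simp add: mat_ker_def)
    then obtain w where w: "w \<in> fvec ?A (b (Suc (Suc k)))"
      "vec x (Suc k) = mat_app ?A (d (Suc (Suc k))) (b (Suc k)) (b (Suc (Suc k))) w"
      using exact[of "Suc k"] by (auto simp: mat_im_def)
    have "\<forall>s. \<exists>p. s < b (Suc (Suc k)) \<longrightarrow> ?\<psi> p = w s" using w(1) A.surj by (auto simp: fvec_def)
    then obtain w' where w': "\<And>s. s < b (Suc (Suc k)) \<Longrightarrow> ?\<psi> (w' s) = w s" by metis
    define z where "z = (\<lambda>m' s. if m' = int (Suc (Suc k)) \<and> s < b (Suc (Suc k)) then w' s else 0)"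
    have z: "z \<in> ?F (int (Suc (Suc k)))" by (auto simp: z_def graded_free_def Sn simp del: of_nat_Suc)
    have "vec z (Suc (Suc k)) = w"
      using w' w(1) psi0 by (auto simp: vec_def z_def fvec_def fun_eq_iff)
    then have eq: "vec x (Suc k) = vec (D z) (Suc k)" using w(2) vec_D by simp
    have "x m' i - D z m' i \<in> A.ker" for m' i
    proof (cases "m' = int (Suc k)")
      case True
      then show ?thesis using fun_cong[OF eq, of i] A.eq_iff by (simp add: vec_def)
    next
      case False
      then have "x m' i = 0" by (intro F0[OF x']) simp
      moreover have "D z m' i = 0" using False by (intro F0[OF dF[OF z]]) simp
      ultimately show ?thesis using ring_idealD(1)[OF A.ker_ideal] by simp
    qed
    then show "\<exists>z\<in>?F (m + 1). vin A.ker (x - D z)" using z k by (intro bexI[of _ z]) (auto simp: vin_def)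
  qed

  obtain y h where y: "regular_mod ker y h" "W 1 = gen_ideal ker y h"
    using regular_parameters[OF rloc] W_1 by metis
  have nr: "Defs.noetherian_ring R" and lr: "local_ring R n" using rloc by (auto simp: regular_local_ring_def)
  have unit: "\<exists>t. t * a - 1 \<in> W 1" if "a \<notin> W 1" for a
    using local_unit[OF nr lr, of a] that ker_W W_1 by blast
  have one: "1 \<notin> W 1"
  proof
    assume "1 \<in> W 1"
    then have "\<one> \<in> n" using W_1 hom_one by auto
    then have "n = carrier R" using ideal.one_imp_carrier[OF n] by blast
    then show False using lr maximalideal.I_notcarr by (auto simp: local_ring_def)
  qed
  have dcc: dcc by (rule lifted_complex_dcc[OF y unit lifted_complex_axioms ex])
  have minD: "vin (W 1) (D v)" for v
  proof -
    have "D v m r \<in> W 1" for m r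
      unfolding D_def using L[of "Suc (nat m)" r] WD(1)
      by (auto simp: S_def intro!: ring_ideal_sum[OF W_ideal] WD(4) split: if_splits)
    then show ?thesis by (simp add: vin_def)
  qed
  \<comment> \<open>The shift by one is due to the square of \<open>D\<close>: on degree
    \<open>i + 1\<close> its second factor is the differential \<open>d i\<close>.\<close>
  have ne: "S m \<noteq> {}" if "m \<in> {int (Suc i) | i. 1 \<le> i \<and> big i}" for m using that b0 by (auto simp: S_def)
  have van: "vin (W 1) (T j v)" if m: "m \<in> {int (Suc i) | i. 1 \<le> i \<and> big i}" and j: "j < c" and v: "v \<in> ?F m" for m j v
  proof -
    obtain i' where i': "m = int (Suc i')" "1 \<le> i'" "big i'" using m by blast
    then obtain i where "i' = Suc i" by (cases i') auto
    then have i: "m = int (Suc (Suc i))" "big (Suc i)" using i' by auto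
    have v': "v \<in> ?F (int (Suc (Suc i)))" using v i by simp
    have DDF: "D (D v) \<in> ?F (int i)" using dF[OF dF[OF v']] .
    \<comment> \<open>The lifted matrix contributes order \<open>\<delta> 0\<close> and
      \<open>D v\<close> one more by minimality. This extra order excludes units as coefficients of
      the \<open>g j\<close>.\<close>
    have DDW: "D (D v) m' r \<in> W (Suc (\<delta> 0))" for m' r
    proof (cases "m' = int i \<and> r < b i")
      case True
      have "L (Suc i) r s * D v (int (Suc i)) s \<in> W (Suc (\<delta> 0))" if "s < b (Suc i)" for s
        using L[of "Suc i" r s] True that i(2) minD[of v]
        by (intro W_mono_mult[where i = "\<delta> 0" and j = 1]) (auto simp: vin_def)
      then show ?thesis using True by (auto simp: Dap intro!: ring_ideal_sum[OF W_ideal] simp del: of_nat_Suc)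
    next
      case False
      then have "D (D v) m' r = 0" by (intro F0[OF DDF]) auto
      then show ?thesis using WD(1) by simp
    qed
    have "T j v m' r \<in> W 1" for m' r
    proof (rule coefficients_positive_order[where c = c and g = g and \<delta> = \<delta> and d = "\<delta> 0" and t = "\<lambda>j. T j v m' r"])
      have "D (D v) m' r - (\<Sum>j<c. g j * T j v m' r) \<in> W (Suc (\<delta> 0))"
        using T(3)[OF v'] ker_W unfolding vin_def by (auto simp: sum_vec_apply)
      then show "(\<Sum>j<c. g j * T j v m' r) \<in> W (Suc (\<delta> 0))"
        using WD(5)[OF DDW] by (metis diff_diff_eq2 add_diff_cancel_left' add.commute)
    qed (use \<delta>(2,3) \<delta>1 \<delta>0 j in blast)+
    then show ?thesis by (simp add: vin_def)
  qed
  have "\<exists>k::nat. \<forall>m\<in>{int (Suc i) | i. 1 \<le> i \<and> big i}. m < int k"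
  proof (rule operators_eventually_nonzero[OF dcc _ one])
    fix m j v
    show "vin (W 1) (D v)" by (rule minD)
    show "m \<in> {int (Suc i) | i. 1 \<le> i \<and> big i} \<Longrightarrow> S m \<noteq> {}" by (rule ne)
    show "m \<in> {int (Suc i) | i. 1 \<le> i \<and> big i} \<Longrightarrow> j < c \<Longrightarrow> v \<in> ?F m \<Longrightarrow> vin (W 1) (T j v)" by (rule van)
  qed
  then obtain k :: nat where k: "\<forall>m\<in>{int (Suc i) | i. 1 \<le> i \<and> big i}. m < int k" ..
  have "ord_map ?A ?m (d i) (b (i - 1)) (b i) \<le> ord_in R n (\<phi> (g 0)) - 1" if i: "Suc k \<le> i" for i
  proof -
    have nb: "\<not> big i"
    proof
      assume "big i"
      then have "int (Suc i) < int k" using i by (intro bspec[OF k]) auto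
      then show False using i by simp
    qed
    \<comment> \<open>If all entries had order at least \<open>\<delta> 0\<close>, they would lift
      to \<open>W (\<delta> 0)\<close> and \<open>i\<close> would be big.\<close>
    have "enat t \<le> enat (\<delta> 0 - 1)" if t: "\<forall>r<b (i - 1). \<forall>s<b i. d i r s \<in> idealpow ?A ?m t" for t
    proof (rule ccontr)
      assume "\<not> ?thesis"
      then have "\<delta> 0 \<le> t" by simp
      then have "big i" unfolding big_def using quot_pow_lift[OF I] t W_antimono by (meson subsetD)
      then show False using nb by blast
    qed
    then have "ord_map ?A ?m (d i) (b (i - 1)) (b i) \<le> enat (\<delta> 0 - 1)"
      unfolding ord_map_def by (intro Sup_least) auto
    then show ?thesis using \<delta>(1)[OF c] by (simp add: one_enat_def)
  qed
  then show ?thesis by blast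
qed

end

theorem theorem1p1:
  fixes Q :: "('a, 'b) ring_scheme" and n :: "'a set" and fs :: "'a list"
    and M :: "('a set, 'm, 'c) module_scheme"
    and b :: "nat \<Rightarrow> nat" and d :: "nat \<Rightarrow> nat \<Rightarrow> nat \<Rightarrow> 'a set" and e :: "nat \<Rightarrow> 'm"
  assumes reg: "regular_local_ring Q n"
    and nonempty: "fs \<noteq> []"
    and in_n2: "set fs \<subseteq> idealpow Q n 2"
    and Qreg: "regular_seq Q fs"
    and Greg: "regular_seq (assoc_graded Q n) (map (initial_form Q n) fs)"
    and ord_dec: "\<forall>i j. i \<le> j \<longrightarrow> j < length fs \<longrightarrow> ord_in Q n (fs ! j) \<le> ord_in Q n (fs ! i)"
    and modM: "module (Q Quot (Idl\<^bsub>Q\<^esub> (set fs))) M"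
    and fgM: "fin_gen_module (Q Quot (Idl\<^bsub>Q\<^esub> (set fs))) M"
    and infpd: "\<not> finite_proj_dim (Q Quot (Idl\<^bsub>Q\<^esub> (set fs))) M"
    and res: "minimal_resolution (Q Quot (Idl\<^bsub>Q\<^esub> (set fs)))
                (quot_ideal Q (Idl\<^bsub>Q\<^esub> (set fs)) n) M b d e"
  shows "\<exists>N. \<forall>i\<ge>N.
           ord_map (Q Quot (Idl\<^bsub>Q\<^esub> (set fs))) (quot_ideal Q (Idl\<^bsub>Q\<^esub> (set fs)) n)
                   (d i) (b (i - 1)) (b i)
           \<le> ord_in Q n (fs ! 0) - 1"
proof -
  have "cring Q" using reg by (simp add: regular_local_ring_def local_ring_def)
  then have "\<exists>\<phi> :: ('a multiset \<Rightarrow>\<^sub>0 int) \<Rightarrow> 'a. ring_presentation Q \<phi>" by (rule cring.presentation_exists)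
  then obtain \<phi> :: "('a multiset \<Rightarrow>\<^sub>0 int) \<Rightarrow> 'a" where \<phi>: "ring_presentation Q \<phi>" ..
  then interpret ring_presentation Q \<phi> .
  have "ideal n Q" using reg by (simp add: regular_local_ring_def local_ring_def maximalideal.axioms(1))
  then interpret presented_filtration Q \<phi> n
    by (intro presented_filtration.intro presented_filtration_axioms.intro \<phi>)
  have "set fs \<subseteq> carrier Q" using Qreg by (simp add: regular_seq_def)
  then have "\<forall>j. \<exists>p. j < length fs \<longrightarrow> \<phi> p = fs ! j" by (metis surj nth_mem subsetD)
  from choice[OF this] obtain g where "\<forall>j. j < length fs \<longrightarrow> \<phi> (g j) = fs ! j" ..
  then have g: "j < length fs \<Longrightarrow> \<phi> (g j) = fs ! j" for j by blast
  then have fs: "map \<phi> (map g [0..<length fs]) = fs" by (intro nth_equalityI) simp_all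
  have g0: "\<phi> (g 0) = fs ! 0" using g nonempty by simp
  show ?thesis
    using order_of_differentials[of "length fs" g M b d e] assms unfolding fs g0
    by (simp add: g)
qed

end
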